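(* Let $\Omega\subset\mathbb{R}^n$ be non-empty, compact and convex, let $\alpha,\beta>0$, let $Y=\mathbb{R}^m$, let $\mathcal{F}:Y\to\mathbb{R}\cup\{\infty\}$ be convex, bounded from below, proper and (weakly) lower semicontinuous, and let $K:\mathcal{A}\to Y$ be a linear map which can be extended to a linear map $L^2_w([0,1];\mathcal{M}(\Omega))\to Y$ and which is continuous in the following sense: if $(\mu^j)\subset\mathcal{A}$ and $\mu\in\mathcal{A}$ satisfy $\mu^j_t\overset{*}{\rightharpoonup}\mu_t$ for a.e. $t\in[0,1]$, then $K(\mu^j)\rightharpoonup K(\mu)$ weakly in $Y$. Then there exists a minimizer $\mu^{opt}\in\mathcal{A}$ of $$\inf_{\mu\in\mathcal{A}}\ \mathcal{F}(K(\mu))+\mathcal{R}_{\alpha,\beta}(\mu)$$ with $$\mu^{opt}_t=\sum_{i=1}^N\lambda^i\delta_{x^i_t}\qquad\text{for a.e. }t\in[0,1],$$ where $N\leq m=\dim(Y)$, $\lambda^i\in[0,\infty)$, and $(t\mapsto x^i_t)\in BV([0,1];\Omega)$ for $i=1,\ldots,N$.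
   Context: $\mathcal{P}(\Omega)$ is the set of Borel probability measures on $\Omega$, $W_1$ is the Wasserstein-1 distance on $\mathcal{P}(\Omega)$ with cost $|x-y|$, and $\mathcal{W}_1(\Omega)=(\mathcal{P}(\Omega),W_1)$. $\mathcal{M}(\Omega)=C(\Omega)^*$ is the space of signed Radon measures on $\Omega$, and $\overset{*}{\rightharpoonup}$ is weak-$*$ convergence in it. For a metric space $(X,d)$, $L^1([0,1];(X,d))$ is the set of a.e.-equivalence classes of Lebesgue measurable maps $f:[0,1]\to X$ with $d(f,x)\in L^1([0,1])$ for some $x\in X$. The variation of a map $\mu:[0,1]\to X$ is $\mathrm{var}(\mu)=\sup\{\sum_{i=1}^N d(\mu_{t_i},\mu_{t_{i-1}}) : t_0<\ldots<t_N,\ t_i\in[0,1]\}$, the essential variation of $\mu\in L^1([0,1];(X,d))$ is $\mathrm{ess\,var}(\mu)=\inf\{\mathrm{var}(\tilde\mu):\tilde\mu=\mu\text{ a.e.}\}$, and $BV([0,1];(X,d))$ is the set of $\mu\in L^1([0,1];(X,d))$ with $\mathrm{ess\,var}(\mu)<\infty$. $BV([0,1];\Omega)$ is taken with respect to the Euclidean distance. The set of admissible curves is $\mathcal{A}=[0,\infty)\cdot BV([0,1];\mathcal{W}_1(\Omega))$, i.e. $\mu\in\mathcal{A}$ iff $\mu=\omega(\mu)\rho$ with $\omega(\mu)\in[0,\infty)$ (the weight of $\mu$) and $\rho\in BV([0,1];\mathcal{W}_1(\Omega))$; its essential variation is $\mathrm{ess\,var}(\mu)=\omega(\mu)\,\mathrm{ess\,var}(\rho)$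 ($W_1$ extended by scaling to measures of equal mass). $\mathcal{A}$ is a convex cone in $L^2_w([0,1];\mathcal{M}(\Omega))$, the space of a.e.-equivalence classes of weakly measurable maps $f:[0,1]\to\mathcal{M}(\Omega)$ (i.e. $t\mapsto\int\phi\,df_t$ measurable for all $\phi\in C(\Omega)$) with $\int_0^1\|f_t\|_{\mathcal{M}}^2\,dt<\infty$, $\|\cdot\|_{\mathcal M}$ being the total variation norm. The regularizer is $\mathcal{R}_{\alpha,\beta}(\mu)=\alpha\,\omega(\mu)+\beta\,\mathrm{ess\,var}(\mu)$ for $\mu\in\mathcal{A}$. *)

theory Defs
  imports "HOL-Probability.Probability"
begin

section \<open>Curves of bounded variation in a metric space\<close>

text \<open>A metric space is given by a carrier \<open>X\<close> and a distance \<open>d\<close>. Maps on \<open>[0,1]\<close> are functions on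
  \<open>real\<close> whose values outside \<open>[0,1]\<close> are irrelevant, and an a.e.-equivalence class is given by any of
  its representatives.\<close>

definition eq_ae :: "(real \<Rightarrow> 'b) \<Rightarrow> (real \<Rightarrow> 'b) \<Rightarrow> bool" where
  "eq_ae f g \<longleftrightarrow> (AE t in lebesgue_on {0..1}. f t = g t)"

text \<open>The library's \<open>Metric_space.mopen\<close>, but with a defining equation that does not presuppose the
  metric axioms for \<open>d\<close>.\<close>

definition metric_open :: "'b set \<Rightarrow> ('b \<Rightarrow> 'b \<Rightarrow> real) \<Rightarrow> 'b set \<Rightarrow> bool" where
  "metric_open X d U \<longleftrightarrow> U \<subseteq> X \<and> (\<forall>x\<in>U. \<exists>r>0. {y \<in> X. d x y < r} \<subseteq> U)"

lemma metric_open_eq_mopen: "Metric_space X d \<Longrightarrow> metric_open X d = Metric_space.mopen X d"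
  by (rule ext) (simp add: metric_open_def Metric_space.mopen_def Metric_space.mball_def Ball_def subset_iff,
    blast)

definition L1_curves :: "'b set \<Rightarrow> ('b \<Rightarrow> 'b \<Rightarrow> real) \<Rightarrow> (real \<Rightarrow> 'b) set" where
  "L1_curves X d =
    {f \<in> lebesgue_on {0..1} \<rightarrow>\<^sub>M sigma X {U. metric_open X d U}.
      \<exists>x\<in>X. integrable (lebesgue_on {0..1}) (\<lambda>t. d (f t) x)}"

definition variation :: "('b \<Rightarrow> 'b \<Rightarrow> real) \<Rightarrow> (real \<Rightarrow> 'b) \<Rightarrow> ennreal" where
  "variation d f =
    (SUP (N, t) \<in> {(N :: nat, t :: nat \<Rightarrow> real). strict_mono_on {0..N} t \<and> t ` {0..N} \<subseteq> {0..1}}.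
      \<Sum>i=1..N. ennreal (d (f (t i)) (f (t (i - 1)))))"

definition ess_variation :: "'b set \<Rightarrow> ('b \<Rightarrow> 'b \<Rightarrow> real) \<Rightarrow> (real \<Rightarrow> 'b) \<Rightarrow> ennreal" where
  "ess_variation X d f = (INF g \<in> {g. g ` {0..1} \<subseteq> X \<and> eq_ae g f}. variation d g)"

definition BV_curves :: "'b set \<Rightarrow> ('b \<Rightarrow> 'b \<Rightarrow> real) \<Rightarrow> (real \<Rightarrow> 'b) set" where
  "BV_curves X d = {f \<in> L1_curves X d. ess_variation X d f < \<infinity>}"


section \<open>Probability measures and the Wasserstein-1 distance\<close>

definition prob_on :: "'a::euclidean_space set \<Rightarrow> 'a measure set" where
  "prob_on Om = {\<mu>. prob_space \<mu> \<and> sets \<mu> = sets (restrict_space borel Om)}"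

definition couplings :: "'a measure \<Rightarrow> 'a measure \<Rightarrow> ('a \<times> 'a) measure set" where
  "couplings \<mu> \<nu> =
    {\<pi>. prob_space \<pi> \<and> sets \<pi> = sets (\<mu> \<Otimes>\<^sub>M \<nu>) \<and> distr \<pi> \<mu> fst = \<mu> \<and> distr \<pi> \<nu> snd = \<nu>}"

definition W1 :: "'a::euclidean_space measure \<Rightarrow> 'a measure \<Rightarrow> real" where
  "W1 \<mu> \<nu> = (INF \<pi> \<in> couplings \<mu> \<nu>. \<integral>z. dist (fst z) (snd z) \<partial>\<pi>)"


section \<open>The space of Radon measures as the dual of the continuous functions\<close>

text \<open>A function on \<open>Om\<close> is represented by its extension by \<open>0\<close>, and a functional on \<open>C_space Om\<close> by
  its extension by \<open>0\<close>, so that equality of elements of either space is equality in HOL.\<close>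

definition C_space :: "'a::euclidean_space set \<Rightarrow> ('a \<Rightarrow> real) set" where
  "C_space Om = {\<phi>. continuous_on Om \<phi> \<and> (\<forall>x. x \<notin> Om \<longrightarrow> \<phi> x = 0)}"

definition M_space :: "'a::euclidean_space set \<Rightarrow> (('a \<Rightarrow> real) \<Rightarrow> real) set" where
  "M_space Om =
    {L. (\<forall>\<phi>\<in>C_space Om. \<forall>\<psi>\<in>C_space Om. L (\<lambda>x. \<phi> x + \<psi> x) = L \<phi> + L \<psi>) \<and>
        (\<forall>c. \<forall>\<phi>\<in>C_space Om. L (\<lambda>x. c * \<phi> x) = c * L \<phi>) \<and>
        (\<exists>B. \<forall>\<phi>\<in>C_space Om. \<bar>L \<phi>\<bar> \<le> B * (SUP x\<in>Om. \<bar>\<phi> x\<bar>)) \<and>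
        (\<forall>\<phi>. \<phi> \<notin> C_space Om \<longrightarrow> L \<phi> = 0)}"

text \<open>The dual norm, which is the total variation norm of the representing measure.\<close>

definition M_norm :: "'a::euclidean_space set \<Rightarrow> (('a \<Rightarrow> real) \<Rightarrow> real) \<Rightarrow> real" where
  "M_norm Om L = (SUP \<phi> \<in> {\<phi> \<in> C_space Om. \<forall>x\<in>Om. \<bar>\<phi> x\<bar> \<le> 1}. \<bar>L \<phi>\<bar>)"

definition weak_star_tendsto ::
    "'a::euclidean_space set \<Rightarrow> (nat \<Rightarrow> ('a \<Rightarrow> real) \<Rightarrow> real) \<Rightarrow> (('a \<Rightarrow> real) \<Rightarrow> real) \<Rightarrow> bool" where
  "weak_star_tendsto Om Ls L \<longleftrightarrow> (\<forall>\<phi>\<in>C_space Om. (\<lambda>j. Ls j \<phi>) \<longlonglongrightarrow> L \<phi>)"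

definition radon :: "'a::euclidean_space set \<Rightarrow> 'a measure \<Rightarrow> ('a \<Rightarrow> real) \<Rightarrow> real" where
  "radon Om \<mu> = (\<lambda>\<phi>. if \<phi> \<in> C_space Om then \<integral>x. \<phi> x \<partial>\<mu> else 0)"

definition dirac :: "'a::euclidean_space set \<Rightarrow> 'a \<Rightarrow> ('a \<Rightarrow> real) \<Rightarrow> real" where
  "dirac Om x = radon Om (return (restrict_space borel Om) x)"

definition L2w :: "'a::euclidean_space set \<Rightarrow> (real \<Rightarrow> ('a \<Rightarrow> real) \<Rightarrow> real) set" where
  "L2w Om =
    {f. f ` {0..1} \<subseteq> M_space Om \<and>
        (\<forall>\<phi>\<in>C_space Om. (\<lambda>t. f t \<phi>) \<in> borel_measurable (lebesgue_on {0..1})) \<and>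
        integrable (lebesgue_on {0..1}) (\<lambda>t. (M_norm Om (f t))\<^sup>2)}"

definition linear_on_L2w ::
    "'a::euclidean_space set \<Rightarrow> ((real \<Rightarrow> ('a \<Rightarrow> real) \<Rightarrow> real) \<Rightarrow> 'y::real_vector) \<Rightarrow> bool" where
  "linear_on_L2w Om K \<longleftrightarrow>
    (\<forall>f\<in>L2w Om. \<forall>g\<in>L2w Om. eq_ae f g \<longrightarrow> K f = K g) \<and>
    (\<forall>f\<in>L2w Om. \<forall>g\<in>L2w Om. K (\<lambda>t \<phi>. f t \<phi> + g t \<phi>) = K f + K g) \<and>
    (\<forall>c. \<forall>f\<in>L2w Om. K (\<lambda>t \<phi>. c * f t \<phi>) = c *\<^sub>R K f)"


section \<open>Admissible curves and the regularizer\<close>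

definition factorizes ::
    "'a::euclidean_space set \<Rightarrow> (real \<Rightarrow> ('a \<Rightarrow> real) \<Rightarrow> real) \<Rightarrow> real \<Rightarrow> (real \<Rightarrow> 'a measure) \<Rightarrow> bool" where
  "factorizes Om \<mu> \<omega> \<rho> \<longleftrightarrow>
    0 \<le> \<omega> \<and> \<rho> \<in> BV_curves (prob_on Om) W1 \<and> eq_ae \<mu> (\<lambda>t \<phi>. \<omega> * radon Om (\<rho> t) \<phi>)"

definition admissible :: "'a::euclidean_space set \<Rightarrow> (real \<Rightarrow> ('a \<Rightarrow> real) \<Rightarrow> real) set" where
  "admissible Om = {\<mu> \<in> L2w Om. \<exists>\<omega> \<rho>. factorizes Om \<mu> \<omega> \<rho>}"

text \<open>The uniqueness underlying the two definite descriptions is proved below.\<close>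

definition weight :: "'a::euclidean_space set \<Rightarrow> (real \<Rightarrow> ('a \<Rightarrow> real) \<Rightarrow> real) \<Rightarrow> real" where
  "weight Om \<mu> = (THE \<omega>. \<exists>\<rho>. factorizes Om \<mu> \<omega> \<rho>)"

definition curve_ess_variation ::
    "'a::euclidean_space set \<Rightarrow> (real \<Rightarrow> ('a \<Rightarrow> real) \<Rightarrow> real) \<Rightarrow> real" where
  "curve_ess_variation Om \<mu> =
    (THE v. \<exists>\<omega> \<rho>. factorizes Om \<mu> \<omega> \<rho> \<and> v = \<omega> * enn2real (ess_variation (prob_on Om) W1 \<rho>))"

definition regularizer ::
    "'a::euclidean_space set \<Rightarrow> real \<Rightarrow> real \<Rightarrow> (real \<Rightarrow> ('a \<Rightarrow> real) \<Rightarrow> real) \<Rightarrow> real" where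
  "regularizer Om \<alpha> \<beta> \<mu> = \<alpha> * weight Om \<mu> + \<beta> * curve_ess_variation Om \<mu>"

lemma BV_curves_in_carrier:
  assumes "f \<in> BV_curves X d" "t \<in> {0..1}"
  shows "f t \<in> X"
proof -
  have "f \<in> lebesgue_on {0..1} \<rightarrow>\<^sub>M sigma X {U. metric_open X d U}"
    using assms by (simp add: BV_curves_def L1_curves_def)
  from measurable_space[OF this, of t] assms(2) show ?thesis
    by (simp add: space_restrict_space space_measure_of_conv)
qed

lemma eq_ae_trans2:
  assumes "eq_ae f g" "eq_ae f h"
  shows "eq_ae g h"
  using assms unfolding eq_ae_def by eventually_elim simp

lemma eq_ae_obtain:
  assumes "eq_ae f g"
  obtains t where "t \<in> {0..1}" "f t = g t"
proof -
  have "\<not> (AE t in lebesgue_on {0..1::real}. False)"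
  proof
    assume "AE t in lebesgue_on {0..1::real}. False"
    then have "emeasure (lebesgue_on {0..1::real}) (space (lebesgue_on {0..1::real})) = 0"
      by (subst AE_iff_measurable[OF sets.top, where P = "\<lambda>_. False", symmetric]) auto
    then show False
      by (simp add: space_restrict_space emeasure_restrict_space)
  qed
  moreover have "AE t in lebesgue_on {0..1}. t \<in> {0..1} \<and> f t = g t"
    using assms AE_space[of "lebesgue_on {0..1::real}"] unfolding eq_ae_def
    by eventually_elim (simp add: space_restrict_space)
  ultimately have "\<exists>t. t \<in> {0..1} \<and> f t = g t"
    using eventually_mono[of _ "ae_filter (lebesgue_on {0..1::real})" "\<lambda>_. False"] by blast
  then show thesis
    using that by blast
qed

lemma indicator_in_C_space: "indicator Om \<in> C_space Om"
proof -
  have "continuous_on Om (indicator Om :: _ \<Rightarrow> real) \<longleftrightarrow> continuous_on Om (\<lambda>_. 1 :: real)"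
    by (intro continuous_on_cong) auto
  then show ?thesis
    by (auto simp: C_space_def)
qed

lemma space_prob_on: "\<mu> \<in> prob_on Om \<Longrightarrow> space \<mu> = Om"
  using sets_eq_imp_space_eq[of \<mu> "restrict_space borel Om"]
  by (simp add: prob_on_def space_restrict_space)

lemma radon_indicator:
  assumes "\<mu> \<in> prob_on Om"
  shows "radon Om \<mu> (indicator Om) = 1"
proof -
  interpret prob_space \<mu> using assms by (simp add: prob_on_def)
  show ?thesis
    using space_prob_on[OF assms] prob_space
    by (simp add: radon_def indicator_in_C_space)
qed

lemma radon_eqD:
  assumes \<mu>: "\<mu> \<in> prob_on Om" and \<nu>: "\<nu> \<in> prob_on Om" and eq: "radon Om \<mu> = radon Om \<nu>"
    and Om: "compact Om"
  shows "\<mu> = \<nu>"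
proof -
  have Om_borel: "Om \<in> sets borel"
    using Om by (simp add: borel_compact)
  have inc: "(\<lambda>x. x) \<in> M \<rightarrow>\<^sub>M borel" if "M \<in> prob_on Om" for M :: "'a measure"
    using that measurable_ident_sets[of M "restrict_space borel Om"]
    by (simp add: prob_on_def measurable_restrict_space2_iff)
  have lim: "(\<lambda>k. \<integral>x. (if x \<in> Om then max 0 (1 - real k * infdist x C) else 0) \<partial>M)
      \<longlonglongrightarrow> measure M (C \<inter> Om)" if M: "M \<in> prob_on Om" and C: "closed C" "C \<noteq> {}" for M C
  proof -
    interpret prob_space M using M by (simp add: prob_on_def)
    note [measurable] = inc[OF M] Om_borel
    have CM: "C \<inter> Om \<in> sets M"
      using M C by (auto simp: prob_on_def sets_restrict_space)
    have "(\<lambda>k. \<integral>x. (if x \<in> Om then max 0 (1 - real k * infdist x C) else 0) \<partial>M)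
        \<longlonglongrightarrow> (\<integral>x. indicator (C \<inter> Om) x \<partial>M)"
    proof (rule integral_dominated_convergence[where w = "\<lambda>_. 1"])
      show "(indicator (C \<inter> Om) :: _ \<Rightarrow> real) \<in> borel_measurable M"
        using CM by measurable
      fix k
      have "(\<lambda>x. if x \<in> Om then max 0 (1 - real k * infdist x C) else 0) \<in> borel_measurable borel"
        by (intro measurable_If_set borel_measurable_continuous_onI continuous_intros) (auto simp: Om_borel)
      from measurable_compose[OF inc[OF M] this]
      show "(\<lambda>x. if x \<in> Om then max 0 (1 - real k * infdist x C) else 0) \<in> borel_measurable M" .
      show "AE x in M. norm (if x \<in> Om then max 0 (1 - real k * infdist x C) else 0) \<le> 1"
        by (auto simp: infdist_nonneg)
    next
      show "AE x in M. (\<lambda>k. if x \<in> Om then max 0 (1 - real k * infdist x C) else 0)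
          \<longlonglongrightarrow> indicator (C \<inter> Om) x"
      proof (rule AE_I2)
        fix x assume "x \<in> space M"
        then have x: "x \<in> Om" using space_prob_on[OF M] by simp
        show "(\<lambda>k. if x \<in> Om then max 0 (1 - real k * infdist x C) else 0) \<longlonglongrightarrow> indicator (C \<inter> Om) x"
        proof (cases "x \<in> C")
          case True
          then show ?thesis using x by simp
        next
          case False
          then have pos: "infdist x C > 0"
            using C by (metis in_closed_iff_infdist_zero infdist_nonneg less_eq_real_def)
          have "\<forall>\<^sub>F k in sequentially. (if x \<in> Om then max 0 (1 - real k * infdist x C) else 0) = 0"
            using eventually_ge_at_top[of "nat \<lceil>1 / infdist x C\<rceil>"]
          proof eventually_elim
            case (elim k)
            then have "1 / infdist x C \<le> real k" by linarith
            then show ?case using pos by (simp add: field_simps)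
          qed
          then show ?thesis using False by (simp add: tendsto_eventually)
        qed
      qed
    qed simp
    then show ?thesis using CM by simp
  qed
  have closed_eq: "measure \<mu> (C \<inter> Om) = measure \<nu> (C \<inter> Om)" if "closed C" for C
  proof (cases "C = {}")
    case False
    have C: "(\<lambda>x. if x \<in> Om then max 0 (1 - real k * infdist x C) else 0) \<in> C_space Om" for k
    proof -
      have "continuous_on Om (\<lambda>x. max 0 (1 - real k * infdist x C))"
        by (intro continuous_intros)
      then show ?thesis
        by (simp add: C_space_def cong: continuous_on_cong)
    qed
    have "(\<integral>x. (if x \<in> Om then max 0 (1 - real k * infdist x C) else 0) \<partial>\<mu>)
        = (\<integral>x. (if x \<in> Om then max 0 (1 - real k * infdist x C) else 0) \<partial>\<nu>)" for k
      using fun_cong[OF eq, of "\<lambda>x. if x \<in> Om then max 0 (1 - real k * infdist x C) else 0"] C[of k]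
      by (simp add: radon_def)
    then show ?thesis
      using LIMSEQ_unique[OF lim[OF \<mu> that False]] lim[OF \<nu> that False] by presburger
  qed simp
  interpret m: prob_space \<mu> using \<mu> by (simp add: prob_on_def)
  interpret n: prob_space \<nu> using \<nu> by (simp add: prob_on_def)
  have vimage: "(\<lambda>x. x) -` A \<inter> space M = A \<inter> Om" if "M \<in> prob_on Om" for A M
    using space_prob_on[OF that] by auto
  have "distr \<mu> borel (\<lambda>x. x) = distr \<nu> borel (\<lambda>x. x)"
  proof (rule measure_eqI_generator_eq[where E = "Collect closed" and \<Omega> = UNIV and A = "\<lambda>_. UNIV"])
    fix X :: "'a set" assume "X \<in> Collect closed"
    then show "emeasure (distr \<mu> borel (\<lambda>x. x)) X = emeasure (distr \<nu> borel (\<lambda>x. x)) X"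
      using closed_eq[of X] vimage[OF \<mu>] vimage[OF \<nu>]
      by (simp add: emeasure_distr inc[OF \<mu>] inc[OF \<nu>] m.emeasure_eq_measure n.emeasure_eq_measure)
  next
    show "emeasure (distr \<mu> borel (\<lambda>x. x)) UNIV \<noteq> \<infinity>"
      by (simp add: emeasure_distr inc[OF \<mu>] m.emeasure_eq_measure)
  qed (auto simp: Int_stable_def borel_eq_closed)
  then have borel_eq: "emeasure \<mu> (A \<inter> Om) = emeasure \<nu> (A \<inter> Om)" if "A \<in> sets borel" for A
    using that emeasure_distr[OF inc[OF \<mu>] that] emeasure_distr[OF inc[OF \<nu>] that]
      vimage[OF \<mu>] vimage[OF \<nu>] by simp
  show ?thesis
  proof (rule measure_eqI)
    show "sets \<mu> = sets \<nu>" using \<mu> \<nu> by (simp add: prob_on_def)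
    fix A assume "A \<in> sets \<mu>"
    then obtain B where "B \<in> sets borel" "A = B \<inter> Om"
      using \<mu> by (auto simp: prob_on_def sets_restrict_space)
    then show "emeasure \<mu> A = emeasure \<nu> A" using borel_eq by simp
  qed
qed

lemma weight_unique:
  assumes "factorizes Om \<mu> \<omega> \<rho>" "factorizes Om \<mu> \<omega>' \<rho>'"
  shows "\<omega> = \<omega>'"
proof -
  from assms have BV: "\<rho> \<in> BV_curves (prob_on Om) W1" "\<rho>' \<in> BV_curves (prob_on Om) W1"
    and eq: "eq_ae (\<lambda>t \<phi>. \<omega> * radon Om (\<rho> t) \<phi>) (\<lambda>t \<phi>. \<omega>' * radon Om (\<rho>' t) \<phi>)"
    by (auto simp: factorizes_def intro: eq_ae_trans2)
  from eq_ae_obtain[OF eq] obtain t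
    where t: "t \<in> {0..1}" "(\<lambda>\<phi>. \<omega> * radon Om (\<rho> t) \<phi>) = (\<lambda>\<phi>. \<omega>' * radon Om (\<rho>' t) \<phi>)"
    by blast
  from fun_cong[OF t(2), of "indicator Om"] show ?thesis
    using BV_curves_in_carrier[OF BV(1) t(1)] BV_curves_in_carrier[OF BV(2) t(1)]
    by (simp add: radon_indicator)
qed

lemma ess_variation_cong:
  assumes "eq_ae f g"
  shows "ess_variation X d f = ess_variation X d g"
proof -
  have "eq_ae h f \<longleftrightarrow> eq_ae h g" for h
  proof
    assume "eq_ae h f"
    with assms show "eq_ae h g"
      unfolding eq_ae_def by eventually_elim simp
  next
    assume "eq_ae h g"
    with assms show "eq_ae h f"
      unfolding eq_ae_def by eventually_elim simp
  qed
  then show ?thesis by (simp add: ess_variation_def)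
qed

lemma curve_ess_variation_unique:
  assumes Om: "compact Om"
    and f: "factorizes Om \<mu> \<omega> \<rho>" "factorizes Om \<mu> \<omega>' \<rho>'"
  shows "\<omega> * enn2real (ess_variation (prob_on Om) W1 \<rho>)
    = \<omega>' * enn2real (ess_variation (prob_on Om) W1 \<rho>')"
proof (cases "\<omega> = 0")
  case True
  then show ?thesis using weight_unique[OF f] by simp
next
  case False
  from f have BV: "\<rho> \<in> BV_curves (prob_on Om) W1" "\<rho>' \<in> BV_curves (prob_on Om) W1"
    and eq: "eq_ae (\<lambda>t \<phi>. \<omega> * radon Om (\<rho> t) \<phi>) (\<lambda>t \<phi>. \<omega>' * radon Om (\<rho>' t) \<phi>)"
    by (auto simp: factorizes_def intro: eq_ae_trans2)
  have "eq_ae \<rho> \<rho>'"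
    using eq AE_space[of "lebesgue_on {0..1::real}"] unfolding eq_ae_def
  proof eventually_elim
    case (elim t)
    then have t: "t \<in> {0..1}" by (simp add: space_restrict_space)
    have "radon Om (\<rho> t) \<phi> = radon Om (\<rho>' t) \<phi>" for \<phi>
      using fun_cong[OF elim(1), of \<phi>] weight_unique[OF f] False by simp
    then show ?case
      using radon_eqD[OF BV_curves_in_carrier[OF BV(1) t] BV_curves_in_carrier[OF BV(2) t] _ Om] by blast
  qed
  then show ?thesis
    using ess_variation_cong weight_unique[OF f] by metis
qed

lemma weight_eq:
  assumes "factorizes Om \<mu> \<omega> \<rho>"
  shows "weight Om \<mu> = \<omega>"
  unfolding weight_def using assms weight_unique by blast

lemma curve_ess_variation_eq:
  assumes "compact Om" "factorizes Om \<mu> \<omega> \<rho>"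
  shows "curve_ess_variation Om \<mu> = \<omega> * enn2real (ess_variation (prob_on Om) W1 \<rho>)"
  unfolding curve_ess_variation_def
proof (rule the_equality)
  show "\<exists>\<omega>' \<rho>'. factorizes Om \<mu> \<omega>' \<rho>' \<and> \<omega> * enn2real (ess_variation (prob_on Om) W1 \<rho>)
      = \<omega>' * enn2real (ess_variation (prob_on Om) W1 \<rho>')"
    using assms(2) by blast
  show "v = \<omega> * enn2real (ess_variation (prob_on Om) W1 \<rho>)"
    if "\<exists>\<omega>' \<rho>'. factorizes Om \<mu> \<omega>' \<rho>' \<and> v = \<omega>' * enn2real (ess_variation (prob_on Om) W1 \<rho>')" for v
    using that curve_ess_variation_unique[OF assms(1) _ assms(2)] by blast
qed


section \<open>Weak convergence and functionals on the data space\<close>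

definition weak_tendsto :: "(nat \<Rightarrow> 'y::real_normed_vector) \<Rightarrow> 'y \<Rightarrow> bool" where
  "weak_tendsto ys y \<longleftrightarrow>
    (\<forall>l :: 'y \<Rightarrow> real. bounded_linear l \<longrightarrow> (\<lambda>j. l (ys j)) \<longlonglongrightarrow> l y)"

definition convex_ereal :: "('y::real_vector \<Rightarrow> ereal) \<Rightarrow> bool" where
  "convex_ereal F \<longleftrightarrow>
    (\<forall>x y. \<forall>u\<ge>0. \<forall>v\<ge>0. u + v = 1 \<longrightarrow> F (u *\<^sub>R x + v *\<^sub>R y) \<le> ereal u * F x + ereal v * F y)"

definition weakly_lsc :: "('y::real_normed_vector \<Rightarrow> ereal) \<Rightarrow> bool" where
  "weakly_lsc F \<longleftrightarrow> (\<forall>ys y. weak_tendsto ys y \<longrightarrow> F y \<le> liminf (\<lambda>j. F (ys j)))"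

end

theory Submission
  imports Defs "HOL-Complex_Analysis.Great_Picard"
begin

text \<open>Call a curve sparse if it is a combination \<open>\<Sum>i. c i * \<delta>(x i t)\<close> with finitely many weights
\<open>c i \<ge> 0\<close> and paths \<open>x i\<close> of bounded variation in \<open>Om\<close>, and let its cost be \<open>\<Sum>i. c i * (\<alpha> + \<beta> * V i)\<close>,
where \<open>V i\<close> bounds the variation of \<open>x i\<close>. Moving every atom along its own path is a coupling, so
the cost is an upper bound for the regularizer (\<open>sparse_admissible\<close>). The theorem follows from three facts
about sparse curves.

First, every admissible curve is, at almost every time, the weak-* limit of sparse curves whose cost exceeds
its regularizer by as little as desired (\<open>sparse_approximation\<close>). Take a representative of almost minimal
variation, sample it at the times \<open>i/n\<close>, round the sampled measures to a finite net, and choose almost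
optimal couplings of consecutive samples. Couplings with matching marginals are the transition laws of a Markov
chain; its law lives on finitely many sample paths, and the expected length of a sample path is the sum of
the transport costs. This is a discrete superposition principle, and the passage to the limit is left to the
compactness argument below.

Secondly, both the observation \<open>K\<close> and the cost are linear in the weights. By the argument of
Caratheodory, the same observation in \<open>\<real>\<^sup>m\<close> is produced by at most \<open>m\<close> of the atoms at
no higher cost (\<open>conic_caratheodory_with_cost\<close>).

Thirdly, sparse curves with \<open>m\<close> atoms and bounded cost are sequentially compact
(\<open>sparse_compactness\<close>). The paths of atoms whose weights stay away from \<open>0\<close> have bounded variation, and
Helly's selection principle applies to them; atoms whose weights tend to \<open>0\<close> vanish in the limit, whatever
happens to their paths.

Together these facts show that each admissible \<open>\<mu>\<close> can be replaced by a sparse curve with \<open>m\<close> atoms that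
has exactly the observation \<open>K \<mu>\<close> and costs arbitrarily little more than \<open>\<mu>\<close> (\<open>sparse_replacement\<close>).
Exactness matters, because \<open>F\<close> is only lower semicontinuous and a merely nearby observation could have a much
larger value. So it is enough to minimize \<open>F\<close> plus cost over sparse curves with \<open>m\<close> atoms, and there
compactness and lower semicontinuity provide a minimizer (\<open>sparse_minimizer_exists\<close>).\<close>


section \<open>Curves controlled by a monotone function\<close>

text \<open>Bounded variation is expressed through a monotone function \<open>w\<close> whose increments dominate those of the
curve, the prototype being the variation on \<open>[0,t]\<close>. Such a \<open>w\<close> can be averaged and passed to the limit together
with the curve. The later value comes first because it does so in the sums that define the variation.\<close>

definition controlled :: "('b \<Rightarrow> 'b \<Rightarrow> real) \<Rightarrow> (real \<Rightarrow> 'b) \<Rightarrow> (real \<Rightarrow> real) \<Rightarrow> bool" where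
  "controlled d f w \<longleftrightarrow> mono_on {0..1} w \<and>
    (\<forall>s\<in>{0..1}. \<forall>t\<in>{0..1}. s < t \<longrightarrow> d (f t) (f s) \<le> w t - w s)"

lemma controlled_mono:
  "controlled d f w \<Longrightarrow> s \<in> {0..1} \<Longrightarrow> t \<in> {0..1} \<Longrightarrow> s \<le> t \<Longrightarrow> w s \<le> w t"
  by (auto simp: controlled_def mono_on_def)

lemma controlledD:
  "controlled d f w \<Longrightarrow> s \<in> {0..1} \<Longrightarrow> t \<in> {0..1} \<Longrightarrow> s < t \<Longrightarrow> d (f t) (f s) \<le> w t - w s"
  by (auto simp: controlled_def)

lemma controlled_dist:
  assumes "controlled dist f w" "s \<in> {0..1}" "t \<in> {0..1}"
  shows "dist (f s) (f t) \<le> \<bar>w t - w s\<bar>"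
  using controlledD[OF assms] controlledD[OF assms(1) assms(3) assms(2)]
  by (cases s t rule: linorder_cases) (auto simp: dist_commute)

text \<open>The increments of the control telescope along every partition.\<close>

lemma variation_le_control:
  assumes "controlled d f w"
  shows "variation d f \<le> ennreal (w 1 - w 0)"
  unfolding variation_def
proof (rule SUP_least, clarify)
  fix N :: nat and t :: "nat \<Rightarrow> real"
  assume t: "strict_mono_on {0..N} t" "t ` {0..N} \<subseteq> {0..1}"
  have t01: "t n \<in> {0..1}" if "n \<le> N" for n
    using t(2) that by (metis atLeastAtMost_iff image_subset_iff zero_le)
  have "(\<Sum>i=1..n. ennreal (d (f (t i)) (f (t (i - 1))))) \<le> ennreal (w (t n) - w (t 0))" if "n \<le> N" for n
    using that
  proof (induction n)
    case (Suc n)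
    have lt: "t n < t (Suc n)" and le: "t 0 \<le> t n"
      using t(1) Suc.prems strict_mono_onD[OF t(1), of n "Suc n"] strict_mono_onD[OF t(1), of 0 n]
      by (auto intro: less_imp_le)
    have "(\<Sum>i=1..Suc n. ennreal (d (f (t i)) (f (t (i - 1)))))
        = (\<Sum>i=1..n. ennreal (d (f (t i)) (f (t (i - 1))))) + ennreal (d (f (t (Suc n))) (f (t n)))"
      by simp
    also have "\<dots> \<le> ennreal (w (t n) - w (t 0)) + ennreal (w (t (Suc n)) - w (t n))"
      using Suc t01[of n] t01[of "Suc n"] lt
      by (intro add_mono ennreal_leI controlledD[OF assms]) auto
    also have "\<dots> = ennreal (w (t (Suc n)) - w (t 0))"
      using Suc.prems t01[of 0] t01[of n] t01[of "Suc n"] lt le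
      by (subst ennreal_plus[symmetric]) (auto intro!: controlled_mono[OF assms])
    finally show ?case .
  qed simp
  from this[of N] have "(\<Sum>i=1..N. ennreal (d (f (t i)) (f (t (i - 1))))) \<le> ennreal (w (t N) - w (t 0))"
    by simp
  also have "\<dots> \<le> ennreal (w 1 - w 0)"
    using t01[of N] t01[of 0] controlled_mono[OF assms, of "t N" 1] controlled_mono[OF assms, of 0 "t 0"]
    by (intro ennreal_leI) auto
  finally show "(\<Sum>i=1..N. ennreal (d (f (t i)) (f (t (i - 1))))) \<le> ennreal (w 1 - w 0)" .
qed

text \<open>The control is the variation on \<open>[0,s]\<close>, as a supremum over the partitions that end exactly at \<open>s\<close>: such a
partition extends by the single point \<open>t > s\<close>, which adds exactly the distance of the two values.\<close>

lemma control_exists: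
  assumes fin: "variation d f < \<infinity>"
  obtains w where "controlled d f w" "w 0 = 0" "ennreal (w 1) \<le> variation d f"
proof -
  define S where "S s = {(N :: nat, t :: nat \<Rightarrow> real). strict_mono_on {0..N} t \<and> t ` {0..N} \<subseteq> {0..s} \<and> t N = s}" for s
  define \<sigma> where "\<sigma> = (\<lambda>(N :: nat, t :: nat \<Rightarrow> real). \<Sum>i=1..N. ennreal (d (f (t i)) (f (t (i - 1)))))"
  define v where "v s = (SUP p\<in>S s. \<sigma> p)" for s :: real
  have S_ne: "(0, \<lambda>_. s) \<in> S s" if "0 \<le> s" for s
    using that by (auto simp: S_def strict_mono_on_def)
  have v_le: "v s \<le> variation d f" if "s \<in> {0..1}" for s
    unfolding v_def variation_def \<sigma>_def
    using that by (intro SUP_subset_mono) (auto simp: S_def)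
  have step: "v s + ennreal (d (f t) (f s)) \<le> v t" if st: "0 \<le> s" "s < t" for s t
  proof -
    have "v s + ennreal (d (f t) (f s)) = (SUP p\<in>S s. \<sigma> p + ennreal (d (f t) (f s)))"
      unfolding v_def using S_ne[OF st(1)] by (intro ennreal_SUP_add_left[symmetric]) auto
    also have "\<dots> \<le> v t"
    proof (rule SUP_least)
      fix p assume p: "p \<in> S s"
      obtain N \<tau> where p_eq: "p = (N, \<tau>)" by (cases p)
      with p have \<tau>: "strict_mono_on {0..N} \<tau>" "\<And>i. i \<le> N \<Longrightarrow> 0 \<le> \<tau> i \<and> \<tau> i \<le> s" "\<tau> N = s"
        by (simp_all add: S_def image_subset_iff)
      define q where "q = (Suc N, \<tau>(Suc N := t))"
      have "q \<in> S t"
      proof -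
        have "\<tau> i < t" "0 \<le> \<tau> i" if "i \<le> N" for i
          using \<tau>(2)[OF that] st by auto
        then have "\<And>i. i \<le> Suc N \<Longrightarrow> 0 \<le> (\<tau>(Suc N := t)) i \<and> (\<tau>(Suc N := t)) i \<le> t"
          using st by (auto simp: le_Suc_eq less_imp_le)
        moreover have "(\<tau>(Suc N := t)) i < (\<tau>(Suc N := t)) j" if "i < j" "j \<le> Suc N" for i j
          using that strict_mono_onD[OF \<tau>(1), of i j] \<open>\<And>i. i \<le> N \<Longrightarrow> \<tau> i < t\<close>
          by (cases "j = Suc N") auto
        ultimately show ?thesis
          unfolding q_def S_def strict_mono_on_def by (simp add: image_subset_iff)
      qed
      moreover have "\<sigma> q = \<sigma> p + ennreal (d (f t) (f s))"
      proof -
        have "(\<Sum>i=1..N. ennreal (d (f ((\<tau>(Suc N := t)) i)) (f ((\<tau>(Suc N := t)) (i - 1)))))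
            = (\<Sum>i=1..N. ennreal (d (f (\<tau> i)) (f (\<tau> (i - 1)))))"
          by (rule sum.cong) auto
        then show ?thesis
          unfolding \<sigma>_def q_def p_eq using \<tau>(3) by simp
      qed
      ultimately show "\<sigma> p + ennreal (d (f t) (f s)) \<le> v t"
        unfolding v_def by (metis SUP_upper)
    qed
    finally show ?thesis .
  qed
  define w where "w s = enn2real (v s)" for s
  have v_w: "v s = ennreal (w s)" if "s \<in> {0..1}" for s
    using v_le[OF that] fin unfolding w_def
    by (metis ennreal_enn2real_if infinity_ennreal_def not_less top_greatest)
  have w_nn: "0 \<le> w s" for s by (simp add: w_def)
  have step': "w s + max 0 (d (f t) (f s)) \<le> w t" if "s \<in> {0..1}" "t \<in> {0..1}" "s < t" for s t
  proof -
    have "ennreal (w s + max 0 (d (f t) (f s))) = v s + ennreal (d (f t) (f s))"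
      using v_w[OF that(1)] w_nn[of s] by (auto simp: ennreal_plus max_def ennreal_neg)
    also have "\<dots> \<le> ennreal (w t)"
      using step[of s t] v_w[OF that(2)] that by simp
    finally show ?thesis
      using w_nn[of t] by (simp add: ennreal_le_iff)
  qed
  have "v 0 = 0"
  proof -
    have "\<sigma> p = 0" if p: "p \<in> S 0" for p
    proof -
      obtain N \<tau> where p_eq: "p = (N, \<tau>)" by (cases p)
      have "N = 0"
      proof (rule ccontr)
        assume "N \<noteq> 0"
        then have "\<tau> 0 < \<tau> N" "\<tau> 0 = 0" "\<tau> N = 0"
          using p strict_mono_onD[of "{0..N}" \<tau> 0 N] by (auto simp: S_def p_eq image_subset_iff)
        then show False by simp
      qed
      then show ?thesis by (simp add: \<sigma>_def p_eq)
    qed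
    then have "v 0 \<le> 0"
      unfolding v_def by (intro SUP_least) simp
    then show ?thesis by simp
  qed
  then have "w 0 = 0" by (simp add: w_def)
  moreover have "controlled d f w"
    unfolding controlled_def
  proof (intro conjI mono_onI ballI impI)
    show "w r \<le> w s" if "r \<in> {0..1}" "s \<in> {0..1}" "r \<le> s" for r s
      using step'[of r s] that by (cases "r = s") auto
    show "d (f t) (f s) \<le> w t - w s" if "s \<in> {0..1}" "t \<in> {0..1}" "s < t" for s t
      using step'[OF that] by linarith
  qed
  moreover have "ennreal (w 1) \<le> variation d f"
    using v_le[of 1] v_w[of 1] by simp
  ultimately show thesis using that by blast
qed

lemma controlled_countable_discont:
  assumes "controlled d f w"
  shows "countable {t \<in> {0..1}. \<not> continuous (at t within {0..1}) w}"
  using assms by (intro mono_on_ctble_discont) (simp add: controlled_def)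

lemma AE_notin_countable:
  assumes "countable D"
  shows "AE t in lebesgue_on {0..1::real}. t \<in> {0..1} \<and> t \<notin> D"
proof -
  have "AE t in lebesgue. t \<notin> D"
    using assms by (intro AE_not_in) (auto simp: countable_imp_null_set_lborel null_sets_completionI)
  then show ?thesis
    by (subst AE_restrict_space_iff) (auto elim: eventually_mono)
qed

lemma lebesgue_on_space: "space (lebesgue_on {0..1::real}) = {0..1}"
  by (simp add: space_restrict_space)

text \<open>A curve can be discontinuous only where its control is, hence at countably many times. The preimage of an open set
is therefore relatively open up to a countable set.\<close>

lemma controlled_measurable:
  fixes w :: "real \<Rightarrow> real"
  assumes w: "mono_on {0..1} w"
    and f: "\<And>s t. s \<in> {0..1} \<Longrightarrow> t \<in> {0..1} \<Longrightarrow> d (f s) (f t) \<le> \<bar>w t - w s\<bar>"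
    and X: "f ` {0..1} \<subseteq> X"
  shows "f \<in> lebesgue_on {0..1} \<rightarrow>\<^sub>M sigma X {U. metric_open X d U}"
proof (rule measurable_sigma_sets[where \<Omega> = X and A = "{U. metric_open X d U}"])
  show "sets (sigma X {U. metric_open X d U}) = sigma_sets X {U. metric_open X d U}"
    by (intro sets_measure_of) (auto simp: metric_open_def)
  show "{U. metric_open X d U} \<subseteq> Pow X" by (auto simp: metric_open_def)
  show "f \<in> space (lebesgue_on {0..1}) \<rightarrow> X" using X by (auto simp: lebesgue_on_space)
  fix U assume "U \<in> {U. metric_open X d U}"
  then have U: "metric_open X d U" by simp
  define D where "D = {t \<in> {0..1}. \<not> continuous (at t within {0..1}) w}"
  have D: "countable D" unfolding D_def by (rule mono_on_ctble_discont[OF w])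
  define P where "P = {t \<in> {0..1}. f t \<in> U}"
  have "\<exists>\<delta>>0. \<forall>s\<in>{0..1}. dist s t < \<delta> \<longrightarrow> s \<in> P" if t: "t \<in> P - D" for t
  proof -
    from t have t01: "t \<in> {0..1}" and cont: "continuous (at t within {0..1}) w" and "f t \<in> U"
      by (auto simp: P_def D_def)
    with U obtain r where r: "r > 0" "{y \<in> X. d (f t) y < r} \<subseteq> U"
      by (auto simp: metric_open_def)
    from cont r(1) obtain \<delta> where \<delta>: "\<delta> > 0" "\<forall>s\<in>{0..1}. dist s t < \<delta> \<longrightarrow> dist (w s) (w t) < r"
      unfolding continuous_within_eps_delta by blast
    have "s \<in> P" if s: "s \<in> {0..1}" "dist s t < \<delta>" for s
    proof -
      have "d (f t) (f s) < r"
        using f[OF t01 s(1)] \<delta>(2) s by (force simp: dist_real_def)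
      moreover have "f s \<in> X" using X s(1) by blast
      ultimately show ?thesis using r(2) s(1) by (auto simp: P_def)
    qed
    then show ?thesis using \<delta>(1) by blast
  qed
  then obtain \<delta> where \<delta>: "\<And>t. t \<in> P - D \<Longrightarrow> \<delta> t > 0 \<and> (\<forall>s\<in>{0..1}. dist s t < \<delta> t \<longrightarrow> s \<in> P)"
    by metis
  define W where "W = (\<Union>t\<in>P - D. ball t (\<delta> t))"
  have P_eq: "P = (W \<inter> {0..1}) \<union> (P \<inter> D)"
    using \<delta> unfolding W_def by (fastforce simp: P_def dist_commute)
  have "W \<inter> {0..1} \<in> sets lebesgue"
  proof -
    have "open W" unfolding W_def by auto
    then show ?thesis by simp
  qed
  moreover have "P \<inter> D \<in> sets lebesgue"
    using D by (metis countable_Int2 countable_imp_null_set_lborel null_setsD2 sets_completionI_sets)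
  ultimately have "P \<in> sets lebesgue" using P_eq by (metis sets.Un)
  moreover have "f -` U \<inter> space (lebesgue_on {0..1}) = P"
    by (auto simp: P_def lebesgue_on_space)
  ultimately show "f -` U \<inter> space (lebesgue_on {0..1}) \<in> sets (lebesgue_on {0..1})"
    by (auto simp: sets_restrict_space_iff P_def)
qed

lemma controlled_borel_measurable:
  fixes f :: "real \<Rightarrow> 'a::metric_space"
  assumes "controlled dist f w"
  shows "f \<in> borel_measurable (lebesgue_on {0..1})"
proof -
  have eq: "metric_open UNIV dist U \<longleftrightarrow> open U" for U :: "'a set"
    unfolding metric_open_def open_dist by (auto simp: dist_commute subset_iff)
  have "f \<in> lebesgue_on {0..1} \<rightarrow>\<^sub>M sigma UNIV {U. metric_open UNIV dist U}"
    using assms controlled_dist[OF assms]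
    by (intro controlled_measurable[where w = w]) (auto simp: controlled_def)
  then show ?thesis by (simp add: eq borel_def)
qed

lemma ess_variation_le_control:
  assumes "controlled d f w" "f ` {0..1} \<subseteq> X"
  shows "ess_variation X d f \<le> ennreal (w 1 - w 0)"
proof -
  have "ess_variation X d f \<le> variation d f"
    unfolding ess_variation_def using assms(2) by (intro INF_lower) (simp add: eq_ae_def)
  with variation_le_control[OF assms(1)] show ?thesis by simp
qed

lemma controlled_BV_curves:
  assumes w: "controlled d f w"
    and sym: "\<And>x y. x \<in> X \<Longrightarrow> y \<in> X \<Longrightarrow> d x y = d y x" and refl: "\<And>x. x \<in> X \<Longrightarrow> d x x \<le> 0"
    and X: "f ` {0..1} \<subseteq> X"
    and int: "x0 \<in> X" "integrable (lebesgue_on {0..1}) (\<lambda>t. d (f t) x0)"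
  shows "f \<in> BV_curves X d"
proof -
  have "d (f s) (f t) \<le> \<bar>w t - w s\<bar>" if "s \<in> {0..1}" "t \<in> {0..1}" for s t
  proof -
    have "f s \<in> X" "f t \<in> X" using X that by blast+
    then show ?thesis
      using controlledD[OF w, of s t] controlledD[OF w, of t s] that sym[of "f s" "f t"] refl[of "f s"]
      by (cases s t rule: linorder_cases) auto
  qed
  then have "f \<in> lebesgue_on {0..1} \<rightarrow>\<^sub>M sigma X {U. metric_open X d U}"
    using w X by (intro controlled_measurable[where w = w]) (auto simp: controlled_def)
  moreover have "ess_variation X d f < \<infinity>"
    using ess_variation_le_control[OF w X] by (metis ennreal_less_top infinity_ennreal_def le_less_trans)
  ultimately show ?thesis
    using int by (auto simp: BV_curves_def L1_curves_def)
qed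


section \<open>Selection of convergent subsequences of controlled curves\<close>

lemma convergent_if_approximable:
  fixes z :: "nat \<Rightarrow> 'a::complete_space"
  assumes "\<And>e. e > 0 \<Longrightarrow> \<exists>a. convergent a \<and> (\<forall>\<^sub>F n in sequentially. dist (z n) (a n) < e)"
  shows "convergent z"
proof -
  have "Cauchy z"
  proof (rule metric_CauchyI)
    fix e :: real assume "e > 0"
    then obtain a where a: "convergent a" and near: "\<forall>\<^sub>F n in sequentially. dist (z n) (a n) < e / 3"
      using assms[of "e / 3"] by auto
    from near obtain N where N: "\<And>n. n \<ge> N \<Longrightarrow> dist (z n) (a n) < e / 3"
      by (auto simp: eventually_sequentially)
    from a have "Cauchy a" by (rule convergent_Cauchy)
    then obtain M where M: "\<And>m n. m \<ge> M \<Longrightarrow> n \<ge> M \<Longrightarrow> dist (a m) (a n) < e / 3"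
      using \<open>e > 0\<close> by (metis metric_CauchyD zero_less_divide_iff zero_less_numeral)
    have "dist (z m) (z n) < e" if "m \<ge> max M N" "n \<ge> max M N" for m n
      using N[of m] N[of n] M[of m n] that dist_triangle[of "z m" "z n" "a m"]
        dist_triangle[of "a m" "z n" "a n"] dist_commute[of "a n" "z n"]
      by simp
    then show "\<exists>M. \<forall>m\<ge>M. \<forall>n\<ge>M. dist (z m) (z n) < e" by blast
  qed
  then show ?thesis by (simp add: Cauchy_convergent)
qed

text \<open>Helly's selection principle for a curve together with its control. Along a subsequence the controls converge on
the rationals, and the limit extends to a monotone function on \<open>[0,1]\<close>; a further subsequence takes care of its
countably many discontinuities. At any other time the increments of the controls over a short rational
interval are eventually small, which forces the curves and the controls to be Cauchy.\<close>

lemma helly_selection_controlled: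
  fixes x :: "nat \<Rightarrow> real \<Rightarrow> 'a::euclidean_space"
  assumes w: "\<And>j. controlled dist (x j) (w j)" "\<And>j. w j 0 = 0" "\<And>j. w j 1 \<le> B"
    and x: "\<And>j t. t \<in> {0..1} \<Longrightarrow> norm (x j t) \<le> C"
  obtains r y v where "strict_mono (r :: nat \<Rightarrow> nat)"
    "\<And>t. t \<in> {0..1} \<Longrightarrow> (\<lambda>j. x (r j) t) \<longlonglongrightarrow> y t"
    "\<And>t. t \<in> {0..1} \<Longrightarrow> (\<lambda>j. w (r j) t) \<longlonglongrightarrow> v t"
proof -
  define f where "f j t = (x j t, w j t)" for j t
  have w_bounds: "0 \<le> w j t" "w j t \<le> B" if "t \<in> {0..1}" for j t
    using controlled_mono[OF w(1), of 0 t j] controlled_mono[OF w(1), of t 1 j] w(2,3)[of j] that by auto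
  have f_bound: "norm (f j t) \<le> C + B" if "t \<in> {0..1}" for j t
    using norm_Pair_le[of "x j t" "w j t"] x[OF that, of j] w_bounds[OF that, of j]
    by (simp add: f_def)
  define Q where "Q = \<rat> \<inter> {0..1::real}"
  have "countable Q" by (simp add: Q_def countable_rat)
  then obtain r1 where r1: "strict_mono (r1 :: nat \<Rightarrow> nat)" "\<And>t. t \<in> Q \<Longrightarrow> \<exists>l. (\<lambda>n. f (r1 n) t) \<longlonglongrightarrow> l"
    using function_convergent_subsequence[of Q f "C + B"] f_bound by (auto simp: Q_def)
  define v0 where "v0 q = lim (\<lambda>n. w (r1 n) q)" for q
  have v0: "(\<lambda>n. w (r1 n) q) \<longlonglongrightarrow> v0 q" if "q \<in> Q" for q
  proof -
    obtain l where "(\<lambda>n. f (r1 n) q) \<longlonglongrightarrow> l" using r1(2)[OF \<open>q \<in> Q\<close>] by blast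
    from tendsto_snd[OF this] have "convergent (\<lambda>n. w (r1 n) q)"
      by (auto simp: f_def convergent_def)
    then show ?thesis by (simp add: v0_def convergent_LIMSEQ_iff)
  qed
  have v0_mono: "v0 p \<le> v0 q" if "p \<in> Q" "q \<in> Q" "p \<le> q" for p q
    using that by (intro LIMSEQ_le[OF v0 v0]) (auto simp: Q_def intro!: controlled_mono[OF w(1)])
  \<comment> \<open>the monotone extension of the limit of the controls from the rationals to \<open>[0,1]\<close>\<close>
  define v1 where "v1 t = (SUP q\<in>Q \<inter> {0..t}. v0 q)" for t
  have Q01: "0 \<in> Q" "1 \<in> Q" by (auto simp: Q_def)
  have bdd: "bdd_above (v0 ` (Q \<inter> {0..t}))" for t
    using v0_mono Q01 by (intro bdd_aboveI2[where M = "v0 1"]) (auto simp: Q_def)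
  have v1_Q: "v1 q = v0 q" if "q \<in> Q" for q
    unfolding v1_def
  proof (rule antisym)
    show "(SUP p\<in>Q \<inter> {0..q}. v0 p) \<le> v0 q"
      using that Q01 v0_mono by (intro cSUP_least) (auto simp: Q_def)
    show "v0 q \<le> (SUP p\<in>Q \<inter> {0..q}. v0 p)"
      using that by (intro cSUP_upper[OF _ bdd]) (auto simp: Q_def)
  qed
  have v1_mono: "mono_on {0..1} v1"
    unfolding v1_def using Q01 by (intro mono_onI cSUP_subset_mono bdd) auto
  define D where "D = {t \<in> {0..1}. \<not> continuous (at t within {0..1}) v1}"
  have "countable D" unfolding D_def by (rule mono_on_ctble_discont[OF v1_mono])
  then obtain r2 where r2: "strict_mono (r2 :: nat \<Rightarrow> nat)"
      "\<And>t. t \<in> D \<Longrightarrow> \<exists>l. (\<lambda>n. f (r1 (r2 n)) t) \<longlonglongrightarrow> l"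
    using function_convergent_subsequence[of D "\<lambda>n. f (r1 n)" "C + B"] f_bound by (auto simp: D_def)
  define r where "r = r1 \<circ> r2"
  have r: "strict_mono r" unfolding r_def using r1(1) r2(1) by (rule strict_mono_o)
  have convQ: "convergent (\<lambda>n. f (r n) q)" if "q \<in> Q" for q
    using r1(2)[OF that] LIMSEQ_subseq_LIMSEQ[OF _ r2(1), of "\<lambda>n. f (r1 n) q"]
    by (auto simp: r_def convergent_def o_def)
  have wQ: "(\<lambda>n. w (r n) q) \<longlonglongrightarrow> v1 q" if "q \<in> Q" for q
    using LIMSEQ_subseq_LIMSEQ[OF v0[OF that] r2(1)] v1_Q[OF that] by (simp add: r_def o_def)
  have conv: "convergent (\<lambda>n. f (r n) t)" if t01: "t \<in> {0..1}" for t
  proof (cases "t \<in> D \<union> Q")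
    case True
    then show ?thesis using convQ[of t] r2(2)[of t] by (auto simp: r_def convergent_def)
  next
    case False
    then have cont: "continuous (at t within {0..1}) v1" using t01 by (auto simp: D_def)
    from False Q01 t01 have t: "0 < t" "t < 1" by (metis UnI2 atLeastAtMost_iff less_eq_real_def)+
    show ?thesis
    proof (rule convergent_if_approximable)
      fix e :: real assume e: "e > 0"
      with cont obtain \<delta> where \<delta>: "\<delta> > 0" "\<And>s. s \<in> {0..1} \<Longrightarrow> dist s t < \<delta> \<Longrightarrow> dist (v1 s) (v1 t) < e / 4"
        unfolding continuous_within_eps_delta by (metis zero_less_divide_iff zero_less_numeral)
      obtain p where p: "p \<in> \<rat>" "max 0 (t - \<delta>) < p" "p < t"
        using Rats_dense_in_real[of "max 0 (t - \<delta>)" t] t \<delta>(1) by auto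
      obtain q where q: "q \<in> \<rat>" "t < q" "q < min 1 (t + \<delta>)"
        using Rats_dense_in_real[of t "min 1 (t + \<delta>)"] t \<delta>(1) by auto
      have pq: "p \<in> Q" "q \<in> Q" using p q t by (auto simp: Q_def)
      have "dist (v1 p) (v1 t) < e / 4" "dist (v1 q) (v1 t) < e / 4"
        using p q t by (intro \<delta>(2); simp add: dist_real_def; linarith)+
      then have "v1 q - v1 p < e / 2" by (auto simp: dist_real_def abs_if split: if_splits)
      with tendsto_diff[OF wQ[OF pq(2)] wQ[OF pq(1)]]
      have "\<forall>\<^sub>F n in sequentially. w (r n) q - w (r n) p < e / 2" by (rule order_tendstoD)
      then have "\<forall>\<^sub>F n in sequentially. dist (f (r n) t) (f (r n) p) < e"
      proof eventually_elim
        case (elim n)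
        have p01: "p \<in> {0..1}" and q01: "q \<in> {0..1}" using p q t by auto
        have w_order: "w (r n) p \<le> w (r n) t" "w (r n) t \<le> w (r n) q"
          using p q p01 q01 t01 by (auto intro!: controlled_mono[OF w(1)])
        have "dist (f (r n) t) (f (r n) p) \<le> dist (x (r n) t) (x (r n) p) + dist (w (r n) t) (w (r n) p)"
          unfolding f_def dist_Pair_Pair by (rule sqrt_sum_squares_le_sum) auto
        also have "dist (x (r n) t) (x (r n) p) \<le> w (r n) t - w (r n) p"
          using controlledD[OF w(1) p01 t01 p(3)] .
        also have "dist (w (r n) t) (w (r n) p) = w (r n) t - w (r n) p"
          using w_order by (simp add: dist_real_def)
        finally show ?case using w_order elim by simp
      qed
      then show "\<exists>a. convergent a \<and> (\<forall>\<^sub>F n in sequentially. dist (f (r n) t) (a n) < e)"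
        using convQ[OF pq(1)] by blast
    qed
  qed
  have "(\<lambda>n. f (r n) t) \<longlonglongrightarrow> lim (\<lambda>n. f (r n) t)" if "t \<in> {0..1}" for t
    using conv[OF that] by (simp add: convergent_LIMSEQ_iff)
  from tendsto_fst[OF this] tendsto_snd[OF this] show thesis
    by (intro that[OF r, of "\<lambda>t. fst (lim (\<lambda>n. f (r n) t))" "\<lambda>t. snd (lim (\<lambda>n. f (r n) t))"])
      (auto simp: f_def)
qed

lemma controlled_limit:
  fixes x :: "nat \<Rightarrow> real \<Rightarrow> 'a::metric_space"
  assumes "\<And>j. controlled dist (x j) (w j)"
    and "\<And>t. t \<in> {0..1} \<Longrightarrow> (\<lambda>j. x j t) \<longlonglongrightarrow> y t"
    and "\<And>t. t \<in> {0..1} \<Longrightarrow> (\<lambda>j. w j t) \<longlonglongrightarrow> v t"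
  shows "controlled dist y v"
  unfolding controlled_def
proof (intro conjI mono_onI ballI impI)
  fix s t :: real
  assume st: "s \<in> {0..1}" "t \<in> {0..1}"
  show "v s \<le> v t" if "s \<le> t"
    using st that by (intro LIMSEQ_le[OF assms(3) assms(3)]) (auto intro!: controlled_mono[OF assms(1)])
  show "dist (y t) (y s) \<le> v t - v s" if "s < t"
    using st that
    by (intro LIMSEQ_le[OF tendsto_dist[OF assms(2) assms(2)] tendsto_diff[OF assms(3) assms(3)]])
      (auto intro!: exI[of _ 0] controlledD[OF assms(1)])
qed


section \<open>Couplings and the Wasserstein-1 distance\<close>

lemma C_space_measurable:
  assumes "\<phi> \<in> C_space Om" "sets \<mu> = sets (restrict_space borel Om)"
  shows "\<phi> \<in> borel_measurable \<mu>"
proof -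
  have "\<phi> \<in> borel_measurable (restrict_space borel Om)"
    using assms(1) by (intro borel_measurable_continuous_on_restrict) (simp add: C_space_def)
  then show ?thesis using assms(2) measurable_cong_sets by blast
qed

lemma C_space_bounded:
  assumes "\<phi> \<in> C_space Om" "compact Om"
  obtains M where "0 \<le> M" "\<And>x. \<bar>\<phi> x\<bar> \<le> M"
proof -
  have "bounded (\<phi> ` Om)"
    using assms by (intro compact_imp_bounded compact_continuous_image) (auto simp: C_space_def)
  then obtain M where "\<And>x. x \<in> Om \<Longrightarrow> \<bar>\<phi> x\<bar> \<le> M" by (auto simp: bounded_iff)
  then have "\<bar>\<phi> x\<bar> \<le> max 0 M" for x
    using assms(1) by (cases "x \<in> Om") (auto simp: C_space_def le_max_iff_disj)
  then show thesis using that[of "max 0 M"] by simp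
qed

text \<open>This form of uniform continuity can be integrated against a coupling, and so makes
continuous functions compatible with \<open>W1\<close>.\<close>

lemma C_space_almost_Lipschitz:
  assumes \<phi>: "\<phi> \<in> C_space Om" "compact Om" and e: "e > 0"
  obtains L where "0 \<le> L" "\<And>x y. x \<in> Om \<Longrightarrow> y \<in> Om \<Longrightarrow> \<bar>\<phi> x - \<phi> y\<bar> \<le> e + L * dist x y"
proof -
  have "uniformly_continuous_on Om \<phi>"
    using \<phi> by (intro compact_uniformly_continuous) (auto simp: C_space_def)
  then obtain \<delta> where \<delta>: "\<delta> > 0" "\<And>x y. x \<in> Om \<Longrightarrow> y \<in> Om \<Longrightarrow> dist x y < \<delta> \<Longrightarrow> dist (\<phi> x) (\<phi> y) < e"
    unfolding uniformly_continuous_on_def using e by metis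
  obtain M where M: "0 \<le> M" "\<And>x. \<bar>\<phi> x\<bar> \<le> M" using C_space_bounded[OF \<phi>] by blast
  have "\<bar>\<phi> x - \<phi> y\<bar> \<le> e + 2 * M / \<delta> * dist x y" if xy: "x \<in> Om" "y \<in> Om" for x y
  proof (cases "dist x y < \<delta>")
    case True
    then have "\<bar>\<phi> x - \<phi> y\<bar> \<le> e" using \<delta>(2)[OF xy] by (simp add: dist_real_def)
    moreover have "0 \<le> 2 * M / \<delta> * dist x y" using M(1) \<delta>(1) by simp
    ultimately show ?thesis by linarith
  next
    case False
    have "\<bar>\<phi> x - \<phi> y\<bar> \<le> 2 * M" using M(2)[of x] M(2)[of y] by linarith
    also have "2 * M \<le> 2 * M / \<delta> * dist x y"
      using False \<delta>(1) M(1) by (simp add: field_simps mult_left_mono)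
    finally show ?thesis using e by simp
  qed
  then show thesis using that[of "2 * M / \<delta>"] M(1) \<delta>(1) by simp
qed

lemma coupling_space:
  assumes "\<mu> \<in> prob_on Om" "\<nu> \<in> prob_on Om" "\<pi> \<in> couplings \<mu> \<nu>"
  shows "space \<pi> = Om \<times> Om"
proof -
  have "space \<pi> = space (\<mu> \<Otimes>\<^sub>M \<nu>)"
    using assms(3) by (intro sets_eq_imp_space_eq) (simp add: couplings_def)
  then show ?thesis using assms by (simp add: space_pair_measure space_prob_on)
qed

lemma coupling_measurable:
  assumes "\<pi> \<in> couplings \<mu> \<nu>"
  shows "fst \<in> \<pi> \<rightarrow>\<^sub>M \<mu>" "snd \<in> \<pi> \<rightarrow>\<^sub>M \<nu>"
proof -
  have "sets \<pi> = sets (\<mu> \<Otimes>\<^sub>M \<nu>)" using assms by (simp add: couplings_def)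
  then show "fst \<in> \<pi> \<rightarrow>\<^sub>M \<mu>" "snd \<in> \<pi> \<rightarrow>\<^sub>M \<nu>"
    by (simp_all cong: measurable_cong_sets)
qed

lemma coupling_integral:
  fixes \<phi> :: "'a::euclidean_space \<Rightarrow> real"
  assumes "\<pi> \<in> couplings \<mu> \<nu>"
  shows "\<phi> \<in> borel_measurable \<mu> \<Longrightarrow> (\<integral>z. \<phi> (fst z) \<partial>\<pi>) = (\<integral>x. \<phi> x \<partial>\<mu>)"
    and "\<phi> \<in> borel_measurable \<nu> \<Longrightarrow> (\<integral>z. \<phi> (snd z) \<partial>\<pi>) = (\<integral>x. \<phi> x \<partial>\<nu>)"
  using integral_distr[OF coupling_measurable(1)[OF assms], of \<phi>]
    integral_distr[OF coupling_measurable(2)[OF assms], of \<phi>] assms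
  by (simp_all add: couplings_def)

lemma prob_on_borel_id:
  assumes "\<mu> \<in> prob_on Om"
  shows "(\<lambda>x. x) \<in> \<mu> \<rightarrow>\<^sub>M borel"
  using assms measurable_ident_sets[of \<mu> "restrict_space borel Om"]
  by (simp add: prob_on_def measurable_restrict_space2_iff)

lemma coupling_dist_integrable:
  assumes "\<mu> \<in> prob_on Om" "\<nu> \<in> prob_on Om" "\<pi> \<in> couplings \<mu> \<nu>" "compact Om"
  shows "integrable \<pi> (\<lambda>z. dist (fst z) (snd z))"
proof -
  interpret prob_space \<pi> using assms(3) by (simp add: couplings_def)
  have "fst \<in> \<pi> \<rightarrow>\<^sub>M borel" "snd \<in> \<pi> \<rightarrow>\<^sub>M borel"
    using measurable_compose[OF coupling_measurable(1)[OF assms(3)] prob_on_borel_id[OF assms(1)]]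
      measurable_compose[OF coupling_measurable(2)[OF assms(3)] prob_on_borel_id[OF assms(2)]] by simp_all
  then have "(\<lambda>z. dist (fst z) (snd z)) \<in> borel_measurable \<pi>" by (rule borel_measurable_dist)
  moreover have "AE z in \<pi>. norm (dist (fst z) (snd z)) \<le> diameter Om"
  proof (rule AE_I2)
    fix z assume "z \<in> space \<pi>"
    then have "fst z \<in> Om" "snd z \<in> Om" unfolding coupling_space[OF assms(1-3)] by auto
    then show "norm (dist (fst z) (snd z)) \<le> diameter Om"
      using diameter_bounded_bound[OF compact_imp_bounded[OF assms(4)]] by simp
  qed
  ultimately show ?thesis by (rule integrable_const_bound[rotated])
qed

text \<open>Without this the infimum in \<open>W1\<close> could be taken over the empty set and would then be unspecified.\<close>

lemma product_coupling:
  assumes "prob_space \<mu>" "prob_space \<nu>"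
  shows "\<mu> \<Otimes>\<^sub>M \<nu> \<in> couplings \<mu> \<nu>"
proof -
  interpret m: prob_space \<mu> by fact
  interpret n: prob_space \<nu> by fact
  interpret pair_prob_space \<mu> \<nu> ..
  have "distr (\<mu> \<Otimes>\<^sub>M \<nu>) \<nu> snd = \<nu>"
  proof (rule measure_eqI)
    fix A assume "A \<in> sets (distr (\<mu> \<Otimes>\<^sub>M \<nu>) \<nu> snd)"
    then have A: "A \<in> sets \<nu>" by simp
    have "snd -` A \<inter> space (\<mu> \<Otimes>\<^sub>M \<nu>) = space \<mu> \<times> A"
      using sets.sets_into_space[OF A] by (auto simp: space_pair_measure)
    then show "emeasure (distr (\<mu> \<Otimes>\<^sub>M \<nu>) \<nu> snd) A = emeasure \<nu> A"
      using A by (simp add: emeasure_distr n.emeasure_pair_measure_Times m.emeasure_space_1)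
  qed simp
  then show ?thesis
    using n.distr_pair_fst[of \<mu>] prob_space_axioms by (simp add: couplings_def)
qed

lemma W1_le_coupling: "\<pi> \<in> couplings \<mu> \<nu> \<Longrightarrow> W1 \<mu> \<nu> \<le> (\<integral>z. dist (fst z) (snd z) \<partial>\<pi>)"
  unfolding W1_def by (intro cINF_lower bdd_belowI2[where m = 0]) auto

lemma W1_greatest:
  assumes "\<mu> \<in> prob_on Om" "\<nu> \<in> prob_on Om"
    and "\<And>\<pi>. \<pi> \<in> couplings \<mu> \<nu> \<Longrightarrow> c \<le> (\<integral>z. dist (fst z) (snd z) \<partial>\<pi>)"
  shows "c \<le> W1 \<mu> \<nu>"
  unfolding W1_def using product_coupling[of \<mu> \<nu>] assms by (intro cINF_greatest) (auto simp: prob_on_def)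

lemma W1_near_optimal:
  assumes "\<mu> \<in> prob_on Om" "\<nu> \<in> prob_on Om" "W1 \<mu> \<nu> < r"
  obtains \<pi> where "\<pi> \<in> couplings \<mu> \<nu>" "(\<integral>z. dist (fst z) (snd z) \<partial>\<pi>) < r"
  using W1_greatest[OF assms(1,2), of r] assms(3) by (meson not_less)

text \<open>The modulus of continuity is integrated against an arbitrary coupling. The infimum over the couplings is taken after
division by \<open>L\<close>, whence the separate case \<open>L = 0\<close>.\<close>

lemma W1_integral_diff:
  assumes \<mu>: "\<mu> \<in> prob_on Om" and \<nu>: "\<nu> \<in> prob_on Om" and Om: "compact Om"
    and \<phi>: "\<phi> \<in> C_space Om" and L: "0 \<le> L"
    and lip: "\<And>x y. x \<in> Om \<Longrightarrow> y \<in> Om \<Longrightarrow> \<bar>\<phi> x - \<phi> y\<bar> \<le> e + L * dist x y"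
  shows "\<bar>(\<integral>x. \<phi> x \<partial>\<mu>) - (\<integral>x. \<phi> x \<partial>\<nu>)\<bar> \<le> e + L * W1 \<mu> \<nu>"
proof -
  obtain M where M: "\<And>x. \<bar>\<phi> x\<bar> \<le> M" using C_space_bounded[OF \<phi> Om] by blast
  have \<phi>_meas: "\<phi> \<in> borel_measurable \<mu>" "\<phi> \<in> borel_measurable \<nu>"
    using \<mu> \<nu> \<phi> by (auto intro!: C_space_measurable simp: prob_on_def)
  have *: "\<bar>(\<integral>x. \<phi> x \<partial>\<mu>) - (\<integral>x. \<phi> x \<partial>\<nu>)\<bar> \<le> e + L * (\<integral>z. dist (fst z) (snd z) \<partial>\<pi>)"
    if \<pi>: "\<pi> \<in> couplings \<mu> \<nu>" for \<pi>
  proof -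
    interpret prob_space \<pi> using \<pi> by (simp add: couplings_def)
    have [measurable]: "(\<lambda>z. \<phi> (fst z)) \<in> borel_measurable \<pi>" "(\<lambda>z. \<phi> (snd z)) \<in> borel_measurable \<pi>"
      using measurable_compose[OF coupling_measurable(1)[OF \<pi>] \<phi>_meas(1)]
        measurable_compose[OF coupling_measurable(2)[OF \<pi>] \<phi>_meas(2)] by simp_all
    have int: "integrable \<pi> (\<lambda>z. \<phi> (fst z))" "integrable \<pi> (\<lambda>z. \<phi> (snd z))"
      using M by (auto intro!: integrable_const_bound[where B = M])
    note dist_int = coupling_dist_integrable[OF \<mu> \<nu> \<pi> Om]
    have "\<bar>(\<integral>x. \<phi> x \<partial>\<mu>) - (\<integral>x. \<phi> x \<partial>\<nu>)\<bar> = \<bar>\<integral>z. \<phi> (fst z) - \<phi> (snd z) \<partial>\<pi>\<bar>"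
      using int coupling_integral[OF \<pi>] \<phi>_meas by simp
    also have "\<dots> \<le> (\<integral>z. \<bar>\<phi> (fst z) - \<phi> (snd z)\<bar> \<partial>\<pi>)" by (rule integral_abs_bound)
    also have "\<dots> \<le> (\<integral>z. e + L * dist (fst z) (snd z) \<partial>\<pi>)"
    proof (rule integral_mono)
      show "integrable \<pi> (\<lambda>z. \<bar>\<phi> (fst z) - \<phi> (snd z)\<bar>)"
        using int by (intro integrable_abs Bochner_Integration.integrable_diff)
      show "integrable \<pi> (\<lambda>z. e + L * dist (fst z) (snd z))"
        using dist_int by (intro Bochner_Integration.integrable_add integrable_mult_right) simp_all
      show "\<bar>\<phi> (fst z) - \<phi> (snd z)\<bar> \<le> e + L * dist (fst z) (snd z)" if "z \<in> space \<pi>" for z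
        using that unfolding coupling_space[OF \<mu> \<nu> \<pi>] by (intro lip) auto
    qed
    also have "\<dots> = e + L * (\<integral>z. dist (fst z) (snd z) \<partial>\<pi>)"
      using dist_int by (simp add: prob_space)
    finally show ?thesis .
  qed
  show ?thesis
  proof (cases "L = 0")
    case True
    then show ?thesis using *[OF product_coupling] \<mu> \<nu> by (simp add: prob_on_def)
  next
    case False
    then have "(\<bar>(\<integral>x. \<phi> x \<partial>\<mu>) - (\<integral>x. \<phi> x \<partial>\<nu>)\<bar> - e) / L \<le> W1 \<mu> \<nu>"
      using L * by (intro W1_greatest[OF \<mu> \<nu>]) (simp add: field_simps)
    then show ?thesis using False L by (simp add: field_simps)
  qed
qed

text \<open>The product is the only coupling with a Dirac measure. This makes the distance of a curve of measures to a
fixed measure explicit, and thus measurable in time.\<close>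

lemma W1_dirac:
  assumes \<mu>: "\<mu> \<in> prob_on Om" and x0: "x0 \<in> Om" and Om: "compact Om"
  shows "W1 \<mu> (return (restrict_space borel Om) x0) = (\<integral>x. dist x x0 \<partial>\<mu>)"
proof -
  define \<nu> where "\<nu> = return (restrict_space borel Om) x0"
  have \<nu>: "\<nu> \<in> prob_on Om"
    using x0 prob_space_return[of x0 "restrict_space borel Om"]
    by (simp add: \<nu>_def prob_on_def space_restrict_space)
  have *: "(\<integral>z. dist (fst z) (snd z) \<partial>\<pi>) = (\<integral>x. dist x x0 \<partial>\<mu>)" if \<pi>: "\<pi> \<in> couplings \<mu> \<nu>" for \<pi>
  proof -
    have "{x \<in> Om. x = x0} \<in> sets (restrict_space borel Om)"
      using x0 by (auto simp: sets_restrict_space intro!: image_eqI[of _ _ "{x0}"])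
    then have "AE x in \<nu>. x = x0"
      unfolding \<nu>_def using x0
      by (subst AE_return) (simp_all add: space_restrict_space pred_def)
    then have "AE x in distr \<pi> \<nu> snd. x = x0"
      using \<pi> unfolding couplings_def by (metis (mono_tags, lifting) mem_Collect_eq)
    then have "AE z in \<pi>. snd z = x0"
      by (rule AE_distrD[OF coupling_measurable(2)[OF \<pi>]])
    moreover have meas: "(\<lambda>x. dist x x0) \<in> borel_measurable \<mu>"
      using prob_on_borel_id[OF \<mu>] measurable_const by (rule borel_measurable_dist) simp
    ultimately have "(\<integral>z. dist (fst z) (snd z) \<partial>\<pi>) = (\<integral>z. dist (fst z) x0 \<partial>\<pi>)"
      using borel_measurable_integrable[OF coupling_dist_integrable[OF \<mu> \<nu> \<pi> Om]]
        measurable_compose[OF coupling_measurable(1)[OF \<pi>] meas]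
      by (intro integral_cong_AE) (assumption | erule eventually_mono, simp)+
    also have "\<dots> = (\<integral>x. dist x x0 \<partial>\<mu>)"
      by (rule coupling_integral(1)[OF \<pi> meas])
    finally show ?thesis .
  qed
  have "W1 \<mu> \<nu> \<le> (\<integral>x. dist x x0 \<partial>\<mu>)"
  proof -
    have "\<mu> \<Otimes>\<^sub>M \<nu> \<in> couplings \<mu> \<nu>"
      using \<mu> \<nu> by (intro product_coupling) (simp_all add: prob_on_def)
    from W1_le_coupling[OF this] *[OF this] show ?thesis by simp
  qed
  moreover have "(\<integral>x. dist x x0 \<partial>\<mu>) \<le> W1 \<mu> \<nu>"
    using * by (intro W1_greatest[OF \<mu> \<nu>]) simp
  ultimately show ?thesis unfolding \<nu>_def by simp
qed

lemma W1_le_swap: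
  assumes \<mu>: "\<mu> \<in> prob_on Om" and \<nu>: "\<nu> \<in> prob_on Om" and Om: "compact Om"
  shows "W1 \<nu> \<mu> \<le> W1 \<mu> \<nu>"
proof (rule W1_greatest[OF \<mu> \<nu>])
  fix \<pi> assume \<pi>: "\<pi> \<in> couplings \<mu> \<nu>"
  define swap where "swap = (\<lambda>z :: 'a \<times> 'a. (snd z, fst z))"
  have swap: "swap \<in> \<pi> \<rightarrow>\<^sub>M \<nu> \<Otimes>\<^sub>M \<mu>"
    unfolding swap_def using coupling_measurable[OF \<pi>] by (rule measurable_Pair[rotated])
  have "distr \<pi> (\<nu> \<Otimes>\<^sub>M \<mu>) swap \<in> couplings \<nu> \<mu>"
  proof -
    interpret prob_space \<pi> using \<pi> by (simp add: couplings_def)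
    have "distr (distr \<pi> (\<nu> \<Otimes>\<^sub>M \<mu>) swap) \<nu> fst = \<nu>" "distr (distr \<pi> (\<nu> \<Otimes>\<^sub>M \<mu>) swap) \<mu> snd = \<mu>"
      using \<pi> by (simp_all add: distr_distr[OF measurable_fst swap] distr_distr[OF measurable_snd swap]
        couplings_def comp_def) (simp_all add: swap_def)
    then show ?thesis using prob_space_distr[OF swap] by (simp add: couplings_def)
  qed
  from W1_le_coupling[OF this]
  have "W1 \<nu> \<mu> \<le> (\<integral>z. dist (fst z) (snd z) \<partial>distr \<pi> (\<nu> \<Otimes>\<^sub>M \<mu>) swap)" .
  also have "\<dots> = (\<integral>z. dist (fst (swap z)) (snd (swap z)) \<partial>\<pi>)"
  proof (rule integral_distr[OF swap])
    have "fst \<in> \<nu> \<Otimes>\<^sub>M \<mu> \<rightarrow>\<^sub>M borel" "snd \<in> \<nu> \<Otimes>\<^sub>M \<mu> \<rightarrow>\<^sub>M borel"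
      using measurable_compose[OF measurable_fst[of \<nu> \<mu>] prob_on_borel_id[OF \<nu>]]
        measurable_compose[OF measurable_snd[of \<nu> \<mu>] prob_on_borel_id[OF \<mu>]] by simp_all
    then show "(\<lambda>z. dist (fst z) (snd z)) \<in> borel_measurable (\<nu> \<Otimes>\<^sub>M \<mu>)" by (rule borel_measurable_dist)
  qed
  also have "\<dots> = (\<integral>z. dist (fst z) (snd z) \<partial>\<pi>)" by (simp add: swap_def dist_commute)
  finally show "W1 \<nu> \<mu> \<le> (\<integral>z. dist (fst z) (snd z) \<partial>\<pi>)" .
qed

lemma W1_commute:
  assumes "\<mu> \<in> prob_on Om" "\<nu> \<in> prob_on Om" "compact Om"
  shows "W1 \<mu> \<nu> = W1 \<nu> \<mu>"
  using W1_le_swap[OF assms] W1_le_swap[OF assms(2,1,3)] by simp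


section \<open>Finite superpositions of moving Dirac measures\<close>

text \<open>The control of each path starts at \<open>0\<close>, so that its value at \<open>1\<close> is the bound for the variation.\<close>

definition path_family ::
    "'a::euclidean_space set \<Rightarrow> 'i set \<Rightarrow> ('i \<Rightarrow> real \<Rightarrow> 'a) \<Rightarrow> ('i \<Rightarrow> real \<Rightarrow> real) \<Rightarrow> bool" where
  "path_family Om I x w \<longleftrightarrow>
    (\<forall>i\<in>I. x i ` {0..1} \<subseteq> Om \<and> controlled dist (x i) (w i) \<and> w i 0 = 0)"

definition sparse_curve ::
    "'a::euclidean_space set \<Rightarrow> 'i set \<Rightarrow> ('i \<Rightarrow> real) \<Rightarrow> ('i \<Rightarrow> real \<Rightarrow> 'a)
      \<Rightarrow> real \<Rightarrow> ('a \<Rightarrow> real) \<Rightarrow> real" where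
  "sparse_curve Om I c x = (\<lambda>t \<phi>. \<Sum>i\<in>I. c i * dirac Om (x i t) \<phi>)"

lemma path_familyD:
  assumes "path_family Om I x w" "i \<in> I"
  shows "t \<in> {0..1} \<Longrightarrow> x i t \<in> Om" "controlled dist (x i) (w i)" "w i 0 = 0"
  using assms unfolding path_family_def by blast+

lemma path_control_nonneg:
  assumes "path_family Om I x w" "i \<in> I" "t \<in> {0..1}"
  shows "0 \<le> w i t"
  using controlled_mono[OF path_familyD(2)[OF assms(1,2)], of 0 t] path_familyD(3)[OF assms(1,2)] assms(3)
  by simp

lemma dirac_apply:
  assumes "x \<in> Om" "\<phi> \<in> C_space Om"
  shows "dirac Om x \<phi> = \<phi> x"
  using assms C_space_measurable[of \<phi> Om "restrict_space borel Om"]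
  by (simp add: dirac_def radon_def integral_return space_restrict_space)

lemma dirac_outside: "\<phi> \<notin> C_space Om \<Longrightarrow> dirac Om x \<phi> = 0"
  by (simp add: dirac_def radon_def)

lemma path_measurable:
  assumes "path_family Om I x w" "i \<in> I"
  shows "x i \<in> lebesgue_on {0..1} \<rightarrow>\<^sub>M restrict_space borel Om"
  using controlled_borel_measurable[OF path_familyD(2)[OF assms]] path_familyD(1)[OF assms]
  by (intro measurable_restrict_space2) (auto simp: lebesgue_on_space)

lemma finite_measure_lebesgue_on: "finite_measure (lebesgue_on {0..1::real})"
  by (rule finite_measureI) (simp add: lebesgue_on_space emeasure_restrict_space)

lemma path_in_BV_curves:
  assumes "path_family Om I x w" "i \<in> I" "compact Om"
  shows "x i \<in> BV_curves Om dist"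
proof (rule controlled_BV_curves[where ?x0.0 = "x i 0"])
  interpret finite_measure "lebesgue_on {0..1::real}" by (rule finite_measure_lebesgue_on)
  have "(\<lambda>t. dist (x i t) (x i 0)) \<in> borel_measurable (lebesgue_on {0..1})"
    using controlled_borel_measurable[OF path_familyD(2)[OF assms(1,2)]] measurable_const
    by (rule borel_measurable_dist) simp
  then show "integrable (lebesgue_on {0..1}) (\<lambda>t. dist (x i t) (x i 0))"
    using path_familyD(1)[OF assms(1,2)] diameter_bounded_bound[OF compact_imp_bounded[OF assms(3)]]
    by (intro integrable_const_bound[where B = "diameter Om"] AE_I2) (simp_all add: lebesgue_on_space)
qed (use path_familyD[OF assms(1,2)] in \<open>auto simp: dist_commute\<close>)

definition mixture ::
    "'a::euclidean_space set \<Rightarrow> 'i set \<Rightarrow> ('i \<Rightarrow> real) \<Rightarrow> ('i \<Rightarrow> 'a) \<Rightarrow> 'a measure" where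
  "mixture Om I p z = distr (point_measure I (\<lambda>i. ennreal (p i))) (restrict_space borel Om) z"

locale weights =
  fixes I :: "'i set" and p :: "'i \<Rightarrow> real"
  assumes finite: "finite I" and nonneg: "\<And>i. i \<in> I \<Longrightarrow> 0 \<le> p i" and sum_one: "(\<Sum>i\<in>I. p i) = 1"
begin

lemma prob_space_weights: "prob_space (point_measure I (\<lambda>i. ennreal (p i)))"
  by (rule prob_space_point_measure) (use finite nonneg sum_one in \<open>auto simp: sum_ennreal\<close>)

lemma mixture_measurable:
  "z ` I \<subseteq> Om \<Longrightarrow> z \<in> point_measure I (\<lambda>i. ennreal (p i)) \<rightarrow>\<^sub>M restrict_space borel Om"
  by (auto simp: space_restrict_space)

lemma mixture_prob_on: "z ` I \<subseteq> Om \<Longrightarrow> mixture Om I p z \<in> prob_on Om"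
  using prob_space.prob_space_distr[OF prob_space_weights mixture_measurable]
  by (simp add: prob_on_def mixture_def)

lemma mixture_integral:
  fixes \<phi> :: "'a::euclidean_space \<Rightarrow> real"
  assumes "z ` I \<subseteq> Om" "\<phi> \<in> borel_measurable (restrict_space borel Om)"
  shows "(\<integral>x. \<phi> x \<partial>mixture Om I p z) = (\<Sum>i\<in>I. p i * \<phi> (z i))"
  unfolding mixture_def using finite nonneg
  by (simp add: integral_distr[OF mixture_measurable[OF assms(1)] assms(2)] lebesgue_integral_point_measure_finite)

lemma radon_mixture:
  fixes z :: "'i \<Rightarrow> 'a::euclidean_space"
  assumes "z ` I \<subseteq> Om"
  shows "radon Om (mixture Om I p z) \<phi> = (\<Sum>i\<in>I. p i * dirac Om (z i) \<phi>)"
proof (cases "\<phi> \<in> C_space Om")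
  case True
  then show ?thesis
    using mixture_integral[OF assms C_space_measurable[OF True]] assms
    by (auto simp: radon_def dirac_apply image_subset_iff intro!: sum.cong)
qed (simp add: radon_def dirac_outside)

text \<open>Drawing one common index for both mixtures gives the coupling.\<close>

lemma W1_mixture_le:
  fixes z z' :: "'i \<Rightarrow> 'a::euclidean_space"
  assumes z: "z ` I \<subseteq> Om" and z': "z' ` I \<subseteq> Om"
  shows "W1 (mixture Om I p z) (mixture Om I p z') \<le> (\<Sum>i\<in>I. p i * dist (z i) (z' i))"
proof -
  let ?P = "point_measure I (\<lambda>i. ennreal (p i))"
  let ?N = "mixture Om I p z \<Otimes>\<^sub>M mixture Om I p z'"
  interpret prob_space ?P by (rule prob_space_weights)
  define h where "h i = (z i, z' i)" for i
  have h: "h \<in> ?P \<rightarrow>\<^sub>M ?N"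
    using z z' by (simp add: h_def space_pair_measure mixture_def space_restrict_space image_subset_iff)
  have "distr (distr ?P ?N h) (mixture Om I p z) fst = mixture Om I p z"
    "distr (distr ?P ?N h) (mixture Om I p z') snd = mixture Om I p z'"
    unfolding distr_distr[OF measurable_fst h] distr_distr[OF measurable_snd h] comp_def
    unfolding h_def mixture_def by (simp_all cong: distr_cong)
  then have "distr ?P ?N h \<in> couplings (mixture Om I p z) (mixture Om I p z')"
    using prob_space_distr[OF h] by (simp add: couplings_def)
  from W1_le_coupling[OF this]
  have "W1 (mixture Om I p z) (mixture Om I p z') \<le> (\<integral>y. dist (fst y) (snd y) \<partial>distr ?P ?N h)" .
  also have "\<dots> = (\<integral>i. dist (fst (h i)) (snd (h i)) \<partial>?P)"
  proof (rule integral_distr[OF h])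
    have "fst \<in> ?N \<rightarrow>\<^sub>M borel" "snd \<in> ?N \<rightarrow>\<^sub>M borel"
      using measurable_compose[OF measurable_fst prob_on_borel_id[OF mixture_prob_on[OF z]]]
        measurable_compose[OF measurable_snd prob_on_borel_id[OF mixture_prob_on[OF z']]] by blast+
    then show "(\<lambda>y. dist (fst y) (snd y)) \<in> borel_measurable ?N" by (rule borel_measurable_dist)
  qed
  also have "\<dots> = (\<Sum>i\<in>I. p i * dist (z i) (z' i))"
    using finite nonneg by (simp add: lebesgue_integral_point_measure_finite h_def)
  finally show ?thesis .
qed

lemma mixture_controlled:
  assumes "path_family Om I x w"
  shows "controlled W1 (\<lambda>t. mixture Om I p (\<lambda>i. x i t)) (\<lambda>t. \<Sum>i\<in>I. p i * w i t)"
  unfolding controlled_def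
proof (intro conjI mono_onI ballI impI)
  fix s t :: real assume st: "s \<in> {0..1}" "t \<in> {0..1}"
  show "(\<Sum>i\<in>I. p i * w i s) \<le> (\<Sum>i\<in>I. p i * w i t)" if "s \<le> t"
    using that st nonneg by (intro sum_mono mult_left_mono controlled_mono[OF path_familyD(2)[OF assms]]) auto
  show "W1 (mixture Om I p (\<lambda>i. x i t)) (mixture Om I p (\<lambda>i. x i s))
      \<le> (\<Sum>i\<in>I. p i * w i t) - (\<Sum>i\<in>I. p i * w i s)" if "s < t"
  proof -
    have "W1 (mixture Om I p (\<lambda>i. x i t)) (mixture Om I p (\<lambda>i. x i s))
        \<le> (\<Sum>i\<in>I. p i * dist (x i t) (x i s))"
      using path_familyD(1)[OF assms] st by (intro W1_mixture_le) auto
    also have "\<dots> \<le> (\<Sum>i\<in>I. p i * (w i t - w i s))"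
      using st that nonneg by (intro sum_mono mult_left_mono controlledD[OF path_familyD(2)[OF assms]]) auto
    finally show ?thesis by (simp add: right_diff_distrib sum_subtractf)
  qed
qed

text \<open>The distance to a fixed Dirac measure serves as the integrable distance function, by \<open>W1_dirac\<close>.\<close>

lemma mixture_BV_curves:
  assumes x: "path_family Om I x w" and Om: "compact Om"
  shows "(\<lambda>t. mixture Om I p (\<lambda>i. x i t)) \<in> BV_curves (prob_on Om) W1"
proof -
  have xt: "(\<lambda>i. x i t) ` I \<subseteq> Om" if "t \<in> {0..1}" for t
    using path_familyD(1)[OF x] that by auto
  obtain i0 where "i0 \<in> I" using sum_one by fastforce
  then have x0: "x i0 0 \<in> Om" using xt[of 0] by auto
  define \<nu> where "\<nu> = return (restrict_space borel Om) (x i0 0)"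
  interpret L: finite_measure "lebesgue_on {0..1::real}" by (rule finite_measure_lebesgue_on)
  show ?thesis
  proof (rule controlled_BV_curves[OF mixture_controlled[OF x], where ?x0.0 = \<nu>])
    show "\<nu> \<in> prob_on Om"
      using x0 prob_space_return[of "x i0 0" "restrict_space borel Om"]
      by (simp add: \<nu>_def prob_on_def space_restrict_space)
    show "(\<lambda>t. mixture Om I p (\<lambda>i. x i t)) ` {0..1} \<subseteq> prob_on Om"
      using mixture_prob_on[OF xt] by blast
    show "W1 \<mu> \<nu>' = W1 \<nu>' \<mu>" if "\<mu> \<in> prob_on Om" "\<nu>' \<in> prob_on Om" for \<mu> \<nu>'
      using W1_commute that Om .
    show "W1 \<mu> \<mu> \<le> 0" if \<mu>: "\<mu> \<in> prob_on Om" for \<mu>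
    proof -
      interpret prob_space \<mu> using \<mu> by (simp add: prob_on_def)
      have h: "(\<lambda>z. (z, z)) \<in> \<mu> \<rightarrow>\<^sub>M \<mu> \<Otimes>\<^sub>M \<mu>" by simp
      have "distr \<mu> (\<mu> \<Otimes>\<^sub>M \<mu>) (\<lambda>z. (z, z)) \<in> couplings \<mu> \<mu>"
        using prob_space_distr[OF h]
        by (simp add: couplings_def distr_distr[OF measurable_fst h] distr_distr[OF measurable_snd h] comp_def)
      from W1_le_coupling[OF this] show ?thesis
        using integral_distr[OF h, of "\<lambda>z. dist (fst z) (snd z)"]
          borel_measurable_dist[OF measurable_compose[OF measurable_fst prob_on_borel_id[OF \<mu>]]
            measurable_compose[OF measurable_snd prob_on_borel_id[OF \<mu>]]]
        by simp
    qed
    have W1_eq: "W1 (mixture Om I p (\<lambda>i. x i t)) \<nu> = (\<Sum>i\<in>I. p i * dist (x i t) (x i0 0))"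
      if "t \<in> {0..1}" for t
    proof -
      have "continuous_on Om (\<lambda>y. dist y (x i0 0))" by (intro continuous_intros)
      then have "(\<lambda>y. dist y (x i0 0)) \<in> borel_measurable (restrict_space borel Om)"
        by (rule borel_measurable_continuous_on_restrict)
      from mixture_integral[OF xt[OF that] this] show ?thesis
        unfolding \<nu>_def W1_dirac[OF mixture_prob_on[OF xt[OF that]] x0 Om] .
    qed
    have "integrable (lebesgue_on {0..1}) (\<lambda>t. \<Sum>i\<in>I. p i * dist (x i t) (x i0 0))"
    proof (intro Bochner_Integration.integrable_sum integrable_mult_right)
      fix i assume i: "i \<in> I"
      have "(\<lambda>t. dist (x i t) (x i0 0)) \<in> borel_measurable (lebesgue_on {0..1})"
        using controlled_borel_measurable[OF path_familyD(2)[OF x i]] measurable_const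
        by (rule borel_measurable_dist) simp
      then show "integrable (lebesgue_on {0..1}) (\<lambda>t. dist (x i t) (x i0 0))"
        using path_familyD(1)[OF x i] x0 diameter_bounded_bound[OF compact_imp_bounded[OF Om]]
        by (intro L.integrable_const_bound[where B = "diameter Om"] AE_I2) (simp_all add: lebesgue_on_space)
    qed
    then show "integrable (lebesgue_on {0..1}) (\<lambda>t. W1 (mixture Om I p (\<lambda>i. x i t)) \<nu>)"
      using W1_eq by (subst Bochner_Integration.integrable_cong[OF refl]) (auto simp: lebesgue_on_space)
  qed
qed

end

text \<open>The dual norm of a positive functional is its value at the constant function \<open>1\<close>, here the total weight.\<close>

lemma sparse_M_space:
  assumes "finite I" "compact Om" "Om \<noteq> {}" "\<And>i. i \<in> I \<Longrightarrow> 0 \<le> c i" "\<And>i. i \<in> I \<Longrightarrow> x i t \<in> Om"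
  shows "sparse_curve Om I c x t \<in> M_space Om" "M_norm Om (sparse_curve Om I c x t) = (\<Sum>i\<in>I. c i)"
proof -
  have eval: "sparse_curve Om I c x t \<phi> = (\<Sum>i\<in>I. c i * \<phi> (x i t))" if "\<phi> \<in> C_space Om" for \<phi>
    using that assms(5) by (simp add: sparse_curve_def dirac_apply)
  have abs_le: "\<bar>sparse_curve Om I c x t \<phi>\<bar> \<le> (\<Sum>i\<in>I. c i) * B"
    if \<phi>: "\<phi> \<in> C_space Om" "\<And>y. y \<in> Om \<Longrightarrow> \<bar>\<phi> y\<bar> \<le> B" for \<phi> B
  proof -
    have "\<bar>sparse_curve Om I c x t \<phi>\<bar> \<le> (\<Sum>i\<in>I. \<bar>c i * \<phi> (x i t)\<bar>)"
      unfolding eval[OF \<phi>(1)] by (rule sum_abs)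
    also have "\<dots> \<le> (\<Sum>i\<in>I. c i * B)"
      using \<phi>(2) assms(4,5) by (intro sum_mono) (simp add: abs_mult mult_left_mono)
    finally show ?thesis by (simp add: sum_distrib_right)
  qed
  show "sparse_curve Om I c x t \<in> M_space Om"
    unfolding M_space_def
  proof (intro CollectI conjI ballI allI impI)
    fix \<phi> \<psi> :: "_ \<Rightarrow> real" assume "\<phi> \<in> C_space Om" "\<psi> \<in> C_space Om"
    moreover from this have "(\<lambda>x. \<phi> x + \<psi> x) \<in> C_space Om"
      by (auto simp: C_space_def intro: continuous_on_add)
    ultimately show "sparse_curve Om I c x t (\<lambda>x. \<phi> x + \<psi> x) = sparse_curve Om I c x t \<phi> + sparse_curve Om I c x t \<psi>"
      by (simp add: eval algebra_simps sum.distrib)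
  next
    fix a and \<phi> :: "_ \<Rightarrow> real" assume "\<phi> \<in> C_space Om"
    moreover from this have "(\<lambda>x. a * \<phi> x) \<in> C_space Om"
      by (auto simp: C_space_def intro: continuous_on_mult_left)
    ultimately show "sparse_curve Om I c x t (\<lambda>x. a * \<phi> x) = a * sparse_curve Om I c x t \<phi>"
      by (simp add: eval sum_distrib_left algebra_simps)
  next
    show "\<exists>B. \<forall>\<phi>\<in>C_space Om. \<bar>sparse_curve Om I c x t \<phi>\<bar> \<le> B * (SUP x\<in>Om. \<bar>\<phi> x\<bar>)"
    proof (intro exI ballI)
      fix \<phi> :: "_ \<Rightarrow> real" assume \<phi>: "\<phi> \<in> C_space Om"
      then obtain M where "\<And>x. \<bar>\<phi> x\<bar> \<le> M" using C_space_bounded[OF _ assms(2)] by blast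
      then have "bdd_above ((\<lambda>x. \<bar>\<phi> x\<bar>) ` Om)" by (intro bdd_aboveI2)
      then show "\<bar>sparse_curve Om I c x t \<phi>\<bar> \<le> (\<Sum>i\<in>I. c i) * (SUP x\<in>Om. \<bar>\<phi> x\<bar>)"
        by (intro abs_le[OF \<phi>] cSUP_upper)
    qed
  next
    show "sparse_curve Om I c x t \<phi> = 0" if "\<phi> \<notin> C_space Om" for \<phi>
      using that by (simp add: sparse_curve_def dirac_outside)
  qed
  show "M_norm Om (sparse_curve Om I c x t) = (\<Sum>i\<in>I. c i)"
    unfolding M_norm_def
  proof (rule cSup_eq_maximum)
    have one: "sparse_curve Om I c x t (indicator Om) = (\<Sum>i\<in>I. c i)"
      using assms(5) by (simp add: eval[OF indicator_in_C_space])
    have "0 \<le> (\<Sum>i\<in>I. c i)" using assms(4) by (rule sum_nonneg)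
    with one show "(\<Sum>i\<in>I. c i) \<in> (\<lambda>\<phi>. \<bar>sparse_curve Om I c x t \<phi>\<bar>) ` {\<phi> \<in> C_space Om. \<forall>x\<in>Om. \<bar>\<phi> x\<bar> \<le> 1}"
      by (intro image_eqI[of _ _ "indicator Om"]) (auto simp: indicator_in_C_space)
    show "y \<le> (\<Sum>i\<in>I. c i)"
      if "y \<in> (\<lambda>\<phi>. \<bar>sparse_curve Om I c x t \<phi>\<bar>) ` {\<phi> \<in> C_space Om. \<forall>x\<in>Om. \<bar>\<phi> x\<bar> \<le> 1}" for y
      using that abs_le[of _ 1] by auto
  qed
qed

lemma sparse_L2w:
  assumes "finite I" "compact Om" "Om \<noteq> {}" "\<And>i. i \<in> I \<Longrightarrow> 0 \<le> c i" "path_family Om I x w"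
  shows "sparse_curve Om I c x \<in> L2w Om"
  unfolding L2w_def
proof (intro CollectI conjI ballI)
  have M: "sparse_curve Om I c x t \<in> M_space Om" "M_norm Om (sparse_curve Om I c x t) = (\<Sum>i\<in>I. c i)"
    if "t \<in> {0..1}" for t
    by (intro sparse_M_space assms(1-4) path_familyD(1)[OF assms(5) _ that]; assumption)+
  interpret L: finite_measure "lebesgue_on {0..1::real}" by (rule finite_measure_lebesgue_on)
  show "sparse_curve Om I c x ` {0..1} \<subseteq> M_space Om" using M(1) by blast
  have "integrable (lebesgue_on {0..1::real}) (\<lambda>t. (\<Sum>i\<in>I. c i)\<^sup>2)" by simp
  then show "integrable (lebesgue_on {0..1}) (\<lambda>t. (M_norm Om (sparse_curve Om I c x t))\<^sup>2)"
    using M(2) by (subst Bochner_Integration.integrable_cong[OF refl]) (auto simp: lebesgue_on_space)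
  fix \<phi> assume \<phi>: "\<phi> \<in> C_space Om"
  have "(\<lambda>t. \<Sum>i\<in>I. c i * \<phi> (x i t)) \<in> borel_measurable (lebesgue_on {0..1})"
    using measurable_compose[OF path_measurable[OF assms(5)] C_space_measurable[OF \<phi> refl]]
    by (intro borel_measurable_sum borel_measurable_times) auto
  then show "(\<lambda>t. sparse_curve Om I c x t \<phi>) \<in> borel_measurable (lebesgue_on {0..1})"
    using path_familyD(1)[OF assms(5)] \<phi>
    by (subst measurable_cong[where g = "\<lambda>t. \<Sum>i\<in>I. c i * \<phi> (x i t)"])
      (auto simp: lebesgue_on_space sparse_curve_def dirac_apply)
qed

text \<open>After normalization the weights define a mixture, whose control is the average of the controls of the paths; this
bounds the essential variation.\<close>

lemma sparse_admissible:
  assumes fin: "finite I" "I \<noteq> {}" and Om: "compact Om" "Om \<noteq> {}"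
    and c: "\<And>i. i \<in> I \<Longrightarrow> 0 \<le> c i" and x: "path_family Om I x w" and "0 \<le> \<beta>"
  shows "sparse_curve Om I c x \<in> admissible Om"
    and "regularizer Om \<alpha> \<beta> (sparse_curve Om I c x) \<le> (\<Sum>i\<in>I. c i * (\<alpha> + \<beta> * w i 1))"
proof -
  define \<omega> where "\<omega> = (\<Sum>i\<in>I. c i)"
  \<comment> \<open>If all weights vanish, any mixture factorizes the zero curve.\<close>
  define p where "p i = (if \<omega> = 0 then 1 / card I else c i / \<omega>)" for i
  have \<omega>: "0 \<le> \<omega>" unfolding \<omega>_def using c by (rule sum_nonneg)
  interpret weights I p
  proof
    show "(\<Sum>i\<in>I. p i) = 1"
      using fin by (cases "\<omega> = 0") (simp_all add: p_def sum_divide_distrib[symmetric] \<omega>_def[symmetric])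
    show "0 \<le> p i" if "i \<in> I" for i using \<omega> c[OF that] by (simp add: p_def)
  qed (rule fin)
  have p: "\<omega> * p i = c i" if "i \<in> I" for i
    using that c fin sum_nonneg_eq_0_iff[of I c] by (auto simp: p_def \<omega>_def)
  let ?\<rho> = "\<lambda>t. mixture Om I p (\<lambda>i. x i t)"
  have fac: "factorizes Om (sparse_curve Om I c x) \<omega> ?\<rho>"
    unfolding factorizes_def
  proof (intro conjI \<omega> mixture_BV_curves[OF x Om(1)])
    have "sparse_curve Om I c x t = (\<lambda>\<phi>. \<omega> * radon Om (?\<rho> t) \<phi>)" if t: "t \<in> {0..1}" for t
    proof
      fix \<phi>
      have "\<omega> * radon Om (?\<rho> t) \<phi> = \<omega> * (\<Sum>i\<in>I. p i * dirac Om (x i t) \<phi>)"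
        using path_familyD(1)[OF x _ t] by (subst radon_mixture) auto
      also have "\<dots> = (\<Sum>i\<in>I. c i * dirac Om (x i t) \<phi>)"
        unfolding sum_distrib_left mult.assoc[symmetric] using p by (intro sum.cong) auto
      finally show "sparse_curve Om I c x t \<phi> = \<omega> * radon Om (?\<rho> t) \<phi>" by (simp add: sparse_curve_def)
    qed
    then show "eq_ae (sparse_curve Om I c x) (\<lambda>t \<phi>. \<omega> * radon Om (?\<rho> t) \<phi>)"
      unfolding eq_ae_def by (intro AE_I2) (simp add: lebesgue_on_space)
  qed
  then show "sparse_curve Om I c x \<in> admissible Om"
    using sparse_L2w[OF fin(1) Om c x] by (auto simp: admissible_def)
  have "ess_variation (prob_on Om) W1 ?\<rho> \<le> ennreal ((\<Sum>i\<in>I. p i * w i 1) - (\<Sum>i\<in>I. p i * w i 0))"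
    using path_familyD(1)[OF x]
    by (intro ess_variation_le_control[OF mixture_controlled[OF x]]) (auto intro!: mixture_prob_on)
  also have "(\<Sum>i\<in>I. p i * w i 0) = 0" using path_familyD(3)[OF x] by simp
  finally have "enn2real (ess_variation (prob_on Om) W1 ?\<rho>) \<le> (\<Sum>i\<in>I. p i * w i 1)"
    using path_control_nonneg[OF x] nonneg by (intro enn2real_leI) (auto intro!: sum_nonneg)
  then have "\<omega> * enn2real (ess_variation (prob_on Om) W1 ?\<rho>) \<le> (\<Sum>i\<in>I. \<omega> * p i * w i 1)"
    using \<omega> by (simp add: sum_distrib_left[symmetric] mult.assoc mult_left_mono)
  then have "curve_ess_variation Om (sparse_curve Om I c x) \<le> (\<Sum>i\<in>I. c i * w i 1)"
    unfolding curve_ess_variation_eq[OF Om(1) fac] by (simp add: p)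
  then have "regularizer Om \<alpha> \<beta> (sparse_curve Om I c x) \<le> \<alpha> * \<omega> + \<beta> * (\<Sum>i\<in>I. c i * w i 1)"
    unfolding regularizer_def weight_eq[OF fac] using \<open>0 \<le> \<beta>\<close> by (simp add: mult_left_mono)
  also have "\<dots> = (\<Sum>i\<in>I. c i * (\<alpha> + \<beta> * w i 1))"
    by (simp add: \<omega>_def sum_distrib_left algebra_simps sum.distrib)
  finally show "regularizer Om \<alpha> \<beta> (sparse_curve Om I c x) \<le> (\<Sum>i\<in>I. c i * (\<alpha> + \<beta> * w i 1))" .
qed

lemma linear_on_sparse:
  assumes K: "linear_on_L2w Om K" and fin: "finite I" and Om: "compact Om" "Om \<noteq> {}"
    and c: "\<And>i. i \<in> I \<Longrightarrow> 0 \<le> c i" and x: "path_family Om I x w"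
  shows "K (sparse_curve Om I c x) = (\<Sum>i\<in>I. c i *\<^sub>R K (\<lambda>t. dirac Om (x i t)))"
  using fin c x
proof (induction I)
  case empty
  have "(\<lambda>t. sparse_curve Om ({} :: 'c set) c x t) \<in> L2w Om"
    by (rule sparse_L2w[OF _ Om]) (auto simp: path_family_def)
  then have "K (\<lambda>t \<phi>. 0 * sparse_curve Om ({} :: 'c set) c x t \<phi>) = 0 *\<^sub>R K (sparse_curve Om ({} :: 'c set) c x)"
    using K unfolding linear_on_L2w_def by blast
  then show ?case by (simp add: sparse_curve_def)
next
  case (insert i I)
  have x': "path_family Om I x w" "path_family Om {i} x w"
    using insert.prems(2) by (auto simp: path_family_def)
  have atom: "(\<lambda>t. dirac Om (x i t)) \<in> L2w Om"
    using sparse_L2w[OF _ Om _ x'(2), of "\<lambda>_. 1"] by (simp add: sparse_curve_def)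
  have scaled: "(\<lambda>t \<phi>. c i * dirac Om (x i t) \<phi>) \<in> L2w Om"
    using sparse_L2w[OF _ Om _ x'(2), of c] insert.prems(1) by (simp add: sparse_curve_def)
  have rest: "sparse_curve Om I c x \<in> L2w Om"
    using insert by (intro sparse_L2w[OF _ Om _ x'(1)]) auto
  have "sparse_curve Om (insert i I) c x = (\<lambda>t \<phi>. c i * dirac Om (x i t) \<phi> + sparse_curve Om I c x t \<phi>)"
    using insert.hyps by (simp add: sparse_curve_def)
  then have "K (sparse_curve Om (insert i I) c x) = K (\<lambda>t \<phi>. c i * dirac Om (x i t) \<phi>) + K (sparse_curve Om I c x)"
    using K scaled rest unfolding linear_on_L2w_def by simp
  also have "K (\<lambda>t \<phi>. c i * dirac Om (x i t) \<phi>) = c i *\<^sub>R K (\<lambda>t. dirac Om (x i t))"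
    using K[unfolded linear_on_L2w_def, THEN conjunct2, THEN conjunct2, rule_format, OF atom, of "c i"] .
  also have "K (sparse_curve Om I c x) = (\<Sum>i\<in>I. c i *\<^sub>R K (\<lambda>t. dirac Om (x i t)))"
    using insert.prems(1) by (intro insert.IH x') auto
  finally show ?case using insert.hyps by simp
qed


section \<open>Approximation of curves of measures by finite superpositions\<close>

text \<open>Rounding the sampled measures to finitely many points makes the gluing of couplings an elementary matter of
probability mass functions, and leaves only finitely many sample paths.\<close>

lemma finite_quantization:
  fixes Om :: "'a::euclidean_space set"
  assumes "compact Om" "Om \<noteq> {}" "e > 0"
  obtains q where "q \<in> borel \<rightarrow>\<^sub>M count_space UNIV" "finite (range q)" "range q \<subseteq> Om"
    "\<And>x. x \<in> Om \<Longrightarrow> dist (q x) x \<le> e"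
proof -
  obtain a where a: "a \<in> Om" using assms(2) by blast
  have "\<exists>q. q \<in> borel \<rightarrow>\<^sub>M count_space UNIV \<and> finite (range q) \<and> range q \<subseteq> insert a T \<and>
      (\<forall>x\<in>(\<Union>y\<in>T. ball y e). dist (q x) x \<le> e)" if "finite T" for T :: "'a set"
    using that
  proof (induction T)
    case empty
    show ?case by (rule exI[of _ "\<lambda>_. a"]) auto
  next
    case (insert y T)
    then obtain q where q: "q \<in> borel \<rightarrow>\<^sub>M count_space UNIV" "finite (range q)" "range q \<subseteq> insert a T"
      "\<forall>x\<in>(\<Union>y\<in>T. ball y e). dist (q x) x \<le> e" by blast
    define q' where "q' x = (if x \<in> ball y e then y else q x)" for x
    have "q' \<in> borel \<rightarrow>\<^sub>M count_space UNIV"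
      unfolding q'_def using q(1) by (intro measurable_If_set) auto
    moreover have "range q' \<subseteq> insert y (range q)" by (auto simp: q'_def)
    moreover from this have "finite (range q')" using q(2) by (meson finite.insertI finite_subset)
    moreover have "\<forall>x\<in>(\<Union>z\<in>insert y T. ball z e). dist (q' x) x \<le> e"
      using q(4) by (auto simp: q'_def)
    ultimately show ?case using q(3) by blast
  qed
  moreover obtain T where T: "finite T" "T \<subseteq> Om" "Om \<subseteq> (\<Union>y\<in>T. ball y e)"
  proof -
    have "Om \<subseteq> (\<Union>y\<in>Om. ball y e)" using assms(3) by auto
    then show ?thesis using compactE_image[OF assms(1), of Om "\<lambda>y. ball y e"] that by blast
  qed
  ultimately obtain q where "q \<in> borel \<rightarrow>\<^sub>M count_space UNIV" "finite (range q)" "range q \<subseteq> insert a T"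
    "\<forall>x\<in>(\<Union>y\<in>T. ball y e). dist (q x) x \<le> e" by meson
  with T a show thesis by (intro that[of q]) blast+
qed

text \<open>The law is carried by the finite range, so its point masses are positive almost surely, as the representation by a
probability mass function requires.\<close>

lemma finite_range_law:
  assumes "prob_space M" and h: "h \<in> M \<rightarrow>\<^sub>M count_space UNIV" and fin: "finite (range h)"
  obtains P where "measure_pmf P = distr M (count_space UNIV) h" "set_pmf P \<subseteq> h ` space M"
proof -
  interpret M: prob_space M by fact
  let ?D = "distr M (count_space UNIV) h"
  interpret D: prob_space ?D using h by (rule M.prob_space_distr)
  have "AE x in M. \<forall>b\<in>range h. h x = b \<longrightarrow> measure ?D {b} \<noteq> 0"
  proof (rule AE_finite_allI[OF fin])
    fix b
    show "AE x in M. h x = b \<longrightarrow> measure ?D {b} \<noteq> 0"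
    proof (cases "measure ?D {b} = 0")
      case True
      then have "AE y in ?D. y \<notin> {b}"
        by (intro AE_not_in) (auto simp: null_sets_def D.emeasure_eq_measure)
      then have "AE y in ?D. y \<noteq> b" by simp
      from AE_distrD[OF h this] show ?thesis by (rule eventually_mono) simp
    qed simp
  qed
  then have "AE x in M. measure ?D {h x} \<noteq> 0" by (auto elim: eventually_mono)
  then have "AE y in ?D. measure ?D {y} \<noteq> 0"
    using h by (subst AE_distr_iff) auto
  then have P: "measure_pmf (Abs_pmf ?D) = ?D"
    by (intro Abs_pmf_inverse) (simp add: D.prob_space_axioms)
  have "set_pmf (Abs_pmf ?D) \<subseteq> h ` space M"
  proof
    fix b assume "b \<in> set_pmf (Abs_pmf ?D)"
    then have "measure ?D {b} \<noteq> 0" using P by (metis measure_pmf_single set_pmf_iff)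
    then have "h -` {b} \<inter> space M \<noteq> {}" using h by (auto simp: measure_distr)
    then show "b \<in> h ` space M" by blast
  qed
  with P show thesis using that by blast
qed

text \<open>Gluing of couplings: \<open>J i\<close> prescribes the joint law of the states at the times \<open>i\<close> and \<open>i + 1\<close>. The chain is
extended by drawing the next state from the conditional law of \<open>J (i + 1)\<close> given the current state, which has the right
joint law since the marginals match.\<close>

lemma pmf_chain:
  fixes J :: "nat \<Rightarrow> ('a \<times> 'a) pmf"
  assumes "\<And>i. i < n \<Longrightarrow> map_pmf snd (J i) = map_pmf fst (J (Suc i))"
    and fin: "\<And>i. i \<le> n \<Longrightarrow> finite (set_pmf (J i))"
  shows "\<exists>M :: (nat \<Rightarrow> 'a) pmf. finite (set_pmf M) \<and>
    (\<forall>i\<le>n. map_pmf (\<lambda>z. (z i, z (Suc i))) M = J i)"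
  using assms
proof (induction n)
  case 0
  define M :: "(nat \<Rightarrow> 'a) pmf" where "M = map_pmf (\<lambda>y i. if i = 0 then fst y else snd y) (J 0)"
  have "map_pmf (\<lambda>z. (z 0, z (Suc 0))) M = J 0"
    by (simp add: M_def map_pmf_comp)
  moreover have "finite (set_pmf M)" using 0 by (simp add: M_def)
  ultimately show ?case by auto
next
  case (Suc n)
  have "\<exists>M :: (nat \<Rightarrow> 'a) pmf. finite (set_pmf M) \<and>
      (\<forall>i\<le>n. map_pmf (\<lambda>z. (z i, z (Suc i))) M = J i)"
    by (rule Suc.IH) (simp_all add: Suc.prems)
  then obtain M :: "(nat \<Rightarrow> 'a) pmf" where M: "finite (set_pmf M)"
    "\<And>i. i \<le> n \<Longrightarrow> map_pmf (\<lambda>z. (z i, z (Suc i))) M = J i"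
    by blast
  let ?m = "Suc n"
  have marg: "map_pmf (\<lambda>z. z ?m) M = map_pmf fst (J ?m)"
  proof -
    have "map_pmf (\<lambda>z. z ?m) M = map_pmf snd (map_pmf (\<lambda>z. (z n, z ?m)) M)"
      by (simp add: map_pmf_comp)
    then show ?thesis using M(2)[of n] Suc.prems(1)[of n] by simp
  qed
  define T where "T a = cond_pmf (J ?m) {y. fst y = a}" for a
  have ne: "set_pmf (J ?m) \<inter> {y. fst y = z ?m} \<noteq> {}" if "z \<in> set_pmf M" for z
  proof -
    have "z ?m \<in> set_pmf (map_pmf (\<lambda>z. z ?m) M)" using that by simp
    then show ?thesis unfolding marg by auto
  qed
  have set_T: "set_pmf (T (z ?m)) = set_pmf (J ?m) \<inter> {y. fst y = z ?m}" if "z \<in> set_pmf M" for z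
    unfolding T_def by (rule set_cond_pmf[OF ne[OF that]])
  define M' where "M' = bind_pmf M (\<lambda>z. map_pmf (\<lambda>y. z(Suc ?m := snd y)) (T (z ?m)))"
  have "finite (set_pmf M')"
    using M(1) set_T Suc.prems(2)[of ?m] by (auto simp: M'_def)
  moreover have "map_pmf (\<lambda>z. (z i, z (Suc i))) M' = J i" if i: "i \<le> ?m" for i
  proof (cases "i = ?m")
    case False
    then have "map_pmf (\<lambda>z. (z i, z (Suc i))) M' = bind_pmf M (\<lambda>z. return_pmf (z i, z (Suc i)))"
      using i by (simp add: M'_def map_bind_pmf map_pmf_comp map_pmf_const)
    also have "\<dots> = J i" using M(2)[of i] i False by (simp add: map_pmf_def)
    finally show ?thesis .
  next
    case True
    have "map_pmf (\<lambda>z. (z ?m, z (Suc ?m))) M'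
        = bind_pmf M (\<lambda>z. map_pmf (\<lambda>y. (z ?m, snd y)) (T (z ?m)))"
      by (simp add: M'_def map_bind_pmf map_pmf_comp)
    also have "\<dots> = bind_pmf M (\<lambda>z. T (z ?m))"
    proof (rule bind_pmf_cong[OF refl])
      fix z assume "z \<in> set_pmf M"
      then show "map_pmf (\<lambda>y. (z ?m, snd y)) (T (z ?m)) = T (z ?m)"
        using set_T by (intro map_pmf_idI) auto
    qed
    also have "\<dots> = bind_pmf (map_pmf (\<lambda>z. z ?m) M) T"
      by (simp add: bind_map_pmf)
    also have "\<dots> = J ?m"
      unfolding marg T_def
    proof (rule bind_cond_pmf_cancel)
      fix a y
      show "set_pmf (J ?m) \<inter> {y. fst y = a} \<noteq> {}" if "a \<in> set_pmf (map_pmf fst (J ?m))"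
        using that by auto
      show "set_pmf (map_pmf fst (J ?m)) \<inter> {a. fst y = a} \<noteq> {}" if "y \<in> set_pmf (J ?m)"
        using that by auto
      show "measure (J ?m) {y. fst y = a} = measure (map_pmf fst (J ?m)) {a. fst y = a}" if "fst y = a"
        using that by (simp add: vimage_def eq_commute)
    qed
    finally show ?thesis using True by simp
  qed
  ultimately show ?case by blast
qed

text \<open>The order of the components is reversed, so that \<open>J\<close> lists the earlier measure \<open>\<nu>\<close> first whereas \<open>W1\<close> is used with
the later measure \<open>\<mu>\<close> first, as in the definition of the variation.\<close>

lemma quantized_joint_law:
  assumes \<mu>: "\<mu> \<in> prob_on Om" and \<nu>: "\<nu> \<in> prob_on Om" and Om: "compact Om"
    and q: "q \<in> borel \<rightarrow>\<^sub>M count_space UNIV" "finite (range q)" "range q \<subseteq> Om"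
      "\<And>x. x \<in> Om \<Longrightarrow> dist (q x) x \<le> \<delta>"
    and "W1 \<mu> \<nu> < r"
  obtains J :: "('a::euclidean_space \<times> 'a) pmf" where
    "measure_pmf (map_pmf fst J) = distr \<nu> (count_space UNIV) q"
    "measure_pmf (map_pmf snd J) = distr \<mu> (count_space UNIV) q"
    "finite (set_pmf J)" "set_pmf J \<subseteq> Om \<times> Om"
    "measure_pmf.expectation J (\<lambda>z. dist (snd z) (fst z)) \<le> r + 2 * \<delta>"
proof -
  obtain \<pi> where \<pi>: "\<pi> \<in> couplings \<mu> \<nu>" and cost: "(\<integral>z. dist (fst z) (snd z) \<partial>\<pi>) < r"
    using W1_near_optimal[OF \<mu> \<nu> \<open>W1 \<mu> \<nu> < r\<close>] .
  interpret prob_space \<pi> using \<pi> by (simp add: couplings_def)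
  define h where "h z = (q (snd z), q (fst z))" for z
  have q_fst: "(\<lambda>z. q (fst z)) \<in> \<pi> \<rightarrow>\<^sub>M count_space UNIV"
    by (rule measurable_compose[OF measurable_compose[OF coupling_measurable(1)[OF \<pi>] prob_on_borel_id[OF \<mu>]] q(1)])
  have q_snd: "(\<lambda>z. q (snd z)) \<in> \<pi> \<rightarrow>\<^sub>M count_space UNIV"
    by (rule measurable_compose[OF measurable_compose[OF coupling_measurable(2)[OF \<pi>] prob_on_borel_id[OF \<nu>]] q(1)])
  have q_\<mu>: "q \<in> \<mu> \<rightarrow>\<^sub>M count_space UNIV" and q_\<nu>: "q \<in> \<nu> \<rightarrow>\<^sub>M count_space UNIV"
    using measurable_compose[OF prob_on_borel_id[OF \<mu>] q(1)] measurable_compose[OF prob_on_borel_id[OF \<nu>] q(1)]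
    by simp_all
  have range_h: "range h \<subseteq> range q \<times> range q" by (auto simp: h_def)
  then have fin_h: "finite (range h)" using q(2) by (meson finite_SigmaI finite_subset)
  have h: "h \<in> \<pi> \<rightarrow>\<^sub>M count_space UNIV"
  proof -
    have "h -` {y} \<inter> space \<pi> \<in> events" for y
    proof -
      have "h -` {y} \<inter> space \<pi> = ((\<lambda>z. q (snd z)) -` {fst y} \<inter> space \<pi>) \<inter> ((\<lambda>z. q (fst z)) -` {snd y} \<inter> space \<pi>)"
        by (auto simp: h_def)
      also have "\<dots> \<in> events"
        by (intro sets.Int measurable_sets[OF q_snd] measurable_sets[OF q_fst]) auto
      finally show ?thesis .
    qed
    then have *: "h \<in> \<pi> \<rightarrow>\<^sub>M count_space (range h)"
      using fin_h by (intro measurable_count_space_eq2[THEN iffD2]) auto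
    show ?thesis
      by (rule measurable_compose[OF *, of "\<lambda>x. x", simplified]) simp
  qed
  obtain J where J: "measure_pmf J = distr \<pi> (count_space UNIV) h" "set_pmf J \<subseteq> h ` space \<pi>"
    using finite_range_law[OF prob_space_axioms h fin_h] .
  show thesis
  proof (rule that[of J])
    show "finite (set_pmf J)" using J(2) fin_h by (meson finite_subset image_mono subset_UNIV)
    show "set_pmf J \<subseteq> Om \<times> Om"
    proof
      fix y assume "y \<in> set_pmf J"
      then obtain z where "y = h z" using J(2) by auto
      moreover have "q a \<in> Om" for a using q(3) by (rule subsetD) (rule rangeI)
      ultimately show "y \<in> Om \<times> Om" by (simp add: h_def)
    qed
    have "measure_pmf (map_pmf fst J) = distr \<pi> (count_space UNIV) (\<lambda>z. q (snd z))"
      by (simp add: map_pmf_rep_eq J(1) distr_distr[OF _ h] comp_def h_def)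
    also have "\<dots> = distr (distr \<pi> \<nu> snd) (count_space UNIV) q"
      by (simp add: distr_distr[OF q_\<nu> coupling_measurable(2)[OF \<pi>]] comp_def)
    finally show "measure_pmf (map_pmf fst J) = distr \<nu> (count_space UNIV) q"
      using \<pi> by (simp add: couplings_def)
    have "measure_pmf (map_pmf snd J) = distr \<pi> (count_space UNIV) (\<lambda>z. q (fst z))"
      by (simp add: map_pmf_rep_eq J(1) distr_distr[OF _ h] comp_def h_def)
    also have "\<dots> = distr (distr \<pi> \<mu> fst) (count_space UNIV) q"
      by (simp add: distr_distr[OF q_\<mu> coupling_measurable(1)[OF \<pi>]] comp_def)
    finally show "measure_pmf (map_pmf snd J) = distr \<mu> (count_space UNIV) q"
      using \<pi> by (simp add: couplings_def)
    have q_dist: "dist (q (fst z)) (q (snd z)) \<le> dist (fst z) (snd z) + 2 * \<delta>" if "z \<in> space \<pi>" for z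
    proof -
      have "fst z \<in> Om" "snd z \<in> Om"
        using that unfolding coupling_space[OF \<mu> \<nu> \<pi>] by auto
      then have "dist (q (fst z)) (fst z) \<le> \<delta>" "dist (q (snd z)) (snd z) \<le> \<delta>" using q(4) by auto
      moreover have "dist (q (fst z)) (q (snd z))
          \<le> dist (q (fst z)) (fst z) + dist (fst z) (snd z) + dist (q (snd z)) (snd z)"
        using dist_triangle[of "q (fst z)" "q (snd z)" "fst z"] dist_triangle[of "fst z" "q (snd z)" "snd z"]
          dist_commute[of "q (snd z)" "snd z"] by linarith
      ultimately show ?thesis by linarith
    qed
    note dist_int = coupling_dist_integrable[OF \<mu> \<nu> \<pi> Om]
    have meas: "(\<lambda>z. dist (q (fst z)) (q (snd z))) \<in> borel_measurable \<pi>"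
      using measurable_compose[OF h, of "\<lambda>y. dist (snd y) (fst y)" borel] by (simp add: h_def)
    have "measure_pmf.expectation J (\<lambda>z. dist (snd z) (fst z)) = (\<integral>z. dist (q (fst z)) (q (snd z)) \<partial>\<pi>)"
      unfolding J(1) by (subst integral_distr[OF h]) (simp_all add: h_def)
    also have "\<dots> \<le> (\<integral>z. dist (fst z) (snd z) + 2 * \<delta> \<partial>\<pi>)"
    proof (rule integral_mono[OF _ _ q_dist])
      show R: "integrable \<pi> (\<lambda>z. dist (fst z) (snd z) + 2 * \<delta>)"
        using dist_int by (intro Bochner_Integration.integrable_add) simp_all
      show "integrable \<pi> (\<lambda>z. dist (q (fst z)) (q (snd z)))"
      proof (rule Bochner_Integration.integrable_bound[OF R meas], rule AE_I2)
        fix z assume "z \<in> space \<pi>"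
        from q_dist[OF this]
        show "norm (dist (q (fst z)) (q (snd z))) \<le> norm (dist (fst z) (snd z) + 2 * \<delta>)" by simp
      qed
    qed
    also have "\<dots> = (\<integral>z. dist (fst z) (snd z) \<partial>\<pi>) + 2 * \<delta>"
      using dist_int by (simp add: prob_space)
    finally show "measure_pmf.expectation J (\<lambda>z. dist (snd z) (fst z)) \<le> r + 2 * \<delta>"
      using cost by simp
  qed
qed

text \<open>The sample paths of the chain, with value \<open>z k\<close> on \<open>[k/n, (k+1)/n)\<close>, superpose to the rounded measure at the last
grid point up to \<open>t\<close>, and their expected length is the total cost of the rounded couplings. The error bound is uniform in the
test function up to its modulus of continuity.\<close>

lemma step_path_approximation:
  fixes Om :: "'a::euclidean_space set"
  assumes Om: "compact Om" "Om \<noteq> {}" and g: "\<And>t. t \<in> {0..1} \<Longrightarrow> g t \<in> prob_on Om"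
    and w: "controlled W1 g w" and n: "0 < n" and e: "e > 0"
  shows "\<exists>(I :: (nat \<Rightarrow> 'a) set) c x v.
    weights I c \<and> path_family Om I x v \<and> (\<Sum>i\<in>I. c i * v i 1) \<le> w 1 - w 0 + e \<and>
    (\<forall>t\<in>{0..1}. \<forall>\<phi>\<in>C_space Om. \<forall>L\<ge>0. \<forall>\<epsilon>.
      (\<forall>x\<in>Om. \<forall>y\<in>Om. \<bar>\<phi> x - \<phi> y\<bar> \<le> \<epsilon> + L * dist x y) \<longrightarrow>
      \<bar>(\<Sum>i\<in>I. c i * \<phi> (x i t)) - (\<integral>y. \<phi> y \<partial>g (real (nat \<lfloor>real n * t\<rfloor>) / real n))\<bar> \<le> \<epsilon> + L * e)"
proof -
  obtain m where m: "n = Suc m" using n by (cases n) auto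
  \<comment> \<open>Each of the \<open>n\<close> steps costs \<open>2 * \<delta>\<close> for rounding and \<open>2 * \<delta>\<close> for the choice of the coupling.\<close>
  define \<delta> where "\<delta> = e / (4 * real n)"
  have \<delta>: "\<delta> > 0" "\<delta> \<le> e" using e n by (auto simp: \<delta>_def field_simps) 
  obtain q where q: "q \<in> borel \<rightarrow>\<^sub>M count_space UNIV" "finite (range q)" "range q \<subseteq> Om"
    "\<And>x. x \<in> Om \<Longrightarrow> dist (q x) x \<le> \<delta>"
    using finite_quantization[OF Om \<delta>(1)] by metis
  define s where "s i = real i / real n" for i
  have s: "s i \<in> {0..1}" if "i \<le> n" for i using that n by (auto simp: s_def)
  have s_less: "s i < s (Suc i)" for i using n by (simp add: s_def divide_strict_right_mono)
  define good where "good i J \<longleftrightarrow>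
      measure_pmf (map_pmf fst J) = distr (g (s i)) (count_space UNIV) q \<and>
      measure_pmf (map_pmf snd J) = distr (g (s (Suc i))) (count_space UNIV) q \<and>
      finite (set_pmf J) \<and> set_pmf J \<subseteq> Om \<times> Om \<and>
      measure_pmf.expectation J (\<lambda>z. dist (snd z) (fst z)) \<le> w (s (Suc i)) - w (s i) + e / n" for i J
  have "\<forall>i\<in>{..<n}. \<exists>J. good i J"
  proof
    fix i assume "i \<in> {..<n}"
    then have i: "i < n" by simp
    have \<mu>: "g (s (Suc i)) \<in> prob_on Om" and \<nu>: "g (s i) \<in> prob_on Om"
      using i by (auto intro!: g s)
    have "W1 (g (s (Suc i))) (g (s i)) < w (s (Suc i)) - w (s i) + 2 * \<delta>"
      using controlledD[OF w, of "s i" "s (Suc i)"] s[of i] s[of "Suc i"] s_less[of i] i \<delta>(1) by fastforce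
    from \<mu> \<nu> Om(1) q(1-3) q(4) this obtain J where "measure_pmf (map_pmf fst J) = distr (g (s i)) (count_space UNIV) q"
      "measure_pmf (map_pmf snd J) = distr (g (s (Suc i))) (count_space UNIV) q"
      "finite (set_pmf J)" "set_pmf J \<subseteq> Om \<times> Om"
      "measure_pmf.expectation J (\<lambda>z. dist (snd z) (fst z)) \<le> w (s (Suc i)) - w (s i) + 2 * \<delta> + 2 * \<delta>"
      by (rule quantized_joint_law)
    then show "\<exists>J. good i J" unfolding good_def by (intro exI[of _ J]) (simp add: \<delta>_def)
  qed
  then obtain J where "\<forall>i\<in>{..<n}. good i (J i)" by (rule bchoice[THEN exE])
  then have J:
    "\<And>i. i < n \<Longrightarrow> measure_pmf (map_pmf fst (J i)) = distr (g (s i)) (count_space UNIV) q"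
    "\<And>i. i < n \<Longrightarrow> measure_pmf (map_pmf snd (J i)) = distr (g (s (Suc i))) (count_space UNIV) q"
    "\<And>i. i < n \<Longrightarrow> finite (set_pmf (J i))" "\<And>i. i < n \<Longrightarrow> set_pmf (J i) \<subseteq> Om \<times> Om"
    "\<And>i. i < n \<Longrightarrow> measure_pmf.expectation (J i) (\<lambda>z. dist (snd z) (fst z)) \<le> w (s (Suc i)) - w (s i) + e / n"
    unfolding good_def by blast+
  have "map_pmf snd (J i) = map_pmf fst (J (Suc i))" if "i < m" for i
    using J(2)[of i] J(1)[of "Suc i"] that m by (metis Suc_less_eq less_SucI measure_pmf_inject)
  then obtain M :: "(nat \<Rightarrow> 'a) pmf" where M: "finite (set_pmf M)"
    "\<And>i. i < n \<Longrightarrow> map_pmf (\<lambda>z. (z i, z (Suc i))) M = J i"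
    using pmf_chain[of m J] J(3) m by (auto simp: less_Suc_eq_le)
  have marginal: "measure_pmf (map_pmf (\<lambda>z. z k) M) = distr (g (s k)) (count_space UNIV) q" if k: "k \<le> n" for k
  proof (cases "k = n")
    case True
    have "map_pmf (\<lambda>z. z n) M = map_pmf snd (map_pmf (\<lambda>z. (z m, z (Suc m))) M)"
      by (simp add: map_pmf_comp m)
    then show ?thesis using M(2)[of m] J(2)[of m] True m by simp
  next
    case False
    have "map_pmf (\<lambda>z. z k) M = map_pmf fst (map_pmf (\<lambda>z. (z k, z (Suc k))) M)"
      by (simp add: map_pmf_comp)
    then show ?thesis using M(2)[of k] J(1)[of k] False k by simp
  qed
  have in_Om: "z k \<in> Om" if z: "z \<in> set_pmf M" and k: "k \<le> n" for z k
  proof -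
    have "(z i, z (Suc i)) \<in> Om \<times> Om" if "i < n" for i
    proof -
      have "(z i, z (Suc i)) \<in> set_pmf (map_pmf (\<lambda>z. (z i, z (Suc i))) M)" using z by auto
      then show ?thesis using M(2)[OF that] J(4)[OF that] by auto
    qed
    from this[of k] this[of m] show ?thesis using k m by (cases "k = n") auto
  qed
  define idx where "idx t = nat \<lfloor>real n * t\<rfloor>" for t :: real
  have idx_le: "idx t \<le> n" if "t \<in> {0..1}" for t
  proof -
    have "real n * t \<le> real n" using that by (simp add: mult_left_le)
    then show ?thesis unfolding idx_def by linarith
  qed
  have idx_mono: "idx a \<le> idx b" if "a \<le> b" for a b
    unfolding idx_def using that by (intro nat_mono floor_mono mult_left_mono) auto
  define x where "x z t = z (idx t)" for z :: "nat \<Rightarrow> 'a" and t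
  define len where "len z k = (\<Sum>i<k. dist (z (Suc i)) (z i))" for z :: "nat \<Rightarrow> 'a" and k
  define v where "v z t = len z (idx t)" for z t
  have len_dist: "dist (z b) (z a) \<le> len z b - len z a" if "a \<le> b" for z a b
    using that
  proof (induction b rule: dec_induct)
    case (step b)
    then show ?case
      using dist_triangle[of "z (Suc b)" "z a" "z b"] by (simp add: len_def)
  qed simp
  show ?thesis
  proof (rule exI[of _ "set_pmf M"], rule exI[of _ "pmf M"], rule exI[of _ x], rule exI[of _ v],
      intro conjI ballI allI impI)
    show "weights (set_pmf M) (pmf M)"
      using M(1) by unfold_locales (auto intro: sum_pmf_eq_1)
    show "path_family Om (set_pmf M) x v"
      unfolding path_family_def controlled_def
    proof (intro ballI conjI mono_onI impI)
      fix z assume z: "z \<in> set_pmf M"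
      show "x z ` {0..1} \<subseteq> Om" using in_Om[OF z idx_le] by (auto simp: x_def)
      show "v z 0 = 0" by (simp add: v_def len_def idx_def)
      fix a b :: real
      show "v z a \<le> v z b" if "a \<le> b"
        using len_dist[OF idx_mono[OF that], of z] zero_le_dist[of "z (idx b)" "z (idx a)"]
        unfolding v_def by linarith
      show "dist (x z b) (x z a) \<le> v z b - v z a" if "a < b"
        using len_dist[OF idx_mono[OF less_imp_le[OF that]]] by (simp add: x_def v_def)
    qed
    have "idx 1 = n" by (simp add: idx_def)
    then have "(\<Sum>z\<in>set_pmf M. pmf M z * v z 1)
        = (\<Sum>i<n. \<Sum>z\<in>set_pmf M. pmf M z * dist (z (Suc i)) (z i))"
      by (simp add: v_def len_def sum_distrib_left sum.swap[of _ _ "{..<n}"])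
    also have "\<dots> \<le> (\<Sum>i<n. w (s (Suc i)) - w (s i) + e / n)"
    proof (rule sum_mono)
      fix i assume i: "i \<in> {..<n}"
      have "(\<Sum>z\<in>set_pmf M. pmf M z * dist (z (Suc i)) (z i))
          = measure_pmf.expectation M (\<lambda>z. dist (z (Suc i)) (z i))"
        by (subst integral_measure_pmf_real[OF M(1)]) (auto simp: mult.commute)
      also have "\<dots> = measure_pmf.expectation (map_pmf (\<lambda>z. (z i, z (Suc i))) M) (\<lambda>z. dist (snd z) (fst z))"
        by (simp add: integral_map_pmf)
      also have "\<dots> \<le> w (s (Suc i)) - w (s i) + e / n" using M(2)[of i] J(5)[of i] i by simp
      finally show "(\<Sum>z\<in>set_pmf M. pmf M z * dist (z (Suc i)) (z i)) \<le> w (s (Suc i)) - w (s i) + e / n" .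
    qed
    also have "\<dots> = w (s n) - w (s 0) + e"
      using n by (simp add: sum.distrib sum_lessThan_telescope[of "\<lambda>i. w (s i)"])
    also have "\<dots> = w 1 - w 0 + e" using n by (simp add: s_def)
    finally show "(\<Sum>z\<in>set_pmf M. pmf M z * v z 1) \<le> w 1 - w 0 + e" .
    fix t \<phi> L \<epsilon>
    assume t: "t \<in> {0..1::real}" and \<phi>: "\<phi> \<in> C_space Om" and L: "0 \<le> (L :: real)"
      and lip: "\<forall>x\<in>Om. \<forall>y\<in>Om. \<bar>\<phi> x - \<phi> y\<bar> \<le> \<epsilon> + L * dist x y"
    let ?k = "idx t"
    note \<mu> = g[OF s[OF idx_le[OF t]]]
    interpret prob_space "g (s ?k)" using \<mu> by (simp add: prob_on_def)
    have q_\<mu>: "q \<in> g (s ?k) \<rightarrow>\<^sub>M count_space UNIV"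
      by (rule measurable_compose[OF prob_on_borel_id[OF \<mu>] q(1)])
    obtain B where B: "\<And>x. \<bar>\<phi> x\<bar> \<le> B" using C_space_bounded[OF \<phi> Om(1)] by blast
    have meas: "\<phi> \<in> borel_measurable (g (s ?k))" "(\<lambda>y. \<phi> (q y)) \<in> borel_measurable (g (s ?k))"
      using C_space_measurable[OF \<phi>] \<mu> measurable_compose[OF q_\<mu>, of \<phi> borel] by (auto simp: prob_on_def)
    then have int: "integrable (g (s ?k)) \<phi>" "integrable (g (s ?k)) (\<lambda>y. \<phi> (q y))"
      using B by (auto intro!: integrable_const_bound[where B = B])
    have "(\<Sum>z\<in>set_pmf M. pmf M z * \<phi> (x z t)) = measure_pmf.expectation M (\<lambda>z. \<phi> (z ?k))"
      by (subst integral_measure_pmf_real[OF M(1)]) (auto simp: mult.commute x_def)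
    also have "\<dots> = measure_pmf.expectation (map_pmf (\<lambda>z. z ?k) M) \<phi>"
      by (simp add: integral_map_pmf)
    also have "\<dots> = (\<integral>y. \<phi> (q y) \<partial>g (s ?k))"
      unfolding marginal[OF idx_le[OF t]] by (subst integral_distr[OF q_\<mu>]) auto
    finally have "(\<Sum>z\<in>set_pmf M. pmf M z * \<phi> (x z t)) - (\<integral>y. \<phi> y \<partial>g (s ?k))
        = (\<integral>y. \<phi> (q y) - \<phi> y \<partial>g (s ?k))" using int by simp
    then have "\<bar>(\<Sum>z\<in>set_pmf M. pmf M z * \<phi> (x z t)) - (\<integral>y. \<phi> y \<partial>g (s ?k))\<bar>
        \<le> (\<integral>y. \<bar>\<phi> (q y) - \<phi> y\<bar> \<partial>g (s ?k))" by (simp add: integral_abs_bound)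
    also have "\<dots> \<le> (\<integral>y. \<epsilon> + L * e \<partial>g (s ?k))"
    proof (rule integral_mono)
      show "integrable (g (s ?k)) (\<lambda>y. \<bar>\<phi> (q y) - \<phi> y\<bar>)" using int by simp
      fix y assume "y \<in> space (g (s ?k))"
      then have y: "y \<in> Om" using space_prob_on[OF \<mu>] by simp
      have "\<bar>\<phi> (q y) - \<phi> y\<bar> \<le> \<epsilon> + L * dist (q y) y" using lip q(3) y by blast
      also have "\<dots> \<le> \<epsilon> + L * e" using q(4)[OF y] \<delta>(2) L by (simp add: mult_left_mono)
      finally show "\<bar>\<phi> (q y) - \<phi> y\<bar> \<le> \<epsilon> + L * e" .
    qed simp
    also have "\<dots> = \<epsilon> + L * e" by (simp add: prob_space)
    finally show "\<bar>(\<Sum>z\<in>set_pmf M. pmf M z * \<phi> (x z t)) - (\<integral>y. \<phi> y \<partial>g (real (nat \<lfloor>real n * t\<rfloor>) / real n))\<bar>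
        \<le> \<epsilon> + L * e"
      unfolding s_def idx_def .
  qed
qed

lemma floor_grid_tendsto:
  assumes "0 \<le> (t :: real)"
  shows "(\<lambda>n. real (nat \<lfloor>real (Suc n) * t\<rfloor>) / real (Suc n)) \<longlonglongrightarrow> t"
proof (rule tendsto_sandwich)
  show "(\<lambda>n. t - 1 / real (Suc n)) \<longlonglongrightarrow> t"
    using tendsto_diff[OF tendsto_const[of t] LIMSEQ_inverse_real_of_nat] by (simp add: inverse_eq_divide)
  show "(\<lambda>n. t) \<longlonglongrightarrow> t" by simp
  show "\<forall>\<^sub>F n in sequentially. t - 1 / real (Suc n) \<le> real (nat \<lfloor>real (Suc n) * t\<rfloor>) / real (Suc n)"
  proof (rule always_eventually, rule allI)
    fix n
    have "real (Suc n) * t - 1 \<le> real (nat \<lfloor>real (Suc n) * t\<rfloor>)" by linarith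
    then have "(real (Suc n) * t - 1) / real (Suc n) \<le> real (nat \<lfloor>real (Suc n) * t\<rfloor>) / real (Suc n)"
      by (rule divide_right_mono) simp
    then show "t - 1 / real (Suc n) \<le> real (nat \<lfloor>real (Suc n) * t\<rfloor>) / real (Suc n)"
      by (simp add: diff_divide_distrib)
  qed
  show "\<forall>\<^sub>F n in sequentially. real (nat \<lfloor>real (Suc n) * t\<rfloor>) / real (Suc n) \<le> t"
  proof (rule always_eventually, rule allI)
    fix n
    have "0 \<le> real (Suc n) * t" using assms by (intro mult_nonneg_nonneg) auto
    then have "real (nat \<lfloor>real (Suc n) * t\<rfloor>) \<le> real (Suc n) * t" by linarith
    then have "real (nat \<lfloor>real (Suc n) * t\<rfloor>) / real (Suc n) \<le> real (Suc n) * t / real (Suc n)"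
      by (rule divide_right_mono) simp
    then show "real (nat \<lfloor>real (Suc n) * t\<rfloor>) / real (Suc n) \<le> t" by simp
  qed
qed

text \<open>The increments of the control bound \<open>W1\<close> and tend to \<open>0\<close>. Times up to \<open>t\<close> suffice, since the grid approaches \<open>t\<close>
from below.\<close>

lemma integral_continuous_in_control:
  fixes Om :: "'a::euclidean_space set"
  assumes Om: "compact Om" and g: "\<And>t. t \<in> {0..1} \<Longrightarrow> g t \<in> prob_on Om" and w: "controlled W1 g w"
    and t: "t \<in> {0..1}" "continuous (at t within {0..1}) w"
    and s: "\<And>n. s n \<in> {0..t}" "s \<longlonglongrightarrow> t" and \<phi>: "\<phi> \<in> C_space Om"
  shows "(\<lambda>n. \<integral>y. \<phi> y \<partial>g (s n)) \<longlonglongrightarrow> (\<integral>y. \<phi> y \<partial>g t)"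
proof (rule LIMSEQ_I)
  fix e :: real assume e: "0 < e"
  obtain L where L: "0 \<le> L" "\<And>x y. x \<in> Om \<Longrightarrow> y \<in> Om \<Longrightarrow> \<bar>\<phi> x - \<phi> y\<bar> \<le> e / 2 + L * dist x y"
    using C_space_almost_Lipschitz[OF \<phi> Om, of "e / 2"] e by auto
  have s01: "s n \<in> {0..1}" for n using s(1)[of n] t(1) by auto
  have "(\<lambda>n. w (s n)) \<longlonglongrightarrow> w t"
    using t(2) s01 s(2) unfolding continuous_within_sequentially comp_def by blast
  then have "(\<lambda>n. L * (w t - w (s n))) \<longlonglongrightarrow> L * (w t - w t)"
    by (intro tendsto_intros)
  then have "\<forall>\<^sub>F n in sequentially. L * (w t - w (s n)) < e / 2"
    using e order_tendstoD(2)[of "\<lambda>n. L * (w t - w (s n))" 0 sequentially "e / 2"] by simp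
  then obtain N where N: "\<And>n. n \<ge> N \<Longrightarrow> L * (w t - w (s n)) < e / 2"
    by (auto simp: eventually_sequentially)
  have "norm ((\<integral>y. \<phi> y \<partial>g (s n)) - (\<integral>y. \<phi> y \<partial>g t)) < e" if "n \<ge> N" for n
  proof (cases "s n = t")
    case False
    then have "s n < t" using s(1)[of n] by auto
    have "\<bar>(\<integral>y. \<phi> y \<partial>g t) - (\<integral>y. \<phi> y \<partial>g (s n))\<bar> \<le> e / 2 + L * W1 (g t) (g (s n))"
      by (rule W1_integral_diff[OF g[OF t(1)] g[OF s01] Om \<phi> L])
    also have "\<dots> \<le> e / 2 + L * (w t - w (s n))"
      using controlledD[OF w s01 t(1) \<open>s n < t\<close>] L(1) by (simp add: mult_left_mono)
    also have "\<dots> < e" using N[OF that] by simp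
    finally show ?thesis by (simp add: abs_minus_commute)
  qed (use e in simp)
  then show "\<exists>no. \<forall>n\<ge>no. norm ((\<integral>y. \<phi> y \<partial>g (s n)) - (\<integral>y. \<phi> y \<partial>g t)) < e" by blast
qed

text \<open>The grid is refined and the tolerance lowered at the same rate.\<close>

lemma mixture_approximation:
  fixes Om :: "'a::euclidean_space set"
  assumes Om: "compact Om" "Om \<noteq> {}" and g: "\<And>t. t \<in> {0..1} \<Longrightarrow> g t \<in> prob_on Om"
    and w: "controlled W1 g w" and \<eta>: "0 < \<eta>"
  shows "\<exists>I :: nat \<Rightarrow> (nat \<Rightarrow> 'a) set. \<exists>p x v.
    (\<forall>k. weights (I k) (p k)) \<and> (\<forall>k. path_family Om (I k) (x k) (v k)) \<and>
    (\<forall>k. (\<Sum>i\<in>I k. p k i * v k i 1) \<le> w 1 - w 0 + \<eta>) \<and>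
    (\<forall>t \<phi>. t \<in> {0..1} \<longrightarrow> continuous (at t within {0..1}) w \<longrightarrow> \<phi> \<in> C_space Om
      \<longrightarrow> (\<lambda>k. \<Sum>i\<in>I k. p k i * \<phi> (x k i t)) \<longlonglongrightarrow> (\<integral>y. \<phi> y \<partial>g t))"
proof -
  define e where "e k = \<eta> / real (Suc k)" for k
  have e: "0 < e k" "e k \<le> \<eta>" for k using \<eta> by (simp_all add: e_def field_simps)
  define grid where "grid k t = real (nat \<lfloor>real (Suc k) * t\<rfloor>) / real (Suc k)" for k t
  define good where "good k I p x v \<longleftrightarrow>
    weights I p \<and> path_family Om I x v \<and> (\<Sum>i\<in>I. p i * v i 1) \<le> w 1 - w 0 + e k \<and>
    (\<forall>t\<in>{0..1}. \<forall>\<phi>\<in>C_space Om. \<forall>L\<ge>0. \<forall>\<epsilon>.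
      (\<forall>x\<in>Om. \<forall>y\<in>Om. \<bar>\<phi> x - \<phi> y\<bar> \<le> \<epsilon> + L * dist x y) \<longrightarrow>
      \<bar>(\<Sum>i\<in>I. p i * \<phi> (x i t)) - (\<integral>y. \<phi> y \<partial>g (grid k t))\<bar> \<le> \<epsilon> + L * e k)"
    for k and I :: "(nat \<Rightarrow> 'a) set" and p x v
  have "\<forall>k. \<exists>I p x v. good k I p x v"
    unfolding good_def grid_def by (intro allI step_path_approximation[OF Om g w _ e(1)]) auto
  then obtain I where "\<forall>k. \<exists>p x v. good k (I k) p x v" by (rule choice[THEN exE])
  then obtain p where "\<forall>k. \<exists>x v. good k (I k) (p k) x v" by (rule choice[THEN exE])
  then obtain x where "\<forall>k. \<exists>v. good k (I k) (p k) (x k) v" by (rule choice[THEN exE])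
  then obtain v where good: "\<forall>k. good k (I k) (p k) (x k) (v k)" by (rule choice[THEN exE])
  have error: "\<bar>(\<Sum>i\<in>I k. p k i * \<phi> (x k i t)) - (\<integral>y. \<phi> y \<partial>g (grid k t))\<bar> \<le> \<epsilon> + L * e k"
    if "t \<in> {0..1}" "\<phi> \<in> C_space Om" "0 \<le> L"
      "\<forall>x\<in>Om. \<forall>y\<in>Om. \<bar>\<phi> x - \<phi> y\<bar> \<le> \<epsilon> + L * dist x y" for k t \<phi> L \<epsilon>
    using good[THEN spec, of k] that unfolding good_def by blast
  have lim: "(\<lambda>k. \<Sum>i\<in>I k. p k i * \<phi> (x k i t)) \<longlonglongrightarrow> (\<integral>y. \<phi> y \<partial>g t)"
    if t: "t \<in> {0..1}" "continuous (at t within {0..1}) w" and \<phi>: "\<phi> \<in> C_space Om" for t \<phi>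
  proof -
    have grid_lim: "(\<lambda>k. grid k t) \<longlonglongrightarrow> t"
      unfolding grid_def using t(1) by (intro floor_grid_tendsto) simp
    have "0 \<le> grid k t" "grid k t \<le> t" for k
    proof -
      have "0 \<le> real (Suc k) * t" using t(1) by (intro mult_nonneg_nonneg) auto
      then have "real (nat \<lfloor>real (Suc k) * t\<rfloor>) \<le> real (Suc k) * t" by linarith
      then have "grid k t \<le> real (Suc k) * t / real (Suc k)"
        unfolding grid_def by (rule divide_right_mono) simp
      then show "grid k t \<le> t" by simp
    qed (simp add: grid_def)
    then have int_lim: "(\<lambda>k. \<integral>y. \<phi> y \<partial>g (grid k t)) \<longlonglongrightarrow> (\<integral>y. \<phi> y \<partial>g t)"
      by (intro integral_continuous_in_control[OF Om(1) g w t _ grid_lim \<phi>]) auto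
    have "(\<lambda>k. (\<Sum>i\<in>I k. p k i * \<phi> (x k i t)) - (\<integral>y. \<phi> y \<partial>g (grid k t))) \<longlonglongrightarrow> 0"
    proof (rule LIMSEQ_I)
      fix r :: real assume r: "0 < r"
      obtain L where L: "0 \<le> L" "\<And>x y. x \<in> Om \<Longrightarrow> y \<in> Om \<Longrightarrow> \<bar>\<phi> x - \<phi> y\<bar> \<le> r / 2 + L * dist x y"
        using C_space_almost_Lipschitz[OF \<phi> Om(1), of "r / 2"] r by auto
      have "(\<lambda>k. L * \<eta> * inverse (real (Suc k))) \<longlonglongrightarrow> L * \<eta> * 0"
        by (intro tendsto_mult tendsto_const LIMSEQ_inverse_real_of_nat)
      then have "(\<lambda>k. L * e k) \<longlonglongrightarrow> 0" by (simp add: e_def divide_inverse mult.assoc)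
      from order_tendstoD(2)[OF this, of "r / 2"] r
      obtain N where N: "\<And>k. k \<ge> N \<Longrightarrow> L * e k < r / 2" by (auto simp: eventually_sequentially)
      have "norm ((\<Sum>i\<in>I k. p k i * \<phi> (x k i t)) - (\<integral>y. \<phi> y \<partial>g (grid k t)) - 0) < r" if "k \<ge> N" for k
      proof -
        have "\<bar>(\<Sum>i\<in>I k. p k i * \<phi> (x k i t)) - (\<integral>y. \<phi> y \<partial>g (grid k t))\<bar> \<le> r / 2 + L * e k"
          using L by (intro error t(1) \<phi>) auto
        then show ?thesis using N[OF that] by simp
      qed
      then show "\<exists>no. \<forall>k\<ge>no. norm ((\<Sum>i\<in>I k. p k i * \<phi> (x k i t)) - (\<integral>y. \<phi> y \<partial>g (grid k t)) - 0) < r"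
        by blast
    qed
    from tendsto_add[OF this int_lim] show ?thesis by simp
  qed
  show ?thesis
  proof (rule exI[of _ I], rule exI[of _ p], rule exI[of _ x], rule exI[of _ v], intro conjI allI impI)
    fix k
    show "weights (I k) (p k)" "path_family Om (I k) (x k) (v k)"
      using good[THEN spec, of k] by (simp_all add: good_def)
    have "(\<Sum>i\<in>I k. p k i * v k i 1) \<le> w 1 - w 0 + e k"
      using good[THEN spec, of k] by (simp add: good_def)
    then show "(\<Sum>i\<in>I k. p k i * v k i 1) \<le> w 1 - w 0 + \<eta>" using e(2)[of k] by linarith
  qed (rule lim)
qed

text \<open>The regularizer only sees the essential variation, so a representative of almost minimal variation has to be
chosen before it is approximated. Convergence holds wherever this representative agrees with the given curve and
its control is continuous.\<close>

lemma sparse_approximation: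
  fixes Om :: "'a::euclidean_space set"
  assumes Om: "compact Om" "Om \<noteq> {}" and \<alpha>: "0 < \<alpha>" and \<beta>: "0 < \<beta>"
    and \<mu>: "\<mu> \<in> admissible Om" and C: "regularizer Om \<alpha> \<beta> \<mu> < C"
  obtains I :: "nat \<Rightarrow> (nat \<Rightarrow> 'a) set" and c x w where
    "\<forall>k. finite (I k) \<and> I k \<noteq> {} \<and> (\<forall>i\<in>I k. 0 \<le> c k i) \<and> path_family Om (I k) (x k) (w k)"
    "\<forall>k. (\<Sum>i\<in>I k. c k i * (\<alpha> + \<beta> * w k i 1)) \<le> C"
    "AE t in lebesgue_on {0..1}. weak_star_tendsto Om (\<lambda>k. sparse_curve Om (I k) (c k) (x k) t) (\<mu> t)"
proof -
  obtain \<omega> \<rho> where fac: "factorizes Om \<mu> \<omega> \<rho>" using \<mu> by (auto simp: admissible_def)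
  then have \<omega>: "0 \<le> \<omega>" and \<rho>: "\<rho> \<in> BV_curves (prob_on Om) W1"
    and \<mu>_eq: "eq_ae \<mu> (\<lambda>t \<phi>. \<omega> * radon Om (\<rho> t) \<phi>)" by (auto simp: factorizes_def)
  define V where "V = enn2real (ess_variation (prob_on Om) W1 \<rho>)"
  have V: "ess_variation (prob_on Om) W1 \<rho> = ennreal V" "0 \<le> V"
    using \<rho> by (simp_all add: V_def BV_curves_def)
  define R where "R = \<alpha> * \<omega> + \<beta> * (\<omega> * V)"
  have R: "R < C"
    using C by (simp add: regularizer_def weight_eq[OF fac] curve_ess_variation_eq[OF Om(1) fac] R_def V_def)
  \<comment> \<open>\<open>\<eta>\<close> is spent twice, on the representative and on its approximation; adding \<open>1\<close> covers \<open>\<omega> = 0\<close>.\<close>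
  define \<eta> where "\<eta> = (C - R) / (2 * (\<omega> * \<beta> + 1))"
  have \<omega>\<beta>: "0 < \<omega> * \<beta> + 1" using \<omega> \<beta> by (intro add_nonneg_pos) auto
  then have \<eta>: "0 < \<eta>" using R by (simp add: \<eta>_def)
  have \<eta>_le: "R + 2 * \<eta> * (\<omega> * \<beta>) \<le> C"
  proof -
    have "2 * \<eta> * (\<omega> * \<beta>) \<le> 2 * \<eta> * (\<omega> * \<beta> + 1)" using \<eta> by (intro mult_left_mono) auto
    also have "\<dots> = C - R" using \<omega>\<beta> by (simp add: \<eta>_def field_simps)
    finally show ?thesis by simp
  qed
  have "ess_variation (prob_on Om) W1 \<rho> < ennreal (V + \<eta>)"
    unfolding V(1) using V(2) \<eta> by (intro ennreal_lessI) auto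
  then obtain g where g: "g ` {0..1} \<subseteq> prob_on Om" "eq_ae g \<rho>" "variation W1 g < ennreal (V + \<eta>)"
    unfolding ess_variation_def by (auto simp: INF_less_iff)
  have g_prob: "g t \<in> prob_on Om" if "t \<in> {0..1}" for t using g(1) that by blast
  have "variation W1 g < \<infinity>" using g(3) by (metis ennreal_less_top infinity_ennreal_def less_trans)
  then obtain w where w: "controlled W1 g w" "w 0 = 0" "ennreal (w 1) \<le> variation W1 g"
    by (rule control_exists)
  have "ennreal (w 1) < ennreal (V + \<eta>)" using w(3) g(3) by (rule le_less_trans)
  then have w1: "w 1 < V + \<eta>"
    using controlled_mono[OF w(1), of 0 1] w(2) by (simp add: ennreal_less_iff)
  obtain I :: "nat \<Rightarrow> (nat \<Rightarrow> 'a) set" and p x v where app: "(\<forall>k. weights (I k) (p k)) \<and> (\<forall>k. path_family Om (I k) (x k) (v k)) \<and>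
    (\<forall>k. (\<Sum>i\<in>I k. p k i * v k i 1) \<le> w 1 - w 0 + \<eta>) \<and>
    (\<forall>t \<phi>. t \<in> {0..1} \<longrightarrow> continuous (at t within {0..1}) w \<longrightarrow> \<phi> \<in> C_space Om
      \<longrightarrow> (\<lambda>k. \<Sum>i\<in>I k. p k i * \<phi> (x k i t)) \<longlonglongrightarrow> (\<integral>y. \<phi> y \<partial>g t))"
    using mixture_approximation[OF Om g_prob w(1) \<eta>] by blast
  then have app: "\<And>k. weights (I k) (p k)" "\<And>k. path_family Om (I k) (x k) (v k)"
    "\<And>k. (\<Sum>i\<in>I k. p k i * v k i 1) \<le> w 1 - w 0 + \<eta>"
    "\<And>t \<phi>. t \<in> {0..1} \<Longrightarrow> continuous (at t within {0..1}) w \<Longrightarrow> \<phi> \<in> C_space Om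
      \<Longrightarrow> (\<lambda>k. \<Sum>i\<in>I k. p k i * \<phi> (x k i t)) \<longlonglongrightarrow> (\<integral>y. \<phi> y \<partial>g t)"
    by blast+
  show thesis
  proof (rule that[of I "\<lambda>k i. \<omega> * p k i" x v])
    show "\<forall>k. finite (I k) \<and> I k \<noteq> {} \<and> (\<forall>i\<in>I k. 0 \<le> \<omega> * p k i) \<and> path_family Om (I k) (x k) (v k)"
    proof (intro allI conjI ballI app(2))
      fix k
      show "finite (I k)" using weights.finite[OF app(1)] .
      show "I k \<noteq> {}" using weights.sum_one[OF app(1), of k] by auto
      show "0 \<le> \<omega> * p k i" if "i \<in> I k" for i using weights.nonneg[OF app(1) that] \<omega> by simp
    qed
    show "\<forall>k. (\<Sum>i\<in>I k. \<omega> * p k i * (\<alpha> + \<beta> * v k i 1)) \<le> C"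
    proof
      fix k
      have "(\<Sum>i\<in>I k. \<omega> * p k i * (\<alpha> + \<beta> * v k i 1))
          = \<omega> * (\<alpha> * (\<Sum>i\<in>I k. p k i) + \<beta> * (\<Sum>i\<in>I k. p k i * v k i 1))"
        by (simp add: sum_distrib_left sum.distrib algebra_simps)
      also have "\<dots> \<le> \<omega> * (\<alpha> * 1 + \<beta> * (V + \<eta> + \<eta>))"
        using \<omega> \<alpha> \<beta> app(3)[of k] w1 w(2) weights.sum_one[OF app(1), of k]
        by (intro mult_left_mono add_mono) auto
      also have "\<dots> = R + 2 * \<eta> * (\<omega> * \<beta>)" by (simp add: R_def algebra_simps)
      finally show "(\<Sum>i\<in>I k. \<omega> * p k i * (\<alpha> + \<beta> * v k i 1)) \<le> C" using \<eta>_le by simp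
    qed
    have D: "countable {t \<in> {0..1}. \<not> continuous (at t within {0..1}) w}"
      by (rule controlled_countable_discont[OF w(1)])
    from AE_notin_countable[OF D] \<mu>_eq g(2)
    show "AE t in lebesgue_on {0..1}. weak_star_tendsto Om (\<lambda>k. sparse_curve Om (I k) (\<lambda>i. \<omega> * p k i) (x k) t) (\<mu> t)"
      unfolding eq_ae_def
    proof eventually_elim
      case (elim t)
      then have t: "t \<in> {0..1}" "continuous (at t within {0..1}) w" by auto
      show ?case
        unfolding weak_star_tendsto_def
      proof
        fix \<phi> assume \<phi>: "\<phi> \<in> C_space Om"
        have "sparse_curve Om (I k) (\<lambda>i. \<omega> * p k i) (x k) t \<phi> = \<omega> * (\<Sum>i\<in>I k. p k i * \<phi> (x k i t))" for k
          using dirac_apply[OF path_familyD(1)[OF app(2) _ t(1)] \<phi>]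
          by (simp add: sparse_curve_def sum_distrib_left mult.assoc)
        moreover have "\<mu> t \<phi> = \<omega> * (\<integral>y. \<phi> y \<partial>g t)"
          using elim \<phi> by (simp add: radon_def)
        ultimately show "(\<lambda>k. sparse_curve Om (I k) (\<lambda>i. \<omega> * p k i) (x k) t \<phi>) \<longlonglongrightarrow> \<mu> t \<phi>"
          using tendsto_mult_left[OF app(4)[OF t \<phi>], of \<omega>] by simp
      qed
    qed
  qed
qed


section \<open>Reduction of the number of atoms\<close>

text \<open>The vectors are indexed and need not be distinct; two equal ones are dependent by themselves.\<close>

lemma linear_dependency:
  fixes y :: "'i \<Rightarrow> 'b::euclidean_space"
  assumes "finite I" "DIM('b) < card I"
  obtains a where "(\<Sum>i\<in>I. a i *\<^sub>R y i) = 0" "\<exists>i\<in>I. a i \<noteq> 0"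
proof (cases "inj_on y I")
  case True
  then have "dependent (y ` I)"
    using assms by (intro dependent_biggerset) (simp add: card_image)
  then obtain u where u: "\<exists>v\<in>y ` I. u v \<noteq> 0" "(\<Sum>v\<in>y ` I. u v *\<^sub>R v) = 0"
    using dependent_finite[of "y ` I"] assms(1) by auto
  have "(\<Sum>i\<in>I. u (y i) *\<^sub>R y i) = 0"
    using u(2) by (simp add: sum.reindex[OF True])
  with u(1) show thesis by (intro that[of "\<lambda>i. u (y i)"]) auto
next
  case False
  then obtain j k where jk: "j \<in> I" "k \<in> I" "j \<noteq> k" "y j = y k" by (auto simp: inj_on_def)
  define a where "a i = (if i = j then 1 else if i = k then - 1 else 0 :: real)" for i
  have "(\<Sum>i\<in>I. a i *\<^sub>R y i) = (\<Sum>i\<in>{j, k}. a i *\<^sub>R y i)"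
    using assms(1) jk by (intro sum.mono_neutral_right) (auto simp: a_def)
  also have "\<dots> = 0" using jk by (simp add: a_def)
  finally show thesis using jk by (intro that[of a]) (auto simp: a_def)
qed

text \<open>As long as there are too many atoms, a dependency \<open>b\<close> of their observations can be subtracted from the weights
without changing the total observation. Its sign is chosen such that the cost does not increase and some
\<open>b i\<close> is positive, and its multiple such that the first weight reaches \<open>0\<close>.\<close>

lemma conic_caratheodory_with_cost:
  fixes y :: "'i \<Rightarrow> 'b::euclidean_space" and c d :: "'i \<Rightarrow> real"
  assumes "finite I" "\<And>i. i \<in> I \<Longrightarrow> 0 \<le> c i" "\<And>i. i \<in> I \<Longrightarrow> 0 \<le> d i"
  shows "\<exists>J c'. J \<subseteq> I \<and> card J \<le> DIM('b) \<and> (\<forall>i\<in>J. 0 \<le> c' i) \<and>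
    (\<Sum>i\<in>J. c' i *\<^sub>R y i) = (\<Sum>i\<in>I. c i *\<^sub>R y i) \<and> (\<Sum>i\<in>J. c' i * d i) \<le> (\<Sum>i\<in>I. c i * d i)"
  using assms
proof (induction "card I" arbitrary: I c rule: less_induct)
  case less
  show ?case
  proof (cases "card I \<le> DIM('b)")
    case True
    then show ?thesis using less.prems by (intro exI[of _ I] exI[of _ c]) auto
  next
    case False
    then obtain a where a: "(\<Sum>i\<in>I. a i *\<^sub>R y i) = 0" "\<exists>i\<in>I. a i \<noteq> 0"
      using linear_dependency[of I y] less.prems(1) by auto
    have "\<exists>b. (\<Sum>i\<in>I. b i *\<^sub>R y i) = 0 \<and> 0 \<le> (\<Sum>i\<in>I. b i * d i) \<and> (\<exists>i\<in>I. 0 < b i)"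
    proof -
      define neg where "neg = (\<lambda>i. - a i)"
      have neg: "(\<Sum>i\<in>I. neg i *\<^sub>R y i) = 0" "(\<Sum>i\<in>I. neg i * d i) = - (\<Sum>i\<in>I. a i * d i)"
        using a(1) by (simp_all add: neg_def sum_negf)
      have pos: "\<exists>i\<in>I. 0 < b i" if "0 < (\<Sum>i\<in>I. b i * d i)" for b
      proof (rule ccontr)
        assume "\<not> (\<exists>i\<in>I. 0 < b i)"
        then have "(\<Sum>i\<in>I. b i * d i) \<le> 0"
          using less.prems(3) by (intro sum_nonpos mult_nonpos_nonneg) (auto simp: not_less)
        with that show False by simp
      qed
      consider "0 < (\<Sum>i\<in>I. a i * d i)" | "(\<Sum>i\<in>I. a i * d i) < 0" | "(\<Sum>i\<in>I. a i * d i) = 0"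
        by linarith
      then show ?thesis
      proof cases
        case 1
        then show ?thesis using a(1) pos[OF 1] by (intro exI[of _ a]) simp
      next
        case 2
        then show ?thesis using neg pos[of neg] by (intro exI[of _ neg]) simp
      next
        case 3
        from a(2) obtain i where i: "i \<in> I" "a i \<noteq> 0" by blast
        show ?thesis
        proof (cases "0 < a i")
          case True
          then show ?thesis using a(1) 3 i by (intro exI[of _ a]) auto
        next
          case False
          then have "0 < neg i" using i by (simp add: neg_def)
          then show ?thesis using neg 3 i by (intro exI[of _ neg]) auto
        qed
      qed
    qed
    then obtain b where b: "(\<Sum>i\<in>I. b i *\<^sub>R y i) = 0" "0 \<le> (\<Sum>i\<in>I. b i * d i)" "\<exists>i\<in>I. 0 < b i"
      by blast
    define P where "P = {i \<in> I. 0 < b i}"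
    have P: "finite P" "P \<noteq> {}" using less.prems(1) b(3) by (auto simp: P_def)
    then obtain j where j: "j \<in> P" "\<And>i. i \<in> P \<Longrightarrow> c j / b j \<le> c i / b i"
      using finite_has_minimal[of "(\<lambda>i. c i / b i) ` P"] by (metis (no_types, lifting) arg_min_if_finite(1) arg_min_least)
    define \<tau> where "\<tau> = c j / b j"
    define c2 where "c2 i = c i - \<tau> * b i" for i
    have jI: "j \<in> I" "0 < b j" using j(1) by (auto simp: P_def)
    have \<tau>: "0 \<le> \<tau>" using less.prems(2)[OF jI(1)] jI(2) by (simp add: \<tau>_def)
    have c2j: "c2 j = 0" using jI by (simp add: c2_def \<tau>_def)
    have c2_nonneg: "0 \<le> c2 i" if "i \<in> I" for i
    proof (cases "0 < b i")
      case True
      then show ?thesis using j(2)[of i] that by (simp add: P_def c2_def \<tau>_def field_simps)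
    next
      case False
      then have "\<tau> * b i \<le> 0" using \<tau> by (simp add: mult_nonneg_nonpos)
      then show ?thesis using less.prems(2)[OF that] by (simp add: c2_def)
    qed
    have "(\<Sum>i\<in>I. c2 i *\<^sub>R y i) = (\<Sum>i\<in>I. c i *\<^sub>R y i) - \<tau> *\<^sub>R (\<Sum>i\<in>I. b i *\<^sub>R y i)"
      by (simp add: c2_def scaleR_left_diff_distrib sum_subtractf scaleR_sum_right)
    then have c2_y: "(\<Sum>i\<in>I - {j}. c2 i *\<^sub>R y i) = (\<Sum>i\<in>I. c i *\<^sub>R y i)"
      using b(1) less.prems(1) jI(1) c2j by (simp add: sum_diff1)
    have "(\<Sum>i\<in>I. c2 i * d i) = (\<Sum>i\<in>I. c i * d i) - \<tau> * (\<Sum>i\<in>I. b i * d i)"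
      by (simp add: c2_def left_diff_distrib sum_subtractf sum_distrib_left mult.assoc)
    moreover have "0 \<le> \<tau> * (\<Sum>i\<in>I. b i * d i)" using \<tau> b(2) by simp
    ultimately have c2_d: "(\<Sum>i\<in>I - {j}. c2 i * d i) \<le> (\<Sum>i\<in>I. c i * d i)"
      using less.prems(1) jI(1) c2j by (simp add: sum_diff1)
    have "card (I - {j}) < card I"
      using less.prems(1) jI(1) by (rule card_Diff1_less)
    from less.hyps[OF this, of c2] less.prems c2_nonneg
    obtain J c' where "J \<subseteq> I - {j}" "card J \<le> DIM('b)" "\<forall>i\<in>J. 0 \<le> c' i"
      "(\<Sum>i\<in>J. c' i *\<^sub>R y i) = (\<Sum>i\<in>I - {j}. c2 i *\<^sub>R y i)"
      "(\<Sum>i\<in>J. c' i * d i) \<le> (\<Sum>i\<in>I - {j}. c2 i * d i)" by auto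
    then show ?thesis using c2_y c2_d by (intro exI[of _ J] exI[of _ c']) auto
  qed
qed

text \<open>The remaining atoms are indexed by the coordinates of the observation space, with weight \<open>0\<close> for surplus indices, so that
all reduced curves have the same index set.\<close>

lemma conic_caratheodory_by_type:
  fixes y :: "'i \<Rightarrow> real ^ 'm" and c d :: "'i \<Rightarrow> real"
  assumes "finite I" "I \<noteq> {}" "\<And>i. i \<in> I \<Longrightarrow> 0 \<le> c i" "\<And>i. i \<in> I \<Longrightarrow> 0 \<le> d i"
  obtains h :: "'m \<Rightarrow> 'i" and c' where "range h \<subseteq> I" "\<forall>k. 0 \<le> c' k"
    "(\<Sum>k\<in>UNIV. c' k *\<^sub>R y (h k)) = (\<Sum>i\<in>I. c i *\<^sub>R y i)"
    "(\<Sum>k\<in>UNIV. c' k * d (h k)) \<le> (\<Sum>i\<in>I. c i * d i)"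
proof -
  obtain J b where J: "J \<subseteq> I" "card J \<le> CARD('m)" "\<forall>i\<in>J. 0 \<le> b i"
    "(\<Sum>i\<in>J. b i *\<^sub>R y i) = (\<Sum>i\<in>I. c i *\<^sub>R y i)" "(\<Sum>i\<in>J. b i * d i) \<le> (\<Sum>i\<in>I. c i * d i)"
  proof -
    have "\<exists>J b. J \<subseteq> I \<and> card J \<le> DIM(real ^ 'm) \<and> (\<forall>i\<in>J. 0 \<le> b i) \<and>
      (\<Sum>i\<in>J. b i *\<^sub>R y i) = (\<Sum>i\<in>I. c i *\<^sub>R y i) \<and> (\<Sum>i\<in>J. b i * d i) \<le> (\<Sum>i\<in>I. c i * d i)"
      by (rule conic_caratheodory_with_cost) (simp_all add: assms)
    then show ?thesis using that by auto
  qed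
  have "finite J" using J(1) assms(1) by (rule finite_subset)
  then obtain f :: "'i \<Rightarrow> 'm" where f: "inj_on f J"
    using J(2) inj_on_iff_card_le[of J "UNIV :: 'm set"] by auto
  obtain i0 where i0: "i0 \<in> I" using assms(2) by blast
  define h where "h k = (if k \<in> f ` J then inv_into J f k else i0)" for k
  define c' where "c' k = (if k \<in> f ` J then b (h k) else 0)" for k
  have hf: "h (f i) = i" "c' (f i) = b i" if "i \<in> J" for i
    using that f by (simp_all add: c'_def h_def)
  have "(\<Sum>k\<in>UNIV. c' k *\<^sub>R (y (h k), d (h k))) = (\<Sum>k\<in>f ` J. c' k *\<^sub>R (y (h k), d (h k)))"
    by (rule sum.mono_neutral_right) (auto simp: c'_def zero_prod_def)
  also have "\<dots> = (\<Sum>i\<in>J. b i *\<^sub>R (y i, d i))"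
    unfolding sum.reindex[OF f] by (rule sum.cong) (simp_all add: hf)
  finally have eq: "(\<Sum>k\<in>UNIV. c' k *\<^sub>R (y (h k), d (h k))) = (\<Sum>i\<in>J. b i *\<^sub>R (y i, d i))" .
  show thesis
  proof (rule that[of h c'])
    show "range h \<subseteq> I" using J(1) i0 by (auto simp: h_def inv_into_into subset_iff)
    show "\<forall>k. 0 \<le> c' k" using J(3) by (auto simp: c'_def h_def inv_into_into)
    show "(\<Sum>k\<in>UNIV. c' k *\<^sub>R y (h k)) = (\<Sum>i\<in>I. c i *\<^sub>R y i)"
      using arg_cong[OF eq, of fst] J(4) by (simp add: fst_sum)
    show "(\<Sum>k\<in>UNIV. c' k * d (h k)) \<le> (\<Sum>i\<in>I. c i * d i)"
      using arg_cong[OF eq, of snd] J(5) by (simp add: snd_sum)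
  qed
qed


section \<open>Compactness of sparse curves of bounded cost\<close>

lemma common_subsequence:
  fixes S :: "'i set"
  assumes "finite S"
    and refine: "\<And>i r. strict_mono r \<Longrightarrow> \<exists>k. strict_mono (k :: nat \<Rightarrow> nat) \<and> P i (r \<circ> k)"
    and stable: "\<And>i r k. P i r \<Longrightarrow> strict_mono (k :: nat \<Rightarrow> nat) \<Longrightarrow> P i (r \<circ> k)"
  shows "\<exists>r. strict_mono (r :: nat \<Rightarrow> nat) \<and> (\<forall>i\<in>S. P i r)"
  using assms(1)
proof (induction S)
  case empty
  show ?case by (rule exI[of _ id]) (simp add: strict_mono_def)
next
  case (insert i S)
  then obtain r where r: "strict_mono r" "\<forall>i\<in>S. P i r" by blast
  obtain k where "strict_mono k" "P i (r \<circ> k)" using refine[OF r(1)] by blast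
  with r stable strict_mono_o[OF r(1)] show ?case by (intro exI[of _ "r \<circ> k"]) blast
qed

text \<open>The limit \<open>V\<close> of the weighted variations may exceed the variation of the limit path: an atom of
vanishing weight can lose a positive amount of it.\<close>

definition atom_converges ::
    "'a::euclidean_space set \<Rightarrow> (nat \<Rightarrow> real) \<Rightarrow> (nat \<Rightarrow> real \<Rightarrow> 'a) \<Rightarrow> (nat \<Rightarrow> real \<Rightarrow> real)
      \<Rightarrow> real \<Rightarrow> (real \<Rightarrow> 'a) \<Rightarrow> (real \<Rightarrow> real) \<Rightarrow> real \<Rightarrow> bool" where
  "atom_converges Om c x w c' x' w' V \<longleftrightarrow>
    0 \<le> c' \<and> x' ` {0..1} \<subseteq> Om \<and> controlled dist x' w' \<and> w' 0 = 0 \<and> c' * w' 1 \<le> V \<and>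
    c \<longlonglongrightarrow> c' \<and> (\<lambda>j. c j * w j 1) \<longlonglongrightarrow> V \<and>
    (\<forall>t\<in>{0..1}. \<forall>\<phi>\<in>C_space Om. (\<lambda>j. c j * \<phi> (x j t)) \<longlonglongrightarrow> c' * \<phi> (x' t))"

lemma atom_converges_subseq:
  assumes "atom_converges Om c x w c' x' w' V" "strict_mono k"
  shows "atom_converges Om (c \<circ> k) (x \<circ> k) (w \<circ> k) c' x' w' V"
proof -
  have "(\<lambda>j. X (k j)) \<longlonglongrightarrow> L" if "X \<longlonglongrightarrow> L" for X :: "nat \<Rightarrow> real" and L
    using LIMSEQ_subseq_LIMSEQ[OF that assms(2)] by (simp add: comp_def)
  note this[of "c"] this[of "\<lambda>j. c j * w j 1"] this[of "\<lambda>j. c j * \<phi> (x j t)" for t \<phi>]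
  then show ?thesis using assms(1) unfolding atom_converges_def comp_def by simp
qed

text \<open>If the weights tend to \<open>0\<close>, the limit path is an arbitrary constant. Otherwise the weights are
eventually bounded below, hence the variations are bounded, and Helly's principle applies.\<close>

lemma atom_compactness:
  fixes Om :: "'a::euclidean_space set"
  assumes Om: "compact Om" "Om \<noteq> {}"
    and c: "\<And>j. 0 \<le> c j" "\<And>j. c j \<le> A" and cost: "\<And>j. c j * w j 1 \<le> B"
    and x: "\<And>j. x j ` {0..1} \<subseteq> Om" "\<And>j. controlled dist (x j) (w j)" "\<And>j. w j 0 = 0"
  shows "\<exists>k c' x' w' V. strict_mono (k :: nat \<Rightarrow> nat) \<and>
    atom_converges Om (c \<circ> k) (x \<circ> k) (w \<circ> k) c' x' w' V"
proof -
  have w1: "0 \<le> w j 1" for j using controlled_mono[OF x(2), of 0 1 j] x(3) by simp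
  have "(c j, c j * w j 1) \<in> {0..A} \<times> {0..B}" for j using c cost w1 by simp
  moreover have "seq_compact ({0..A} \<times> {0..B})"
    by (intro compact_imp_seq_compact compact_Times compact_Icc)
  ultimately obtain l k1 where k1: "strict_mono (k1 :: nat \<Rightarrow> nat)"
    "((\<lambda>j. (c j, c j * w j 1)) \<circ> k1) \<longlonglongrightarrow> l" "l \<in> {0..A} \<times> {0..B}"
    using seq_compactE[of "{0..A} \<times> {0..B}" "\<lambda>j. (c j, c j * w j 1)"] by blast
  define c' V where "c' = fst l" and "V = snd l"
  have lim: "(\<lambda>j. c (k1 j)) \<longlonglongrightarrow> c'" "(\<lambda>j. c (k1 j) * w (k1 j) 1) \<longlonglongrightarrow> V"
    using tendsto_fst[OF k1(2)] tendsto_snd[OF k1(2)] by (simp_all add: c'_def V_def comp_def)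
  have c'V: "0 \<le> c'" "0 \<le> V" using k1(3) by (auto simp: c'_def V_def)
  show ?thesis
  proof (cases "c' = 0")
    case True
    obtain x0 where x0: "x0 \<in> Om" using Om(2) by blast
    have "(\<lambda>j. c (k1 j) * \<phi> (x (k1 j) t)) \<longlonglongrightarrow> 0" if \<phi>: "\<phi> \<in> C_space Om" for \<phi> t
    proof -
      obtain M where M: "\<And>y. \<bar>\<phi> y\<bar> \<le> M" using C_space_bounded[OF \<phi> Om(1)] by blast
      have null: "(\<lambda>j. c (k1 j) * M) \<longlonglongrightarrow> 0" using tendsto_mult_right[OF lim(1), of M] True by simp
      have "norm (c (k1 j) * \<phi> (x (k1 j) t)) \<le> c (k1 j) * M" for j
        using M c(1) by (simp add: abs_mult mult_left_mono)
      then show ?thesis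
        by (intro Lim_null_comparison[OF always_eventually[OF allI] null])
    qed
    then have "atom_converges Om (c \<circ> k1) (x \<circ> k1) (w \<circ> k1) c' (\<lambda>_. x0) (\<lambda>_. 0) V"
      using True x0 c'V lim by (auto simp: atom_converges_def controlled_def comp_def mono_on_def)
    then show ?thesis using k1(1) by blast
  next
    case False
    then have c': "c' / 2 < c'" "0 < c'" using c'V by auto
    from order_tendstoD(1)[OF lim(1) c'(1)]
    obtain N where N: "\<And>j. j \<ge> N \<Longrightarrow> c' / 2 < c (k1 j)" by (auto simp: eventually_sequentially)
    \<comment> \<open>the tail along which the weights exceed \<open>c' / 2\<close>\<close>
    define k2 where "k2 j = k1 (j + N)" for j
    have k2: "strict_mono k2" using k1(1) by (simp add: k2_def strict_mono_def)
    have w_bound: "w (k2 j) 1 \<le> 2 * B / c'" for j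
    proof -
      have "c' / 2 * w (k2 j) 1 \<le> c (k2 j) * w (k2 j) 1"
        using N[of "j + N"] w1 by (intro mult_right_mono) (auto simp: k2_def)
      also have "\<dots> \<le> B" by (rule cost)
      finally show ?thesis using c'(2) by (simp add: field_simps)
    qed
    obtain C where C: "\<And>y. y \<in> Om \<Longrightarrow> norm y \<le> C"
      using compact_imp_bounded[OF Om(1)] by (auto simp: bounded_iff)
    obtain r x' w' where r: "strict_mono (r :: nat \<Rightarrow> nat)"
      "\<And>t. t \<in> {0..1} \<Longrightarrow> (\<lambda>j. x (k2 (r j)) t) \<longlonglongrightarrow> x' t"
      "\<And>t. t \<in> {0..1} \<Longrightarrow> (\<lambda>j. w (k2 (r j)) t) \<longlonglongrightarrow> w' t"
    proof (rule helly_selection_controlled[of "\<lambda>j. x (k2 j)" "\<lambda>j. w (k2 j)" "2 * B / c'" C])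
      show "norm (x (k2 j) t) \<le> C" if "t \<in> {0..1}" for j t using x(1) that by (intro C) blast
    qed (use x w_bound in auto)
    define k where "k = k2 \<circ> r"
    have k: "strict_mono k" unfolding k_def using k2 r(1) by (rule strict_mono_o)
    have lim': "(\<lambda>j. c (k j)) \<longlonglongrightarrow> c'" "(\<lambda>j. c (k j) * w (k j) 1) \<longlonglongrightarrow> V"
      using LIMSEQ_subseq_LIMSEQ[OF LIMSEQ_ignore_initial_segment[OF lim(1), of N] r(1)]
        LIMSEQ_subseq_LIMSEQ[OF LIMSEQ_ignore_initial_segment[OF lim(2), of N] r(1)]
      by (simp_all add: k_def k2_def comp_def)
    have x'_Om: "x' t \<in> Om" if "t \<in> {0..1}" for t
      using x(1) that by (intro closed_sequentially[OF compact_imp_closed[OF Om(1)] _ r(2)]) blast+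
    have "w' 0 = 0" using r(3)[of 0] x(3) by (simp add: LIMSEQ_const_iff)
    moreover have "controlled dist x' w'"
      by (rule controlled_limit[OF _ r(2,3)]) (rule x(2))
    moreover have "c' * w' 1 = V"
    proof -
      have "(\<lambda>j. w (k j) 1) \<longlonglongrightarrow> w' 1" using r(3)[of 1] by (simp add: k_def)
      from LIMSEQ_unique[OF lim'(2) tendsto_mult[OF lim'(1) this]] show ?thesis by simp
    qed
    moreover have "(\<lambda>j. c (k j) * \<phi> (x (k j) t)) \<longlonglongrightarrow> c' * \<phi> (x' t)"
      if t: "t \<in> {0..1}" and \<phi>: "\<phi> \<in> C_space Om" for t \<phi>
    proof (rule tendsto_mult[OF lim'(1)])
      have "x (k j) t \<in> Om" for j using x(1) t by blast
      then show "(\<lambda>j. \<phi> (x (k j) t)) \<longlonglongrightarrow> \<phi> (x' t)"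
        using \<phi> x'_Om[OF t] r(2)[OF t]
        by (intro continuous_on_tendsto_compose[of Om \<phi>]) (auto simp: C_space_def k_def)
    qed
    ultimately have "atom_converges Om (c \<circ> k) (x \<circ> k) (w \<circ> k) c' x' w' V"
      using c'V lim' x'_Om by (auto simp: atom_converges_def comp_def)
    then show ?thesis using k by blast
  qed
qed

text \<open>The limit \<open>S\<close> of the costs is kept apart from the cost of the limit, as only their inequality holds.\<close>

lemma sparse_compactness:
  fixes c :: "nat \<Rightarrow> 'i::finite \<Rightarrow> real" and Om :: "'a::euclidean_space set"
  assumes Om: "compact Om" "Om \<noteq> {}" and \<alpha>: "0 < \<alpha>" and \<beta>: "0 < \<beta>"
    and c: "\<And>j i. 0 \<le> c j i" and x: "\<And>j. path_family Om UNIV (x j) (w j)"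
    and cost: "\<And>j. (\<Sum>i\<in>UNIV. c j i * (\<alpha> + \<beta> * w j i 1)) \<le> C"
  obtains k and c' :: "'i \<Rightarrow> real" and x' w' S where "strict_mono (k :: nat \<Rightarrow> nat)" "\<forall>i. 0 \<le> c' i" "path_family Om UNIV x' w'"
    "(\<lambda>j. \<Sum>i\<in>UNIV. c (k j) i * (\<alpha> + \<beta> * w (k j) i 1)) \<longlonglongrightarrow> S"
    "(\<Sum>i\<in>UNIV. c' i * (\<alpha> + \<beta> * w' i 1)) \<le> S"
    "\<forall>t\<in>{0..1}. weak_star_tendsto Om (\<lambda>j. sparse_curve Om UNIV (c (k j)) (x (k j)) t) (sparse_curve Om UNIV c' x' t)"
proof -
  have w1: "0 \<le> w j i 1" for j i using path_control_nonneg[OF x, of i 1] by simp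
  have term_le: "c j i * (\<alpha> + \<beta> * w j i 1) \<le> C" for j i
  proof -
    have "c j i * (\<alpha> + \<beta> * w j i 1) \<le> (\<Sum>i\<in>UNIV. c j i * (\<alpha> + \<beta> * w j i 1))"
      using c w1 \<alpha> \<beta> by (intro member_le_sum) (auto intro!: mult_nonneg_nonneg add_nonneg_nonneg)
    then show ?thesis using cost[of j] by simp
  qed
  have c_le: "c j i \<le> C / \<alpha>" for j i
  proof -
    have "c j i * \<alpha> \<le> c j i * (\<alpha> + \<beta> * w j i 1)" using c w1 \<beta> by (intro mult_left_mono) auto
    then have "c j i * \<alpha> \<le> C" using term_le[of j i] by linarith
    then show ?thesis using \<alpha> by (simp add: field_simps)
  qed
  have cw_le: "c j i * w j i 1 \<le> C / \<beta>" for j i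
  proof -
    have "c j i * (\<beta> * w j i 1) \<le> c j i * (\<alpha> + \<beta> * w j i 1)" using c \<alpha> by (intro mult_left_mono) auto
    then have "c j i * w j i 1 * \<beta> \<le> C" using term_le[of j i] by (simp add: mult_ac)
    then show ?thesis using \<beta> by (simp add: pos_le_divide_eq)
  qed
  define P where "P i r \<longleftrightarrow> (\<exists>c' x' w' V. atom_converges Om
      (\<lambda>j. c (r j) i) (\<lambda>j. x (r j) i) (\<lambda>j. w (r j) i) c' x' w' V)" for i and r :: "nat \<Rightarrow> nat"
  have "\<exists>r. strict_mono (r :: nat \<Rightarrow> nat) \<and> (\<forall>i\<in>UNIV. P i r)"
  proof (rule common_subsequence)
    show "\<exists>k. strict_mono k \<and> P i (r \<circ> k)" if "strict_mono r" for i and r :: "nat \<Rightarrow> nat"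
    proof -
      have "\<exists>k c' x' w' V. strict_mono (k :: nat \<Rightarrow> nat) \<and>
          atom_converges Om ((\<lambda>j. c (r j) i) \<circ> k) ((\<lambda>j. x (r j) i) \<circ> k) ((\<lambda>j. w (r j) i) \<circ> k) c' x' w' V"
      proof (rule atom_compactness[OF Om, where A = "C / \<alpha>" and B = "C / \<beta>"])
        show "x (r j) i ` {0..1} \<subseteq> Om" for j using path_familyD(1)[OF x, of i] by blast
      qed (simp_all add: c c_le cw_le path_familyD[OF x])
      then show ?thesis unfolding P_def comp_def by blast
    qed
    show "P i (r \<circ> k)" if "P i r" "strict_mono k" for i and r k :: "nat \<Rightarrow> nat"
    proof -
      from that(1) obtain c' x' w' V where "atom_converges Om
        (\<lambda>j. c (r j) i) (\<lambda>j. x (r j) i) (\<lambda>j. w (r j) i) c' x' w' V" unfolding P_def by blast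
      from atom_converges_subseq[OF this that(2)] show ?thesis unfolding P_def comp_def by blast
    qed
  qed simp
  then obtain k where k: "strict_mono (k :: nat \<Rightarrow> nat)" "\<forall>i. P i k" by blast
  from k(2) have "\<forall>i. \<exists>c' x' w' V. atom_converges Om
      (\<lambda>j. c (k j) i) (\<lambda>j. x (k j) i) (\<lambda>j. w (k j) i) c' x' w' V" unfolding P_def .
  then obtain c' where "\<forall>i. \<exists>x' w' V. atom_converges Om
      (\<lambda>j. c (k j) i) (\<lambda>j. x (k j) i) (\<lambda>j. w (k j) i) (c' i) x' w' V" by (rule choice[THEN exE])
  then obtain x' where "\<forall>i. \<exists>w' V. atom_converges Om
      (\<lambda>j. c (k j) i) (\<lambda>j. x (k j) i) (\<lambda>j. w (k j) i) (c' i) (x' i) w' V" by (rule choice[THEN exE])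
  then obtain w' where "\<forall>i. \<exists>V. atom_converges Om
      (\<lambda>j. c (k j) i) (\<lambda>j. x (k j) i) (\<lambda>j. w (k j) i) (c' i) (x' i) (w' i) V" by (rule choice[THEN exE])
  then obtain V where V: "\<forall>i. atom_converges Om
      (\<lambda>j. c (k j) i) (\<lambda>j. x (k j) i) (\<lambda>j. w (k j) i) (c' i) (x' i) (w' i) (V i)" by (rule choice[THEN exE])
  from V[unfolded atom_converges_def] have atom: "0 \<le> c' i" "x' i ` {0..1} \<subseteq> Om" "controlled dist (x' i) (w' i)" "w' i 0 = 0"
    "c' i * w' i 1 \<le> V i" "(\<lambda>j. c (k j) i) \<longlonglongrightarrow> c' i" "(\<lambda>j. c (k j) i * w (k j) i 1) \<longlonglongrightarrow> V i"
    "\<And>t \<phi>. t \<in> {0..1} \<Longrightarrow> \<phi> \<in> C_space Om \<Longrightarrow> (\<lambda>j. c (k j) i * \<phi> (x (k j) i t)) \<longlonglongrightarrow> c' i * \<phi> (x' i t)"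
    for i by blast+
  have x': "path_family Om UNIV x' w'" using atom(2-4) by (simp add: path_family_def)
  show thesis
  proof (rule that[of k c' x' w' "\<Sum>i\<in>UNIV. c' i * \<alpha> + \<beta> * V i", OF k(1) _ x'])
    show "\<forall>i. 0 \<le> c' i" using atom(1) by blast
    have "(\<lambda>j. \<Sum>i\<in>UNIV. c (k j) i * \<alpha> + \<beta> * (c (k j) i * w (k j) i 1))
        \<longlonglongrightarrow> (\<Sum>i\<in>UNIV. c' i * \<alpha> + \<beta> * V i)"
      by (intro tendsto_intros atom(6,7))
    then show "(\<lambda>j. \<Sum>i\<in>UNIV. c (k j) i * (\<alpha> + \<beta> * w (k j) i 1)) \<longlonglongrightarrow> (\<Sum>i\<in>UNIV. c' i * \<alpha> + \<beta> * V i)"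
      by (simp add: distrib_left mult_ac)
    show "(\<Sum>i\<in>UNIV. c' i * (\<alpha> + \<beta> * w' i 1)) \<le> (\<Sum>i\<in>UNIV. c' i * \<alpha> + \<beta> * V i)"
    proof (rule sum_mono)
      fix i
      have "\<beta> * (c' i * w' i 1) \<le> \<beta> * V i" using atom(5) \<beta> by (intro mult_left_mono) auto
      then show "c' i * (\<alpha> + \<beta> * w' i 1) \<le> c' i * \<alpha> + \<beta> * V i" by (simp add: algebra_simps)
    qed
    show "\<forall>t\<in>{0..1}. weak_star_tendsto Om (\<lambda>j. sparse_curve Om UNIV (c (k j)) (x (k j)) t) (sparse_curve Om UNIV c' x' t)"
      unfolding weak_star_tendsto_def
    proof (intro ballI)
      fix t :: real assume t: "t \<in> {0..1}"
      fix \<phi> assume \<phi>: "\<phi> \<in> C_space Om"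
      have "(\<lambda>j. \<Sum>i\<in>UNIV. c (k j) i * \<phi> (x (k j) i t)) \<longlonglongrightarrow> (\<Sum>i\<in>UNIV. c' i * \<phi> (x' i t))"
        by (intro tendsto_sum atom(8) t \<phi>)
      then show "(\<lambda>j. sparse_curve Om UNIV (c (k j)) (x (k j)) t \<phi>) \<longlonglongrightarrow> sparse_curve Om UNIV c' x' t \<phi>"
        using dirac_apply[OF path_familyD(1)[OF x _ t] \<phi>] dirac_apply[OF path_familyD(1)[OF x' _ t] \<phi>]
        by (simp add: sparse_curve_def)
    qed
  qed
qed


section \<open>Existence of a sparse minimizer\<close>

lemma weak_tendsto_imp_tendsto:
  fixes y :: "nat \<Rightarrow> 'y::euclidean_space"
  assumes "weak_tendsto y l"
  shows "y \<longlonglongrightarrow> l"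
proof -
  have "(\<lambda>j. y j \<bullet> b) \<longlonglongrightarrow> l \<bullet> b" for b
    using assms bounded_linear_inner_left[of b] unfolding weak_tendsto_def by blast
  then show ?thesis by (subst tendsto_componentwise_iff) auto
qed

lemma path_family_reindex:
  assumes "path_family Om I x w" "range h \<subseteq> I"
  shows "path_family Om UNIV (\<lambda>k. x (h k)) (\<lambda>k. w (h k))"
  using assms unfolding path_family_def by blast

locale observation =
  fixes Om :: "'a::euclidean_space set"
    and K :: "(real \<Rightarrow> ('a \<Rightarrow> real) \<Rightarrow> real) \<Rightarrow> real ^ 'm"
    and \<alpha> \<beta> :: real
  assumes compact: "compact Om" and nonempty: "Om \<noteq> {}" and \<alpha>: "0 < \<alpha>" and \<beta>: "0 < \<beta>"
    and linear: "\<exists>K'. linear_on_L2w Om K' \<and> (\<forall>\<mu>\<in>admissible Om. K' \<mu> = K \<mu>)"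
    and continuous: "\<And>\<mu>s \<mu>. (\<And>j::nat. \<mu>s j \<in> admissible Om) \<Longrightarrow> \<mu> \<in> admissible Om \<Longrightarrow>
      (AE t in lebesgue_on {0..1}. weak_star_tendsto Om (\<lambda>j. \<mu>s j t) (\<mu> t)) \<Longrightarrow>
      weak_tendsto (\<lambda>j. K (\<mu>s j)) (K \<mu>)"
begin

definition cost :: "'i set \<Rightarrow> ('i \<Rightarrow> real) \<Rightarrow> ('i \<Rightarrow> real \<Rightarrow> real) \<Rightarrow> real" where
  "cost I c w = (\<Sum>i\<in>I. c i * (\<alpha> + \<beta> * w i 1))"

lemma cost_nonneg:
  assumes "\<And>i. i \<in> I \<Longrightarrow> 0 \<le> c i" "path_family Om I x w"
  shows "0 \<le> cost I c w"
  unfolding cost_def using assms(1) path_control_nonneg[OF assms(2)] \<alpha> \<beta>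
  by (intro sum_nonneg mult_nonneg_nonneg add_nonneg_nonneg) auto

lemma K_sparse:
  assumes "finite I" "I \<noteq> {}" "\<And>i. i \<in> I \<Longrightarrow> 0 \<le> c i" "path_family Om I x w"
  shows "K (sparse_curve Om I c x) = (\<Sum>i\<in>I. c i *\<^sub>R K (\<lambda>t. dirac Om (x i t)))"
proof -
  obtain K' where K': "linear_on_L2w Om K'" "\<And>\<mu>. \<mu> \<in> admissible Om \<Longrightarrow> K' \<mu> = K \<mu>"
    using linear by blast
  have atom: "K' (\<lambda>t. dirac Om (x i t)) = K (\<lambda>t. dirac Om (x i t))" if "i \<in> I" for i
  proof (rule K'(2))
    have "path_family Om {i} x w" using assms(4) that by (auto simp: path_family_def)
    from sparse_admissible(1)[OF _ _ compact nonempty _ this less_imp_le[OF \<beta>], of "\<lambda>_. 1"]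
    show "(\<lambda>t. dirac Om (x i t)) \<in> admissible Om" by (simp add: sparse_curve_def)
  qed
  have "K (sparse_curve Om I c x) = K' (sparse_curve Om I c x)"
    using sparse_admissible(1)[OF assms(1,2) compact nonempty assms(3,4) less_imp_le[OF \<beta>]] K'(2) by simp
  also have "\<dots> = (\<Sum>i\<in>I. c i *\<^sub>R K' (\<lambda>t. dirac Om (x i t)))"
    by (rule linear_on_sparse[OF K'(1) assms(1) compact nonempty assms(3,4)])
  finally show ?thesis by (simp add: atom)
qed

lemma sparse_limit:
  fixes c :: "nat \<Rightarrow> 'i::finite \<Rightarrow> real"
  assumes c: "\<And>j i. 0 \<le> c j i" and x: "\<And>j. path_family Om UNIV (x j) (w j)"
    and C: "\<And>j. cost UNIV (c j) (w j) \<le> C"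
  obtains k and c' :: "'i \<Rightarrow> real" and x' w' S where "strict_mono (k :: nat \<Rightarrow> nat)"
    "\<forall>i. 0 \<le> c' i" "path_family Om UNIV x' w'"
    "(\<lambda>j. cost UNIV (c (k j)) (w (k j))) \<longlonglongrightarrow> S" "cost UNIV c' w' \<le> S"
    "weak_tendsto (\<lambda>j. K (sparse_curve Om UNIV (c (k j)) (x (k j)))) (K (sparse_curve Om UNIV c' x'))"
proof -
  obtain k and c' :: "'i \<Rightarrow> real" and x' w' S where k: "strict_mono (k :: nat \<Rightarrow> nat)"
    and c': "\<forall>i. 0 \<le> c' i" and x': "path_family Om UNIV x' w'"
    and S: "(\<lambda>j. \<Sum>i\<in>UNIV. c (k j) i * (\<alpha> + \<beta> * w (k j) i 1)) \<longlonglongrightarrow> S"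
      "(\<Sum>i\<in>UNIV. c' i * (\<alpha> + \<beta> * w' i 1)) \<le> S"
    and lim: "\<forall>t\<in>{0..1}.
      weak_star_tendsto Om (\<lambda>j. sparse_curve Om UNIV (c (k j)) (x (k j)) t) (sparse_curve Om UNIV c' x' t)"
    by (rule sparse_compactness[OF compact nonempty \<alpha> \<beta> c x C[unfolded cost_def]])
  have "weak_tendsto (\<lambda>j. K (sparse_curve Om UNIV (c (k j)) (x (k j)))) (K (sparse_curve Om UNIV c' x'))"
  proof (rule continuous)
    show "sparse_curve Om UNIV (c (k j)) (x (k j)) \<in> admissible Om" for j
      using c x by (intro sparse_admissible(1)[OF _ _ compact nonempty _ _ less_imp_le[OF \<beta>]]) auto
    show "sparse_curve Om UNIV c' x' \<in> admissible Om"
      using c' x' by (intro sparse_admissible(1)[OF _ _ compact nonempty _ _ less_imp_le[OF \<beta>]]) auto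
    show "AE t in lebesgue_on {0..1}. weak_star_tendsto Om
        (\<lambda>j. sparse_curve Om UNIV (c (k j)) (x (k j)) t) (sparse_curve Om UNIV c' x' t)"
      using lim by (intro AE_I2) (simp add: lebesgue_on_space)
  qed
  from that[OF k c' x' S[folded cost_def] this] show thesis .
qed

text \<open>The observation of the limit is exactly \<open>K \<mu>\<close>: the reduction to \<open>m\<close> atoms does not change the observations of the
approximating curves, and these converge to \<open>K \<mu>\<close>.\<close>

lemma sparse_replacement:
  assumes \<mu>: "\<mu> \<in> admissible Om" and C: "regularizer Om \<alpha> \<beta> \<mu> < C"
  obtains c :: "'m \<Rightarrow> real" and x w where "\<forall>i. 0 \<le> c i" "path_family Om UNIV x w"
    "K (sparse_curve Om UNIV c x) = K \<mu>" "cost UNIV c w \<le> C"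
proof -
  obtain I :: "nat \<Rightarrow> (nat \<Rightarrow> 'a) set" and c x w where
    fam: "\<forall>k. finite (I k) \<and> I k \<noteq> {} \<and> (\<forall>i\<in>I k. 0 \<le> c k i) \<and> path_family Om (I k) (x k) (w k)"
    and le_C: "\<forall>k. (\<Sum>i\<in>I k. c k i * (\<alpha> + \<beta> * w k i 1)) \<le> C"
    and lim: "AE t in lebesgue_on {0..1}. weak_star_tendsto Om (\<lambda>k. sparse_curve Om (I k) (c k) (x k) t) (\<mu> t)"
    by (rule sparse_approximation[OF compact nonempty \<alpha> \<beta> \<mu> C])
  from fam have I: "finite (I k)" "I k \<noteq> {}" and c: "i \<in> I k \<Longrightarrow> 0 \<le> c k i"
    and x: "path_family Om (I k) (x k) (w k)" for k i by simp_all
  have K_lim: "weak_tendsto (\<lambda>k. K (sparse_curve Om (I k) (c k) (x k))) (K \<mu>)"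
    by (rule continuous[OF _ \<mu> lim])
      (rule sparse_admissible(1)[OF I compact nonempty c x less_imp_le[OF \<beta>]])
  \<comment> \<open>the reduction of the \<open>k\<close>-th approximating curve to the atoms selected by \<open>h\<close> with weights \<open>b\<close>\<close>
  define red where "red k h b \<longleftrightarrow> range h \<subseteq> I k \<and> (\<forall>i. 0 \<le> b i) \<and>
      K (sparse_curve Om UNIV b (\<lambda>i. x k (h i))) = K (sparse_curve Om (I k) (c k) (x k)) \<and>
      cost UNIV b (\<lambda>i. w k (h i)) \<le> C"
    for k and h :: "'m \<Rightarrow> nat \<Rightarrow> 'a" and b
  have "\<forall>k. \<exists>h b. red k h b"
  proof
    fix k
    have "0 \<le> \<alpha> + \<beta> * w k i 1" if "i \<in> I k" for i
      using path_control_nonneg[OF x that, of 1] \<alpha> \<beta> by (intro add_nonneg_nonneg mult_nonneg_nonneg) auto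
    with I[of k] c[of _ k] obtain h :: "'m \<Rightarrow> nat \<Rightarrow> 'a" and b where h: "range h \<subseteq> I k" "\<forall>i. 0 \<le> b i"
      "(\<Sum>i\<in>UNIV. b i *\<^sub>R K (\<lambda>t. dirac Om (x k (h i) t))) = (\<Sum>i\<in>I k. c k i *\<^sub>R K (\<lambda>t. dirac Om (x k i t)))"
      "(\<Sum>i\<in>UNIV. b i * (\<alpha> + \<beta> * w k (h i) 1)) \<le> (\<Sum>i\<in>I k. c k i * (\<alpha> + \<beta> * w k i 1))"
      by (rule conic_caratheodory_by_type[of "I k" "c k" "\<lambda>i. \<alpha> + \<beta> * w k i 1" "\<lambda>i. K (\<lambda>t. dirac Om (x k i t))"])
    have "K (sparse_curve Om UNIV b (\<lambda>i. x k (h i))) = K (sparse_curve Om (I k) (c k) (x k))"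
      using K_sparse[OF _ _ _ path_family_reindex[OF x h(1)], of b] K_sparse[OF I c x, of k] h(2,3) by simp
    then have "red k h b" using h le_C[THEN spec, of k] by (simp add: red_def cost_def)
    then show "\<exists>h b. red k h b" by blast
  qed
  then obtain h where "\<forall>k. \<exists>b. red k (h k) b" by (rule choice[THEN exE])
  then obtain b where red: "\<forall>k. red k (h k) (b k)" by (rule choice[THEN exE])
  then have b: "0 \<le> b k i" and h: "range (h k) \<subseteq> I k"
    and K_eq: "K (sparse_curve Om UNIV (b k) (\<lambda>i. x k (h k i))) = K (sparse_curve Om (I k) (c k) (x k))"
    and b_C: "cost UNIV (b k) (\<lambda>i. w k (h k i)) \<le> C" for k i
    by (simp_all add: red_def)
  obtain r and c' :: "'m \<Rightarrow> real" and x' w' S where r: "strict_mono (r :: nat \<Rightarrow> nat)"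
    and c': "\<forall>i. 0 \<le> c' i" "path_family Om UNIV x' w'"
    and S: "(\<lambda>j. cost UNIV (b (r j)) (\<lambda>i. w (r j) (h (r j) i))) \<longlonglongrightarrow> S" "cost UNIV c' w' \<le> S"
    and K_lim': "weak_tendsto (\<lambda>j. K (sparse_curve Om UNIV (b (r j)) (\<lambda>i. x (r j) (h (r j) i)))) (K (sparse_curve Om UNIV c' x'))"
    by (rule sparse_limit[OF b path_family_reindex[OF x h] b_C])
  have "(\<lambda>j. K (sparse_curve Om (I (r j)) (c (r j)) (x (r j)))) \<longlonglongrightarrow> K (sparse_curve Om UNIV c' x')"
    using weak_tendsto_imp_tendsto[OF K_lim'] by (simp add: K_eq)
  moreover have "(\<lambda>j. K (sparse_curve Om (I (r j)) (c (r j)) (x (r j)))) \<longlonglongrightarrow> K \<mu>"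
    using LIMSEQ_subseq_LIMSEQ[OF weak_tendsto_imp_tendsto[OF K_lim] r] by (simp add: comp_def)
  ultimately have "K (sparse_curve Om UNIV c' x') = K \<mu>" by (rule LIMSEQ_unique)
  moreover have "S \<le> C" using LIMSEQ_le_const2[OF S(1)] b_C by blast
  ultimately show thesis using that[OF c'] S(2) by auto
qed

text \<open>If the infimum is infinite, every sparse curve is a minimizer. Otherwise the lower bound of \<open>F\<close> bounds the
costs along a minimizing sequence. Costs and objective values converge along a subsequence, hence so do the values
of \<open>F\<close>, and lower semicontinuity applies to them.\<close>

lemma sparse_minimizer_exists:
  fixes F :: "real ^ 'm \<Rightarrow> ereal"
  assumes bounded: "\<exists>b::real. \<forall>y. ereal b \<le> F y" and lsc: "weakly_lsc F"
  obtains c :: "'m \<Rightarrow> real" and x w where "\<forall>i. 0 \<le> c i" "path_family Om UNIV x w"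
    "\<forall>b z v. (\<forall>i. 0 \<le> b i) \<longrightarrow> path_family Om UNIV z v \<longrightarrow>
      F (K (sparse_curve Om UNIV c x)) + ereal (cost UNIV c w)
        \<le> F (K (sparse_curve Om UNIV b z)) + ereal (cost (UNIV :: 'm set) b v)"
proof -
  define T where "T = {(c :: 'm \<Rightarrow> real, x, w). (\<forall>i. 0 \<le> c i) \<and> path_family Om (UNIV :: 'm set) x w}"
  define val where "val = (\<lambda>(c :: 'm \<Rightarrow> real, x :: 'm \<Rightarrow> real \<Rightarrow> 'a, w :: 'm \<Rightarrow> real \<Rightarrow> real). F (K (sparse_curve Om UNIV c x)) + ereal (cost UNIV c w))"
  define m where "m = (INF p\<in>T. val p)"
  obtain B :: real where B: "\<And>y. ereal B \<le> F y" using bounded by blast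
  have val_ge: "ereal (B + cost UNIV c w) \<le> val (c, x, w)" for c x w
    using add_mono[OF B order_refl] by (simp add: val_def plus_ereal.simps(1)[symmetric] del: plus_ereal.simps)
  have cost_ge: "0 \<le> cost UNIV c w" if "(c, x, w) \<in> T" for c x w
    using that by (intro cost_nonneg[of _ _ x]) (auto simp: T_def)
  obtain x0 where x0: "x0 \<in> Om" using nonempty by blast
  have T_ne: "(\<lambda>_. 0, \<lambda>_ _. x0, \<lambda>_ _. 0) \<in> T"
    using x0 by (auto simp: T_def path_family_def controlled_def mono_on_def)
  have "\<exists>p\<in>T. val p \<le> m"
  proof (cases "m = \<infinity>")
    case True
    then show ?thesis using T_ne by auto
  next
    case False
    have "ereal B \<le> m"
      unfolding m_def
    proof (rule INF_greatest)
      fix p assume p: "p \<in> T"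
      obtain c x w where p_eq: "p = (c, x, w)" by (cases p)
      have "ereal B \<le> ereal (B + cost UNIV c w)" using cost_ge p p_eq by simp
      also have "\<dots> \<le> val p" unfolding p_eq by (rule val_ge)
      finally show "ereal B \<le> val p" .
    qed
    with False obtain m' where m': "m = ereal m'" by (cases m) auto
    obtain f where f: "decseq f" "range f \<subseteq> val ` T" "Inf (val ` T) = (INF i. f i)"
      using Inf_countable_INF[of "val ` T"] T_ne by blast
    have f_lim: "f \<longlonglongrightarrow> m"
      using LIMSEQ_INF[OF f(1)] f(3) by (simp add: m_def)
    have "m < ereal (m' + 1)" by (simp add: m')
    from order_tendstoD(2)[OF f_lim this] obtain N where N: "\<And>n. n \<ge> N \<Longrightarrow> f n < ereal (m' + 1)"
      by (auto simp: eventually_sequentially)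
    have "\<forall>n. \<exists>p. p \<in> T \<and> val p = f (n + N)"
      using f(2) by (metis (no_types, lifting) imageE range_subsetD)
    then obtain p where p: "\<forall>n. p n \<in> T \<and> val (p n) = f (n + N)" by (rule choice[THEN exE])
    define c x w where "c n = fst (p n)" and "x n = fst (snd (p n))" and "w n = snd (snd (p n))" for n
    have p_eq: "p n = (c n, x n, w n)" for n by (simp add: c_def x_def w_def)
    have c: "0 \<le> c n i" and x: "path_family Om UNIV (x n) (w n)" for n i
    proof -
      have "(c n, x n, w n) \<in> T" using p p_eq[of n] by metis
      then show "0 \<le> c n i" "path_family Om UNIV (x n) (w n)" by (simp_all add: T_def)
    qed
    have cost_le: "cost UNIV (c n) (w n) \<le> m' + 1 - B" for n
    proof -
      have "ereal (B + cost UNIV (c n) (w n)) \<le> val (p n)" unfolding p_eq by (rule val_ge)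
      also have "\<dots> < ereal (m' + 1)" using p N[of "n + N"] by simp
      finally show ?thesis by simp
    qed
    obtain k and c' :: "'m \<Rightarrow> real" and x' w' S where k: "strict_mono (k :: nat \<Rightarrow> nat)"
      and c': "\<forall>i. 0 \<le> c' i" "path_family Om UNIV x' w'"
      and S: "(\<lambda>j. cost UNIV (c (k j)) (w (k j))) \<longlonglongrightarrow> S" "cost UNIV c' w' \<le> S"
      and K_lim: "weak_tendsto (\<lambda>j. K (sparse_curve Om UNIV (c (k j)) (x (k j)))) (K (sparse_curve Om UNIV c' x'))"
      by (rule sparse_limit[OF c x cost_le])
    have "(\<lambda>j. val (p (k j))) \<longlonglongrightarrow> m"
      using LIMSEQ_subseq_LIMSEQ[OF LIMSEQ_ignore_initial_segment[OF f_lim, of N] k] p by (simp add: comp_def)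
    then have "(\<lambda>j. val (p (k j)) - ereal (cost UNIV (c (k j)) (w (k j)))) \<longlonglongrightarrow> m - ereal S"
      using S(1) by (intro tendsto_diff_ereal) (auto simp: m')
    moreover have "val (p (k j)) - ereal (cost UNIV (c (k j)) (w (k j))) = F (K (sparse_curve Om UNIV (c (k j)) (x (k j))))" for j
      by (cases "F (K (sparse_curve Om UNIV (c (k j)) (x (k j))))") (simp_all add: p_eq val_def)
    ultimately have "(\<lambda>j. F (K (sparse_curve Om UNIV (c (k j)) (x (k j))))) \<longlonglongrightarrow> m - ereal S" by simp
    from lim_imp_Liminf[OF _ this]
    have "F (K (sparse_curve Om UNIV c' x')) \<le> m - ereal S"
      using lsc K_lim unfolding weakly_lsc_def by fastforce
    then have "F (K (sparse_curve Om UNIV c' x')) + ereal (cost UNIV c' w') \<le> (m - ereal S) + ereal S"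
      using S(2) by (intro add_mono) auto
    also have "\<dots> = m" by (simp add: m')
    finally have "val (c', x', w') \<le> m" by (simp add: val_def)
    then show ?thesis using c' by (intro bexI[of _ "(c', x', w')"]) (auto simp: T_def)
  qed
  then obtain c x w where cxw: "(c, x, w) \<in> T" "val (c, x, w) \<le> m" by (metis prod_cases3)
  show thesis
  proof (rule that[of c x w])
    show "\<forall>i. 0 \<le> c i" using cxw(1) by (simp add: T_def)
    show "path_family Om UNIV x w" using cxw(1) by (simp add: T_def)
    show "\<forall>b z v. (\<forall>i. 0 \<le> b i) \<longrightarrow> path_family Om UNIV z v \<longrightarrow>
      F (K (sparse_curve Om UNIV c x)) + ereal (cost UNIV c w)
        \<le> F (K (sparse_curve Om UNIV b z)) + ereal (cost (UNIV :: 'm set) b v)"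
    proof (intro allI impI)
      fix b :: "'m \<Rightarrow> real" and z v
      assume "\<forall>i. 0 \<le> b i" "path_family Om (UNIV :: 'm set) z v"
      then have "(b, z, v) \<in> T" by (simp add: T_def)
      then have "m \<le> val (b, z, v)" unfolding m_def by (rule INF_lower)
      with cxw(2) have "val (c, x, w) \<le> val (b, z, v)" by (rule order_trans)
      then show "F (K (sparse_curve Om UNIV c x)) + ereal (cost UNIV c w)
          \<le> F (K (sparse_curve Om UNIV b z)) + ereal (cost UNIV b v)" by (simp add: val_def)
    qed
  qed
qed

end

theorem theorem1p10:
  fixes Om :: "(real ^ 'n) set" and \<alpha> \<beta> :: real
    and F :: "real ^ 'm \<Rightarrow> ereal"
    and K :: "(real \<Rightarrow> ((real ^ 'n) \<Rightarrow> real) \<Rightarrow> real) \<Rightarrow> real ^ 'm"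
  assumes "Om \<noteq> {}" and "compact Om" and "convex Om"
    and "\<alpha> > 0" and "\<beta> > 0"
    and F_range: "\<And>y. F y \<noteq> -\<infinity>"
    and F_convex: "convex_ereal F"
    and F_bounded_below: "\<exists>c::real. \<forall>y. ereal c \<le> F y"
    and F_proper: "\<exists>y. F y \<noteq> \<infinity>"
    and F_lsc: "weakly_lsc F"
    and K_linear: "\<exists>K'. linear_on_L2w Om K' \<and> (\<forall>\<mu>\<in>admissible Om. K' \<mu> = K \<mu>)"
    and K_continuous: "\<And>\<mu>s \<mu>. (\<And>j::nat. \<mu>s j \<in> admissible Om) \<Longrightarrow> \<mu> \<in> admissible Om \<Longrightarrow>
      (AE t in lebesgue_on {0..1}. weak_star_tendsto Om (\<lambda>j. \<mu>s j t) (\<mu> t)) \<Longrightarrow>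
      weak_tendsto (\<lambda>j. K (\<mu>s j)) (K \<mu>)"
  shows "\<exists>\<mu>opt \<in> admissible Om.
    (\<forall>\<mu>\<in>admissible Om. F (K \<mu>opt) + ereal (regularizer Om \<alpha> \<beta> \<mu>opt)
      \<le> F (K \<mu>) + ereal (regularizer Om \<alpha> \<beta> \<mu>)) \<and>
    (\<exists>N c x. N \<le> CARD('m) \<and>
      (\<forall>i\<in>{1..N}. 0 \<le> c i \<and> x i \<in> BV_curves Om dist) \<and>
      (AE t in lebesgue_on {0..1}. \<mu>opt t = (\<lambda>\<phi>. \<Sum>i=1..N. c i * dirac Om (x i t) \<phi>)))"
proof -
  interpret observation Om K \<alpha> \<beta>
    by unfold_locales (use assms in \<open>blast+\<close>)
  obtain c :: "'m \<Rightarrow> real" and x w where c: "\<forall>i. 0 \<le> c i" and x: "path_family Om UNIV x w"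
    and optimal: "\<forall>b z v. (\<forall>i. 0 \<le> b i) \<longrightarrow> path_family Om UNIV z v \<longrightarrow>
      F (K (sparse_curve Om UNIV c x)) + ereal (cost UNIV c w)
        \<le> F (K (sparse_curve Om UNIV b z)) + ereal (cost (UNIV :: 'm set) b v)"
    by (rule sparse_minimizer_exists[OF F_bounded_below F_lsc])
  let ?\<mu> = "sparse_curve Om UNIV c x"
  have sp: "?\<mu> \<in> admissible Om" "regularizer Om \<alpha> \<beta> ?\<mu> \<le> cost UNIV c w"
    using sparse_admissible[OF _ _ compact nonempty _ x less_imp_le[OF \<beta>], of c] c by (simp_all add: cost_def)
  show ?thesis
  proof (intro bexI[of _ ?\<mu>] conjI ballI)
    show "?\<mu> \<in> admissible Om" by (rule sp(1))
    fix \<mu> assume \<mu>: "\<mu> \<in> admissible Om"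
    show "F (K ?\<mu>) + ereal (regularizer Om \<alpha> \<beta> ?\<mu>) \<le> F (K \<mu>) + ereal (regularizer Om \<alpha> \<beta> \<mu>)"
    proof (rule ereal_le_epsilon2)
      fix e :: real assume e: "0 < e"
      obtain b :: "'m \<Rightarrow> real" and z v where b: "\<forall>i. 0 \<le> b i" "path_family Om UNIV z v"
        "K (sparse_curve Om UNIV b z) = K \<mu>" "cost UNIV b v \<le> regularizer Om \<alpha> \<beta> \<mu> + e"
      proof (rule sparse_replacement[OF \<mu>])
        show "regularizer Om \<alpha> \<beta> \<mu> < regularizer Om \<alpha> \<beta> \<mu> + e" using e by simp
      qed
      have "F (K ?\<mu>) + ereal (regularizer Om \<alpha> \<beta> ?\<mu>) \<le> F (K ?\<mu>) + ereal (cost UNIV c w)"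
        using sp(2) by (intro add_left_mono) simp
      also have "\<dots> \<le> F (K \<mu>) + ereal (cost UNIV b v)" using optimal b by metis
      also have "\<dots> \<le> F (K \<mu>) + ereal (regularizer Om \<alpha> \<beta> \<mu> + e)"
        using b(4) by (intro add_left_mono) simp
      finally show "F (K ?\<mu>) + ereal (regularizer Om \<alpha> \<beta> ?\<mu>)
          \<le> F (K \<mu>) + ereal (regularizer Om \<alpha> \<beta> \<mu>) + ereal e"
        by (simp add: add.assoc)
    qed
  next
    obtain h :: "nat \<Rightarrow> 'm" where h: "bij_betw h {1..CARD('m)} UNIV"
      using ex_bij_betw_nat_finite_1[of "UNIV :: 'm set"] by auto
    show "\<exists>N c x. N \<le> CARD('m) \<and> (\<forall>i\<in>{1..N}. 0 \<le> c i \<and> x i \<in> BV_curves Om dist) \<and>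
      (AE t in lebesgue_on {0..1}. ?\<mu> t = (\<lambda>\<phi>. \<Sum>i=1..N. c i * dirac Om (x i t) \<phi>))"
    proof (intro exI[of _ "CARD('m)"] exI[of _ "\<lambda>i. c (h i)"] exI[of _ "\<lambda>i. x (h i)"] conjI ballI)
      show "x (h i) \<in> BV_curves Om dist" for i using path_in_BV_curves[OF x _ compact] by simp
      have "?\<mu> t = (\<lambda>\<phi>. \<Sum>i=1..CARD('m). c (h i) * dirac Om (x (h i) t) \<phi>)" for t
        unfolding sparse_curve_def
        by (rule ext, rule sum.reindex_bij_betw[OF h, symmetric])
      then show "AE t in lebesgue_on {0..1}. ?\<mu> t = (\<lambda>\<phi>. \<Sum>i=1..CARD('m). c (h i) * dirac Om (x (h i) t) \<phi>)"
        by simp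
    qed (use c in auto)
  qed
qed

end
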